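(* Let $1\le r \le 2$, and define the maximal function $M_r h(x) := \big(M(|h|^r)(x)\big)^{1/r}$, where $M$ is the Hardy--Littlewood maximal function on $\mathbb{R}^2$. Let $1 \le p < \frac{4}{3}$ and let $1\le q\le\infty$ satisfy $p' \ge 3q$. Then there is a constant $C = C_{p,r}$ such that $$\|M_r(\widehat{f})\|_{L^q(\mathbb{S}^1)} \le C \|f\|_{L^p(\mathbb{R}^2)}$$ for all Schwartz functions $f\in\mathcal{S}(\mathbb{R}^2)$.
   Context: The Hardy--Littlewood maximal function is $Mf(x) = \sup_{\rho>0} \frac{1}{|B(x,\rho)|}\int_{B(x,\rho)} |f|$, with $B(x,\rho)$ the ball of radius $\rho$ centered at $x$. The Fourier transform is $\widehat{f}(\xi) = \int_{\mathbb{R}^d} e^{-2\pi i x\cdot \xi} f(x)\,dx$. The circle $\mathbb{S}^1\subset\mathbb{R}^2$ is equipped with arc-length measure. $p'$ denotes the conjugate exponent, $1/p+1/p'=1$. *)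

theory Defs
  imports "HOL-Analysis.Analysis" "HOL-Probability.Essential_Supremum"
begin

definition partial_deriv :: "'n::finite \<Rightarrow> (real^'n \<Rightarrow> 'b::real_normed_vector) \<Rightarrow> real^'n \<Rightarrow> 'b" where
  "partial_deriv i f x = vector_derivative (\<lambda>t. f (x + t *\<^sub>R axis i 1)) (at 0)"

definition iter_partial_deriv ::
    "'n::finite list \<Rightarrow> (real^'n \<Rightarrow> 'b::real_normed_vector) \<Rightarrow> real^'n \<Rightarrow> 'b" where
  "iter_partial_deriv is f = foldr partial_deriv is f"

text \<open>
  The list \<open>is\<close> ranges over all finite sequences of directions, so the first conjunct says that
  \<open>f\<close> is infinitely differentiable: since each iterated partial derivative is itself differentiable
  everywhere, all of them exist and are continuous. For such \<open>f\<close> the order of the directions in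
  \<open>is\<close> is irrelevant and the second conjunct is the boundedness of all
  \<open>x\<^sup>\<alpha> \<partial>\<^sup>\<beta> f\<close> over multi-indices \<open>\<alpha>\<close>, \<open>\<beta>\<close>.
\<close>

definition schwartz :: "(real^'n::finite \<Rightarrow> 'b::real_normed_vector) \<Rightarrow> bool" where
  "schwartz f \<longleftrightarrow>
     (\<forall>is x. iter_partial_deriv is f differentiable (at x)) \<and>
     (\<forall>\<alpha> is. bounded (range (\<lambda>x. (\<Prod>j\<in>UNIV. (x $ j) ^ \<alpha> j) *\<^sub>R iter_partial_deriv is f x)))"

definition fourier :: "('a::euclidean_space \<Rightarrow> complex) \<Rightarrow> 'a \<Rightarrow> complex" where
  "fourier f \<xi> = (\<integral>x. exp (- 2 * complex_of_real pi * \<i> * complex_of_real (x \<bullet> \<xi>)) * f x \<partial>lborel)"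

text \<open>Only used for positive exponents, for which \<open>\<infinity>\<^sup>s = \<infinity>\<close> and \<open>0\<^sup>s = 0\<close>.\<close>

definition ennreal_powr :: "ennreal \<Rightarrow> real \<Rightarrow> ennreal" where
  "ennreal_powr x s = (if x = \<infinity> then \<infinity> else ennreal (enn2real x powr s))"

definition hl_maximal :: "('a::euclidean_space \<Rightarrow> 'b::real_normed_vector) \<Rightarrow> 'a \<Rightarrow> ennreal" where
  "hl_maximal f x =
     (SUP \<rho>\<in>{0<..}. (1 / emeasure lborel (ball x \<rho>)) * (\<integral>\<^sup>+y\<in>ball x \<rho>. ennreal (norm (f y)) \<partial>lborel))"

definition hl_maximal_powr ::
    "real \<Rightarrow> ('a::euclidean_space \<Rightarrow> 'b::real_normed_vector) \<Rightarrow> 'a \<Rightarrow> ennreal" where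
  "hl_maximal_powr r h x = ennreal_powr (hl_maximal (\<lambda>y. norm (h y) powr r) x) (1 / r)"

text \<open>The \<open>L\<^sup>q\<close> norm, for \<open>1 \<le> q \<le> \<infinity>\<close>, of a function given by its (extended nonnegative) modulus.\<close>

definition L_norm :: "ennreal \<Rightarrow> 'a measure \<Rightarrow> ('a \<Rightarrow> ennreal) \<Rightarrow> ennreal" where
  "L_norm q M g =
     (if q = \<infinity> then esssup M g
      else ennreal_powr (\<integral>\<^sup>+x. ennreal_powr (g x) (enn2real q) \<partial>M) (1 / enn2real q))"

text \<open>Arc length on the unit circle, as the image of Lebesgue measure under the unit-speed
  parametrization.\<close>

definition circle_measure :: "(real^2) measure" where
  "circle_measure =
     distr (restrict_space lborel {0..<2 * pi}) (restrict_space borel (sphere 0 1))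
       (\<lambda>t. vector [cos t, sin t])"

lemma circle_param_measurable:
  "(\<lambda>t. vector [cos t, sin t] :: real^2) \<in>
     restrict_space lborel {0..<2 * pi} \<rightarrow>\<^sub>M restrict_space borel (sphere 0 1)"
proof (rule measurable_restrict_space2)
  show "(\<lambda>t. vector [cos t, sin t] :: real^2) \<in>
      space (restrict_space lborel {0..<2 * pi}) \<rightarrow> sphere 0 1"
    by (auto simp: norm_vec_def L2_set_def sum_2)
  have "continuous_on UNIV (\<lambda>t. vector [cos t, sin t] :: real^2)"
    by (subst continuous_on_componentwise)
      (auto simp: Basis_vec_def inner_axis forall_2 intro!: continuous_intros)
  then have "(\<lambda>t. vector [cos t, sin t] :: real^2) \<in> borel \<rightarrow>\<^sub>M borel"
    by (rule borel_measurable_continuous_onI)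
  then show "(\<lambda>t. vector [cos t, sin t] :: real^2) \<in> restrict_space lborel {0..<2 * pi} \<rightarrow>\<^sub>M borel"
    by (intro measurable_restrict_space1) simp
qed

lemma space_circle_measure: "space circle_measure = sphere 0 1"
  by (simp add: circle_measure_def space_restrict_space)

lemma emeasure_circle_measure: "emeasure circle_measure (sphere 0 1) = ennreal (2 * pi)"
proof -
  let ?I = "restrict_space lborel {0..<2 * pi}"
  have S: "sphere 0 1 \<in> sets (restrict_space borel (sphere (0::real^2) 1))"
    using sets.top[of "restrict_space borel (sphere (0::real^2) 1)"]
    by (simp add: space_restrict_space)
  have "(\<lambda>t. vector [cos t, sin t] :: real^2) -` sphere 0 1 \<inter> space ?I = space ?I"
    using measurable_space[OF circle_param_measurable] by (auto simp: space_restrict_space simp del: mem_sphere)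
  then have "emeasure circle_measure (sphere 0 1) = emeasure ?I (space ?I)"
    unfolding circle_measure_def by (simp add: emeasure_distr[OF circle_param_measurable S])
  then show ?thesis
    by (simp add: space_restrict_space emeasure_restrict_space)
qed

end

theory Submission
  imports Defs "HOL-Probability.Characteristic_Functions" "HOL-Probability.Sinc_Integral"
begin

text \<open>
  For \<open>p = 1\<close> the Fourier transform is bounded by the norm of \<open>f\<close>.
  Otherwise, by convexity, it suffices to treat \<open>r = 2\<close> and the largest exponent \<open>q = p' / 3\<close>;
  write \<open>s = p' / 2 > 2\<close> and let \<open>s'\<close> be conjugate to \<open>s\<close>.
  Let \<open>F\<close> be the Fourier transform of \<open>f\<close>. Choosing a radius \<open>\<rho>(x)\<close> for each point \<open>x\<close> of the circle, a weighted
  integral of the averages of \<open>\<bar>F\<bar>\<^sup>2\<close> over \<open>B(x, \<rho>(x))\<close> is the pairing of \<open>F\<close> with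
  \<open>G(u) = cnj F(u) \<integral> w(x) 1\<^bsub>B(x, \<rho>(x))\<^esub>(u) / \<bar>B(x, \<rho>(x))\<bar> d\<sigma>(x)\<close>, hence of \<open>f\<close> with the Fourier transform of
  \<open>G\<close>, whose square is the Fourier transform of \<open>G * G\<close>. Hausdorff--Young reduces the claim to an
  \<open>L\<^bsup>s'\<^esup>\<close> bound for \<open>G * G\<close>. Paired with \<open>h \<in> L\<^sup>s\<close>, the contribution of two points \<open>x\<close>, \<open>y\<close> to \<open>G * G\<close> is at most
  \<open>g(x) g(y) (M(h\<^sup>2)(x + y))\<^bsup>1/2\<^esup>\<close> up to a constant, where \<open>g\<close> is the weight times the quadratic average: the smaller
  disc only shifts the larger one inside its double. As \<open>s > 2\<close>, the operator \<open>h \<mapsto> (M(h\<^sup>2))\<^bsup>1/2\<^esup>\<close> is bounded on \<open>L\<^sup>s\<close>,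
  and what remains is the classical estimate for \<open>g d\<sigma> * g d\<sigma>\<close>: the map \<open>(x, y) \<mapsto> x + y\<close> is at most two-to-one with
  Jacobian \<open>\<bar>sin\<bar>\<close> of the angle between \<open>x\<close> and \<open>y\<close>, and the resulting singular integral is bounded by the
  Hardy--Littlewood--Sobolev inequality.
\<close>

section \<open>Integral inequalities\<close>

text \<open>All exponents come from the relation p' = 2s. Then |fourier G|^(2s) = |fourier (G *
  G)|^s, the condition p < 4/3 says exactly s > 2, p is \<open>2 * s / (2 * s - 1)\<close>, the
  endpoint q is \<open>2 * s / 3\<close>, and \<open>2 * s / (2 * s - 3)\<close> is its conjugate.
  The obstacle is that thickening each point of the circle to a disc of its own radius destroys the
  exact arc measure, and the radius depends on the point with no regularity. What survives is
  positivity: after passing to |G| * |G| only sizes matter, and two discs of arbitrary radii cost no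
  more than a quadratic maximal function. Its boundedness on L^s asks for s > 2, which the estimate
  for arc measure asks for as well, so no part of the range is lost. Two inequalities arise in the
  form Z <= C Z^theta with theta < 1, which bounds Z only if Z is finite. Hence radii stay in a
  compact part of (0, infinity), weights are bounded, and limits are taken by Fatou's lemma after
  the uniform bound. Constants are explicit in s, hence depend on p alone, and blow up as s tends to
  2.\<close>

lemma nn_integral_Holder:
  fixes f g :: "'a \<Rightarrow> real" and p q A B :: real
  assumes [measurable]: "f \<in> borel_measurable M" "g \<in> borel_measurable M"
    and "\<And>x. 0 \<le> f x" "\<And>x. 0 \<le> g x" and pq: "1 < p" "1 < q" "1 / p + 1 / q = 1"
    and "0 \<le> A" "0 \<le> B"
    and f: "(\<integral>\<^sup>+x. ennreal (f x powr p) \<partial>M) \<le> ennreal (A powr p)"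
    and g: "(\<integral>\<^sup>+x. ennreal (g x powr q) \<partial>M) \<le> ennreal (B powr q)"
  shows "(\<integral>\<^sup>+x. ennreal (f x * g x) \<partial>M) \<le> ennreal (A * B)"
proof -
  \<comment> \<open>Young's inequality is applied to f / a and g / b with a, b strictly above A, B.
    Letting a and b decrease afterwards covers A = 0 or B = 0 without a case split.\<close>
  have pos: "(\<integral>\<^sup>+x. ennreal (f x * g x) \<partial>M) \<le> ennreal (a * b)" if "A < a" "B < b" for a b
  proof -
    have a: "0 < a" "0 < b" using that assms by auto
    have pt: "f x * g x \<le> a * b * (a powr (- p) / p * f x powr p + b powr (- q) / q * g x powr q)" for x
    proof -
      have "(f x / a) * (g x / b) \<le> (f x / a) powr p / p + (g x / b) powr q / q"
        using a assms by (intro Youngs_inequality) auto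
      then show ?thesis using a assms
        by (simp add: powr_divide powr_minus field_simps)
    qed
    have "(\<integral>\<^sup>+x. ennreal (f x * g x) \<partial>M) \<le>
      (\<integral>\<^sup>+x. ennreal (a * b * a powr (- p) / p) * ennreal (f x powr p)
          + ennreal (a * b * b powr (- q) / q) * ennreal (g x powr q) \<partial>M)"
      using pt a pq
      by (intro nn_integral_mono) (auto simp: ennreal_mult[symmetric] ennreal_plus[symmetric] algebra_simps
        simp del: ennreal_plus intro!: ennreal_leI)
    also have "\<dots> = ennreal (a * b * a powr (- p) / p) * (\<integral>\<^sup>+x. ennreal (f x powr p) \<partial>M)
          + ennreal (a * b * b powr (- q) / q) * (\<integral>\<^sup>+x. ennreal (g x powr q) \<partial>M)"
      by (subst nn_integral_add) (auto simp: nn_integral_cmult)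
    also have "\<dots> \<le> ennreal (a * b * a powr (- p) / p) * ennreal (a powr p)
          + ennreal (a * b * b powr (- q) / q) * ennreal (b powr q)"
      using that assms a by (intro add_mono mult_left_mono order.trans[OF f] order.trans[OF g] ennreal_leI powr_mono2) auto
    also have "\<dots> = ennreal (a * b * a powr (- p) / p * a powr p + a * b * b powr (- q) / q * b powr q)"
      using a pq by (simp add: ennreal_mult[symmetric] ennreal_plus[symmetric] del: ennreal_plus)
    also have "a * b * a powr (- p) / p * a powr p + a * b * b powr (- q) / q * b powr q = a * b * (1 / p + 1 / q)"
      using a by (simp add: powr_minus field_simps)
    finally show ?thesis using pq by simp
  qed
  have lim: "((\<lambda>\<epsilon>. ennreal ((A + \<epsilon>) * (B + \<epsilon>))) \<longlongrightarrow> ennreal ((A + 0) * (B + 0))) (at_right 0)"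
    by (intro tendsto_intros)
  have "(\<integral>\<^sup>+x. ennreal (f x * g x) \<partial>M) \<le> ennreal ((A + 0) * (B + 0))"
  proof (rule tendsto_lowerbound[OF lim])
    show "\<forall>\<^sub>F \<epsilon> in at_right 0. (\<integral>\<^sup>+x. ennreal (f x * g x) \<partial>M) \<le> ennreal ((A + \<epsilon>) * (B + \<epsilon>))"
      using pos by (intro eventually_at_rightI[of 0 1]) auto
  qed simp
  then show ?thesis by simp
qed

section \<open>Power integrals and the layer-cake formula\<close>

lemma nn_integral_powr_Icc_0:
  fixes m y :: real
  assumes "0 < m" "0 \<le> y"
  shows "(\<integral>\<^sup>+x. ennreal (x powr (m - 1)) * indicator {0..y} x \<partial>lborel) = ennreal (y powr m / m)"
  using nn_integral_has_integral_lebesgue'[OF _ has_integral_powr_from_0[of "m - 1" y]] assms by simp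

lemma nn_integral_powr_Ici:
  fixes b y :: real
  assumes "0 < b" "0 < y"
  shows "(\<integral>\<^sup>+x. ennreal (x powr (- b - 1)) * indicator {y..} x \<partial>lborel) = ennreal (y powr (- b) / b)"
  using nn_integral_has_integral_lebesgue'[OF _ has_integral_powr_to_inf[of "- b - 1" y]] assms
  by simp

lemma nn_integral_powr_Ioo_0:
  fixes m y :: real
  assumes "0 < m" "0 \<le> y"
  shows "(\<integral>\<^sup>+x. ennreal (x powr (m - 1)) * indicator {0<..<y} x \<partial>lborel) = ennreal (y powr m / m)"
proof -
  have "AE x in lborel. x \<noteq> y" "AE x in lborel. x \<noteq> 0" by (rule AE_lborel_singleton)+
  then have "AE x in lborel. ennreal (x powr (m - 1)) * indicator {0<..<y} x
      = ennreal (x powr (m - 1)) * indicator {0..y} x"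
    by eventually_elim (auto simp: indicator_def)
  then show ?thesis
    using nn_integral_powr_Icc_0[OF assms] by (subst nn_integral_cong_AE) auto
qed

lemma layer_cake_powr:
  fixes f :: "'a \<Rightarrow> real"
  assumes "sigma_finite_measure M" and [measurable]: "f \<in> borel_measurable M"
    and f: "\<And>x. 0 \<le> f x" and m: "0 < m"
  shows "(\<integral>\<^sup>+x. ennreal (f x powr m) \<partial>M) =
    (\<integral>\<^sup>+l. ennreal (m * l powr (m - 1)) * indicator {0<..} l * emeasure M {x\<in>space M. l < f x} \<partial>lborel)"
proof -
  interpret sigma_finite_measure M by fact
  interpret pair_sigma_finite M lborel ..
  have "(\<integral>\<^sup>+x. ennreal (f x powr m) \<partial>M) =
      (\<integral>\<^sup>+x. \<integral>\<^sup>+l. ennreal (m * l powr (m - 1)) * indicator {0<..} l * (if l < f x then 1 else 0) \<partial>lborel \<partial>M)"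
  proof (rule nn_integral_cong)
    fix x
    have "(\<integral>\<^sup>+l. ennreal (m * l powr (m - 1)) * indicator {0<..} l * (if l < f x then 1 else 0) \<partial>lborel)
       = (\<integral>\<^sup>+l. ennreal m * (ennreal (l powr (m - 1)) * indicator {0<..<f x} l) \<partial>lborel)"
      using m by (intro nn_integral_cong) (auto simp: indicator_def ennreal_mult)
    also have "\<dots> = ennreal (f x powr m)"
      using m f by (simp add: nn_integral_cmult nn_integral_powr_Ioo_0 ennreal_mult[symmetric])
    finally show "ennreal (f x powr m) =
       (\<integral>\<^sup>+l. ennreal (m * l powr (m - 1)) * indicator {0<..} l * (if l < f x then 1 else 0) \<partial>lborel)" ..
  qed
  also have "\<dots> = (\<integral>\<^sup>+l. \<integral>\<^sup>+x. ennreal (m * l powr (m - 1)) * indicator {0<..} l * (if l < f x then 1 else 0) \<partial>M \<partial>lborel)"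
    by (intro Fubini'[symmetric]) simp
  also have "\<dots> = (\<integral>\<^sup>+l. ennreal (m * l powr (m - 1)) * indicator {0<..} l * emeasure M {x\<in>space M. l < f x} \<partial>lborel)"
  proof (rule nn_integral_cong)
    fix l :: real
    have "(\<integral>\<^sup>+x. (if l < f x then 1 else 0) \<partial>M) = (\<integral>\<^sup>+x. indicator {x\<in>space M. l < f x} x \<partial>M)"
      by (intro nn_integral_cong) (auto simp: indicator_def)
    also have "\<dots> = emeasure M {x\<in>space M. l < f x}"
      by (rule nn_integral_indicator) simp
    finally show "(\<integral>\<^sup>+x. ennreal (m * l powr (m - 1)) * indicator {0<..} l * (if l < f x then 1 else 0) \<partial>M)
       = ennreal (m * l powr (m - 1)) * indicator {0<..} l * emeasure M {x\<in>space M. l < f x}"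
      by (simp add: nn_integral_cmult)
  qed
  finally show ?thesis .
qed

text \<open>The common core of two real interpolation arguments: the maximal theorem (j = 1,
  \<open>W\<close> = |f|) and Hausdorff--Young (j = 2, \<open>W\<close> = |f|^2). The set
  \<open>l \<le> Y x\<close> is where the part of the function that matters at level l lives. After
  Tonelli the l-integral is that of l^(m-j-1) over (0, Y x], which converges because j < m.\<close>

lemma weak_type_layer_cake:
  fixes f :: "'a \<Rightarrow> real" and W Y :: "'b \<Rightarrow> real"
  assumes M: "sigma_finite_measure M" and N: "sigma_finite_measure N"
    and [measurable]: "f \<in> borel_measurable M" "W \<in> borel_measurable N" "Y \<in> borel_measurable N"
    and f: "\<And>x. 0 \<le> f x" and W: "\<And>x. 0 \<le> W x" and Y: "\<And>x. 0 \<le> Y x"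
    and m: "0 \<le> j" "j < m" and c: "0 \<le> c"
    and weak: "\<And>l. 0 < l \<Longrightarrow> emeasure M {x\<in>space M. l < f x} \<le>
       ennreal (c * l powr (- j)) * (\<integral>\<^sup>+x. ennreal (W x) * indicator {x. l \<le> Y x} x \<partial>N)"
  shows "(\<integral>\<^sup>+x. ennreal (f x powr m) \<partial>M) \<le> ennreal (c * m / (m - j)) * (\<integral>\<^sup>+x. ennreal (W x * Y x powr (m - j)) \<partial>N)"
proof -
  interpret sigma_finite_measure N by fact
  interpret pair_sigma_finite N lborel ..
  have "(\<integral>\<^sup>+x. ennreal (f x powr m) \<partial>M) =
    (\<integral>\<^sup>+l. ennreal (m * l powr (m - 1)) * indicator {0<..} l * emeasure M {x\<in>space M. l < f x} \<partial>lborel)"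
    using m by (intro layer_cake_powr M f) auto
  also have "\<dots> \<le> (\<integral>\<^sup>+l. \<integral>\<^sup>+x. ennreal (c * m * l powr (m - j - 1)) * indicator {0<..} l * 
      (ennreal (W x) * (if l \<le> Y x then 1 else 0)) \<partial>N \<partial>lborel)"
  proof (rule nn_integral_mono)
    fix l :: real
    show "ennreal (m * l powr (m - 1)) * indicator {0<..} l * emeasure M {x\<in>space M. l < f x}
      \<le> (\<integral>\<^sup>+x. ennreal (c * m * l powr (m - j - 1)) * indicator {0<..} l * 
      (ennreal (W x) * (if l \<le> Y x then 1 else 0)) \<partial>N)"
    proof (cases "0 < l")
      case True
      have e: "(\<integral>\<^sup>+x. ennreal (W x) * indicator {x. l \<le> Y x} x \<partial>N) = (\<integral>\<^sup>+x. ennreal (W x) * (if l \<le> Y x then 1 else 0) \<partial>N)"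
        by (intro nn_integral_cong) (auto simp: indicator_def)
      have "ennreal (m * l powr (m - 1)) * emeasure M {x\<in>space M. l < f x} \<le>
        ennreal (m * l powr (m - 1)) * (ennreal (c * l powr (- j)) * (\<integral>\<^sup>+x. ennreal (W x) * indicator {x. l \<le> Y x} x \<partial>N))"
        using weak[OF True] by (intro mult_left_mono) auto
      also have "\<dots> = ennreal (c * m * l powr (m - j - 1)) * (\<integral>\<^sup>+x. ennreal (W x) * indicator {x. l \<le> Y x} x \<partial>N)"
      proof -
        have "m * l powr (m - 1) * (c * l powr (- j)) = c * m * (l powr (m - 1) * l powr (- j))"
          by simp
        also have "l powr (m - 1) * l powr (- j) = l powr (m - j - 1)"
          by (simp add: powr_add[symmetric] algebra_simps)
        finally have "ennreal (m * l powr (m - 1)) * ennreal (c * l powr (- j)) = ennreal (c * m * l powr (m - j - 1))"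
          using m c by (subst ennreal_mult[symmetric]) auto
        then show ?thesis by (simp only: mult.assoc[symmetric])
      qed
      also have "\<dots> = (\<integral>\<^sup>+x. ennreal (c * m * l powr (m - j - 1)) * indicator {0<..} l * 
          (ennreal (W x) * (if l \<le> Y x then 1 else 0)) \<partial>N)"
        unfolding e using True by (subst nn_integral_cmult[symmetric]) auto
      finally show ?thesis using True by simp
    qed auto
  qed
  also have "\<dots> = (\<integral>\<^sup>+x. \<integral>\<^sup>+l. ennreal (c * m * l powr (m - j - 1)) * indicator {0<..} l * 
      (ennreal (W x) * (if l \<le> Y x then 1 else 0)) \<partial>lborel \<partial>N)"
    by (intro Fubini') simp
  also have "\<dots> \<le> (\<integral>\<^sup>+x. ennreal (c * m / (m - j)) * ennreal (W x * Y x powr (m - j)) \<partial>N)"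
  proof (rule nn_integral_mono)
    fix x
    have "(\<integral>\<^sup>+l. ennreal (c * m * l powr (m - j - 1)) * indicator {0<..} l * 
        (ennreal (W x) * (if l \<le> Y x then 1 else 0)) \<partial>lborel)
       \<le> (\<integral>\<^sup>+l. ennreal (c * m * W x) * (ennreal (l powr (m - j - 1)) * indicator {0..Y x} l) \<partial>lborel)"
      using m c W by (intro nn_integral_mono) (auto simp: indicator_def ennreal_mult mult_ac)
    also have "\<dots> = ennreal (c * m * W x) * ennreal (Y x powr (m - j) / (m - j))"
      using m Y by (simp add: nn_integral_cmult nn_integral_powr_Icc_0)
    also have "\<dots> = ennreal (c * m / (m - j)) * ennreal (W x * Y x powr (m - j))"
      using m c W by (simp add: ennreal_mult[symmetric] field_simps)
    finally show "(\<integral>\<^sup>+l. ennreal (c * m * l powr (m - j - 1)) * indicator {0<..} l * 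
        (ennreal (W x) * (if l \<le> Y x then 1 else 0)) \<partial>lborel) \<le> ennreal (c * m / (m - j)) * ennreal (W x * Y x powr (m - j))" .
  qed
  also have "\<dots> = ennreal (c * m / (m - j)) * (\<integral>\<^sup>+x. ennreal (W x * Y x powr (m - j)) \<partial>N)"
    by (intro nn_integral_cmult) auto
  finally show ?thesis .
qed

section \<open>Translations and reflections of Lebesgue measure\<close>

lemma lborel_distr_affine:
  fixes t :: "'a::euclidean_space" and c :: real
  assumes "\<bar>c\<bar> = 1"
  shows "distr lborel borel (\<lambda>x. t + c *\<^sub>R x) = (lborel :: 'a measure)"
  using lborel_affine[of c t] assms by (auto simp: density_1)

lemma nn_integral_lborel_plus:
  fixes f :: "'a::euclidean_space \<Rightarrow> ennreal"
  assumes "f \<in> borel_measurable borel"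
  shows "(\<integral>\<^sup>+x. f (t + x) \<partial>lborel) = (\<integral>\<^sup>+x. f x \<partial>lborel)"
  using nn_integral_distr[of "\<lambda>x. t + 1 *\<^sub>R x" lborel borel f] assms lborel_distr_affine[of 1 t] by auto

lemma nn_integral_lborel_minus:
  fixes f :: "'a::euclidean_space \<Rightarrow> ennreal"
  assumes "f \<in> borel_measurable borel"
  shows "(\<integral>\<^sup>+x. f (t - x) \<partial>lborel) = (\<integral>\<^sup>+x. f x \<partial>lborel)"
  using nn_integral_distr[of "\<lambda>x. t + (-1) *\<^sub>R x" lborel borel f] assms lborel_distr_affine[of "-1" t] by auto

lemma lborel_integral_plus:
  fixes f :: "'a::euclidean_space \<Rightarrow> 'b::{banach, second_countable_topology}"
  assumes "f \<in> borel_measurable borel"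
  shows "(\<integral>x. f (t + x) \<partial>lborel) = (\<integral>x. f x \<partial>lborel)"
  using integral_distr[of "\<lambda>x. t + 1 *\<^sub>R x" lborel borel f] assms lborel_distr_affine[of 1 t] by auto

lemma nn_integral_swap_lborel:
  fixes f :: "'a::euclidean_space \<Rightarrow> 'b::euclidean_space \<Rightarrow> ennreal"
  assumes "(\<lambda>(x, y). f x y) \<in> borel_measurable (lborel \<Otimes>\<^sub>M lborel)"
  shows "(\<integral>\<^sup>+x. \<integral>\<^sup>+y. f x y \<partial>lborel \<partial>lborel) = (\<integral>\<^sup>+y. \<integral>\<^sup>+x. f x y \<partial>lborel \<partial>lborel)"
  using lborel_pair.Fubini'[OF assms] by simp

section \<open>The Hardy--Littlewood maximal theorem\<close>

lemma emeasure_ball_pos: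
  assumes "0 < \<rho>"
  shows "0 < emeasure lborel (ball (x::'a::euclidean_space) \<rho>)"
  using assms by (simp add: emeasure_ball)

definition ball_avg :: "('a::euclidean_space \<Rightarrow> 'b::real_normed_vector) \<Rightarrow> 'a \<Rightarrow> real \<Rightarrow> ennreal" where
  "ball_avg f x \<rho> = (1 / emeasure lborel (ball x \<rho>)) * (\<integral>\<^sup>+y\<in>ball x \<rho>. ennreal (norm (f y)) \<partial>lborel)"

lemma hl_maximal_ball_avg: "hl_maximal f x = (SUP \<rho>\<in>{0<..}. ball_avg f x \<rho>)"
  by (simp add: hl_maximal_def ball_avg_def)

lemma ball_avg_le_hl_maximal: "0 < \<rho> \<Longrightarrow> ball_avg f x \<rho> \<le> hl_maximal f x"
  unfolding hl_maximal_ball_avg by (rule SUP_upper) auto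

lemma emeasure_times_ball_avg:
  assumes "0 < \<rho>"
  shows "emeasure lborel (ball x \<rho>) * ball_avg f x \<rho> = (\<integral>\<^sup>+y\<in>ball x \<rho>. ennreal (norm (f y)) \<partial>lborel)"
proof -
  have "emeasure lborel (ball x \<rho>) * (1 / emeasure lborel (ball x \<rho>)) = 1"
    using emeasure_ball_pos[OF assms, of x] emeasure_lborel_ball_finite[of x \<rho>]
    by (simp add: ennreal_times_divide ennreal_divide_self)
  then show ?thesis unfolding ball_avg_def by (simp add: mult.assoc[symmetric])
qed

lemma ball_avg_le_iff:
  assumes "0 < \<rho>"
  shows "ball_avg f x \<rho> \<le> c \<longleftrightarrow> (\<integral>\<^sup>+y\<in>ball x \<rho>. ennreal (norm (f y)) \<partial>lborel) \<le> emeasure lborel (ball x \<rho>) * c"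
proof
  assume "(\<integral>\<^sup>+y\<in>ball x \<rho>. ennreal (norm (f y)) \<partial>lborel) \<le> emeasure lborel (ball x \<rho>) * c"
  then have "emeasure lborel (ball x \<rho>) * ball_avg f x \<rho> \<le> emeasure lborel (ball x \<rho>) * c"
    using emeasure_times_ball_avg[OF assms, of x f] by simp
  then show "ball_avg f x \<rho> \<le> c"
    using emeasure_ball_pos[OF assms, of x] emeasure_lborel_ball_finite[of x \<rho>]
    by (subst (asm) ennreal_mult_le_mult_iff) auto
qed (simp add: emeasure_times_ball_avg[OF assms, symmetric] mult_left_mono)

lemma nn_integral_ball_le_hl_maximal:
  assumes "0 < \<rho>"
  shows "(\<integral>\<^sup>+y\<in>ball x \<rho>. ennreal (norm (f y)) \<partial>lborel) \<le> emeasure lborel (ball x \<rho>) * hl_maximal f x"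
  using ball_avg_le_iff[OF assms] ball_avg_le_hl_maximal[OF assms] by blast

text \<open>Continuity from below of the measure with density |f| along increasing balls. The
  normalising volume keeps the radius \<open>\<rho>\<close> while the domain of integration shrinks
  to \<open>\<sigma>\<close>: the gap between the two is room to move the centre or to change the
  radius.\<close>

lemma less_ball_avg_shrink:
  fixes f :: "'a::euclidean_space \<Rightarrow> 'b::real_normed_vector"
  assumes [measurable]: "f \<in> borel_measurable borel" and \<rho>: "0 < \<rho>" and l: "l < ball_avg f x \<rho>"
  obtains \<sigma> where "0 < \<sigma>" "\<sigma> < \<rho>"
    "l < (1 / emeasure lborel (ball x \<rho>)) * (\<integral>\<^sup>+y\<in>ball x \<sigma>. ennreal (norm (f y)) \<partial>lborel)"
proof -
  define N where "N = density lborel (\<lambda>y. ennreal (norm (f y)))"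
  have N: "emeasure N (ball z r) = (\<integral>\<^sup>+y\<in>ball z r. ennreal (norm (f y)) \<partial>lborel)" for z r
    unfolding N_def by (rule emeasure_density) auto
  \<comment> \<open>The offset 2 makes already \<open>r 0\<close> positive.\<close>
  define r where "r n = \<rho> * (1 - 1 / (real n + 2))" for n
  have r: "0 < r n" "r n < \<rho>" for n using \<rho> by (auto simp: r_def field_simps add_pos_nonneg)
  have lim: "r \<longlonglongrightarrow> \<rho>" unfolding r_def by real_asymp
  have "incseq (\<lambda>n. ball x (r n))"
    using \<rho> by (intro monoI subset_ball) (auto simp: r_def frac_le)
  then have "(SUP n. emeasure N (ball x (r n))) = emeasure N (\<Union>n. ball x (r n))"
    by (intro SUP_emeasure_incseq) (auto simp: N_def)
  also have "(\<Union>n. ball x (r n)) = ball x \<rho>"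
  proof (intro equalityI subsetI)
    fix y assume "y \<in> ball x \<rho>"
    then have "\<forall>\<^sub>F n in sequentially. dist x y < r n" using lim by (intro order_tendstoD(1)[OF lim]) auto
    then show "y \<in> (\<Union>n. ball x (r n))" by (auto simp: eventually_sequentially)
  qed (use r in \<open>auto intro: less_trans\<close>)
  finally have "l < (SUP n. (1 / emeasure lborel (ball x \<rho>)) * emeasure N (ball x (r n)))"
    using l unfolding ball_avg_def N[symmetric] by (simp add: SUP_mult_left_ennreal[symmetric])
  then obtain n where "l < (1 / emeasure lborel (ball x \<rho>)) * emeasure N (ball x (r n))"
    by (auto simp: less_SUP_iff)
  with that[of "r n"] r N show thesis by auto
qed

lemma ennreal_inverse_emeasure_ball_mono:
  assumes "\<sigma> \<le> \<rho>"
  shows "1 / emeasure lborel (ball (x::'a::euclidean_space) \<rho>) \<le> 1 / emeasure lborel (ball (y::'a) \<sigma>)"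
proof (cases "0 < \<sigma>")
  case True
  have "\<sigma> ^ DIM('a) \<le> \<rho> ^ DIM('a)" using True assms by (intro power_mono) auto
  then show ?thesis using True assms
    by (simp add: emeasure_ball divide_ennreal frac_le flip: ennreal_1 del: ennreal_1)
\<comment> \<open>For \<open>\<sigma>\<close> \<le> 0 the ball on the right is empty, and 1 / 0 is
  top in \<open>ennreal\<close>.\<close>
qed (simp add: not_less ball_empty)

text \<open>A rational radius between \<open>\<sigma>\<close> and \<open>\<rho>\<close> enlarges
  both the domain of integration and the factor 1 / volume. The countable family of radii is what
  later permits a measurable choice of a nearly optimal radius.\<close>

lemma hl_maximal_Rats:
  fixes f :: "'a::euclidean_space \<Rightarrow> 'b::real_normed_vector"
  assumes [measurable]: "f \<in> borel_measurable borel"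
  shows "hl_maximal f x = (SUP \<rho>\<in>{0<..} \<inter> \<rat>. ball_avg f x \<rho>)"
proof (rule antisym)
  show "hl_maximal f x \<le> (SUP \<rho>\<in>{0<..} \<inter> \<rat>. ball_avg f x \<rho>)"
    unfolding hl_maximal_ball_avg
  proof (rule SUP_least, rule ccontr)
    fix \<rho> :: real assume \<rho>: "\<rho> \<in> {0<..}" and "\<not> ball_avg f x \<rho> \<le> (SUP \<rho>\<in>{0<..} \<inter> \<rat>. ball_avg f x \<rho>)"
    then have l: "(SUP \<rho>\<in>{0<..} \<inter> \<rat>. ball_avg f x \<rho>) < ball_avg f x \<rho>" by simp
    obtain \<sigma> where \<sigma>: "0 < \<sigma>" "\<sigma> < \<rho>" "(SUP \<rho>\<in>{0<..} \<inter> \<rat>. ball_avg f x \<rho>) <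
        (1 / emeasure lborel (ball x \<rho>)) * (\<integral>\<^sup>+y\<in>ball x \<sigma>. ennreal (norm (f y)) \<partial>lborel)"
      using less_ball_avg_shrink[OF assms _ l] \<rho> by auto
    obtain q where q: "q \<in> \<rat>" "\<sigma> < q" "q < \<rho>" using Rats_dense_in_real[OF \<sigma>(2)] by auto
    have "(1 / emeasure lborel (ball x \<rho>)) * (\<integral>\<^sup>+y\<in>ball x \<sigma>. ennreal (norm (f y)) \<partial>lborel) \<le> ball_avg f x q"
      unfolding ball_avg_def using q
      by (intro mult_mono ennreal_inverse_emeasure_ball_mono nn_integral_mono) (auto simp: indicator_def)
    also have "\<dots> \<le> (SUP \<rho>\<in>{0<..} \<inter> \<rat>. ball_avg f x \<rho>)"
      using q \<sigma> by (intro SUP_upper) auto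
    finally show False using \<sigma>(3) by simp
  qed
qed (auto simp: hl_maximal_ball_avg intro: SUP_subset_mono)

text \<open>Lower semicontinuity: a centre z at distance less than \<open>\<rho>\<close> -
  \<open>\<sigma>\<close> from x still has B(x, \<open>\<sigma>\<close>) inside B(z,
  \<open>\<rho>\<close>), and the volume of a ball does not depend on its centre.\<close>

lemma open_hl_maximal_greater:
  fixes f :: "'a::euclidean_space \<Rightarrow> 'b::real_normed_vector"
  assumes [measurable]: "f \<in> borel_measurable borel"
  shows "open {x. l < hl_maximal f x}"
proof (rule openI)
  fix x assume "x \<in> {x. l < hl_maximal f x}"
  then obtain \<rho> where \<rho>: "0 < \<rho>" "l < ball_avg f x \<rho>"
    by (auto simp: hl_maximal_ball_avg less_SUP_iff)
  obtain \<sigma> where \<sigma>: "0 < \<sigma>" "\<sigma> < \<rho>" 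
    "l < (1 / emeasure lborel (ball x \<rho>)) * (\<integral>\<^sup>+y\<in>ball x \<sigma>. ennreal (norm (f y)) \<partial>lborel)"
    using less_ball_avg_shrink[OF assms \<rho>] .
  have "z \<in> {x. l < hl_maximal f x}" if "z \<in> ball x (\<rho> - \<sigma>)" for z
  proof -
    have "y \<in> ball z \<rho>" if "y \<in> ball x \<sigma>" for y
      using that \<open>z \<in> ball x (\<rho> - \<sigma>)\<close> dist_triangle[of z y x] by (auto simp: dist_commute)
    then have "(1 / emeasure lborel (ball x \<rho>)) * (\<integral>\<^sup>+y\<in>ball x \<sigma>. ennreal (norm (f y)) \<partial>lborel) \<le> ball_avg f z \<rho>"
      unfolding ball_avg_def
      by (intro mult_mono ennreal_inverse_emeasure_ball_mono nn_integral_mono) (auto simp: indicator_def)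
    with \<sigma>(3) ball_avg_le_hl_maximal[OF \<rho>(1), of f z] show ?thesis by auto
  qed
  with \<sigma>(2) show "\<exists>e>0. ball x e \<subseteq> {x. l < hl_maximal f x}"
    by (intro exI[of _ "\<rho> - \<sigma>"]) auto
qed

lemma borel_measurable_hl_maximal [measurable]:
  fixes f :: "'a::euclidean_space \<Rightarrow> 'b::real_normed_vector"
  assumes "f \<in> borel_measurable borel"
  shows "hl_maximal f \<in> borel_measurable borel"
  using open_hl_maximal_greater[OF assms] by (intro borel_measurableI_greater) auto

text \<open>Vitali covering. Every point of the superlevel set is the centre of a ball whose
  |f|-mass is at least l times its volume. Disjoint balls among these have total mass at most the
  integral of |f|, and their fivefold dilates cover the set, whence the factor 5 to the
  dimension.\<close>

lemma hl_maximal_weak_type: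
  fixes f :: "'a::euclidean_space \<Rightarrow> 'b::real_normed_vector"
  assumes [measurable]: "f \<in> borel_measurable borel" and l: "0 < l"
  shows "ennreal l * emeasure lborel {x. ennreal l < hl_maximal f x}
    \<le> 5 ^ DIM('a) * (\<integral>\<^sup>+x. ennreal (norm (f x)) \<partial>lborel)"
proof (cases "(\<integral>\<^sup>+x. ennreal (norm (f x)) \<partial>lborel) = \<infinity>")
  case True
  then show ?thesis by (simp add: ennreal_mult_top)
next
  case False
  then obtain A where A: "0 \<le> A" "(\<integral>\<^sup>+x. ennreal (norm (f x)) \<partial>lborel) = ennreal A"
    by (metis ennreal_cases infinity_ennreal_def)
  define S where "S = {x. ennreal l < hl_maximal f x}"
  define N where "N = density lborel (\<lambda>y. ennreal (norm (f y)))"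
  define V where "V = unit_ball_vol (real DIM('a))"
  have V: "0 < V" by (simp add: V_def)
  have N: "emeasure N (ball z r) = (\<integral>\<^sup>+y\<in>ball z r. ennreal (norm (f y)) \<partial>lborel)" for z r
    unfolding N_def by (rule emeasure_density) auto
  have NU: "emeasure N X \<le> ennreal A" for X
  proof -
    have "emeasure N X \<le> emeasure N UNIV" by (rule emeasure_mono) (auto simp: N_def)
    also have "\<dots> = ennreal A" unfolding N_def A(2)[symmetric] by (subst emeasure_density) auto
    finally show ?thesis .
  qed
  have "\<forall>x\<in>S. \<exists>\<rho>>0. ennreal l * emeasure lborel (ball x \<rho>) \<le> emeasure N (ball x \<rho>)"
  proof
    fix x assume "x \<in> S"
    then obtain \<rho> where \<rho>: "0 < \<rho>" "ennreal l < ball_avg f x \<rho>"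
      by (auto simp: S_def hl_maximal_ball_avg less_SUP_iff)
    then have "emeasure lborel (ball x \<rho>) * ennreal l \<le> emeasure lborel (ball x \<rho>) * ball_avg f x \<rho>"
      by (intro mult_left_mono) auto
    then show "\<exists>\<rho>>0. ennreal l * emeasure lborel (ball x \<rho>) \<le> emeasure N (ball x \<rho>)"
      using \<rho> by (intro exI[of _ \<rho>]) (auto simp: emeasure_times_ball_avg N mult.commute[of "ennreal l"])
  qed
  then obtain r where r: "\<And>x. x \<in> S \<Longrightarrow> 0 < r x"
      "\<And>x. x \<in> S \<Longrightarrow> ennreal l * emeasure lborel (ball x (r x)) \<le> emeasure N (ball x (r x))"
    by metis
  \<comment> \<open>The covering lemma needs bounded radii. The mass condition gives l V r^d \<le>
    A, and r \<le> r^d as soon as r \<ge> 1.\<close>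
  have bound: "r x \<le> max 1 (A / (l * V))" if "x \<in> S" for x
  proof (cases "1 \<le> r x")
    case True
    have "ennreal (l * (V * r x ^ DIM('a))) \<le> ennreal A"
      using order.trans[OF r(2)[OF that] NU] r(1)[OF that] l V
      by (simp add: emeasure_ball V_def[symmetric] ennreal_mult[symmetric])
    then have "l * (V * r x ^ DIM('a)) \<le> A" using A by simp
    moreover have "r x ^ 1 \<le> r x ^ DIM('a)" using True by (intro power_increasing) auto
    then have "l * (V * r x) \<le> l * (V * r x ^ DIM('a))" using l V by (intro mult_left_mono) auto
    ultimately have "l * (V * r x) \<le> A" by linarith
    then have "r x * (l * V) \<le> A" by (simp only: ac_simps)
    then have "r x \<le> A / (l * V)" using l V by (simp add: pos_le_divide_eq)
    then show ?thesis by simp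
  qed auto
  have SU: "S \<subseteq> (\<Union>i\<in>S. ball i (r i))" using r(1) by force
  have rb: "\<And>i. i \<in> S \<Longrightarrow> 0 < r i \<and> r i \<le> max 1 (A / (l * V))" using r(1) bound by blast
  then obtain C where C: "countable C" "C \<subseteq> S"
     "pairwise (\<lambda>i j. disjnt (ball i (r i)) (ball j (r j))) C"
     "S \<subseteq> (\<Union>i\<in>C. ball i (5 * r i))"
    using Vitali_covering_lemma_balls[OF SU rb] by blast
  have rC: "0 < r i" if "i \<in> C" for i using r(1) C that by auto
  have "emeasure lborel S \<le> emeasure lborel (\<Union>i\<in>C. ball i (5 * r i))"
    using C by (intro emeasure_mono) (auto intro!: sets.countable_UN'')
  also have "\<dots> = (\<integral>\<^sup>+x. indicator (\<Union>i\<in>C. ball i (5 * r i)) x \<partial>lborel)"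
    using C by (intro nn_integral_indicator[symmetric]) (auto intro!: sets.countable_UN'')
  also have "\<dots> \<le> (\<integral>\<^sup>+x. \<integral>\<^sup>+i. indicator (ball i (5 * r i)) x \<partial>count_space C \<partial>lborel)"
  proof (rule nn_integral_mono)
    fix x :: 'a
    show "indicator (\<Union>i\<in>C. ball i (5 * r i)) x \<le> (\<integral>\<^sup>+i. indicator (ball i (5 * r i)) x \<partial>count_space C)"
    proof (cases "x \<in> (\<Union>i\<in>C. ball i (5 * r i))")
      case True
      then obtain i where i: "i \<in> C" "x \<in> ball i (5 * r i)" by auto
      show ?thesis using nn_integral_ge_point[OF i(1), of "\<lambda>i. indicator (ball i (5 * r i)) x"] i True
        by (auto simp: indicator_def)
    qed auto
  qed
  also have "\<dots> = (\<integral>\<^sup>+i. emeasure lborel (ball i (5 * r i)) \<partial>count_space C)"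
    using C(1) by (subst nn_integral_count_space_nn_integral) (auto intro!: borel_measurable_indicator)
  also have "\<dots> = (\<integral>\<^sup>+i. 5 ^ DIM('a) * emeasure lborel (ball i (r i)) \<partial>count_space C)"
  proof (rule nn_integral_cong)
    fix i assume "i \<in> space (count_space C)"
    then have "0 < r i" using rC by simp
    then have "emeasure lborel (ball i (5 * r i)) = ennreal (5 ^ DIM('a) * (V * r i ^ DIM('a)))"
      by (simp add: emeasure_ball V_def power_mult_distrib mult_ac)
    then show "emeasure lborel (ball i (5 * r i)) = 5 ^ DIM('a) * emeasure lborel (ball i (r i))"
      using \<open>0 < r i\<close> V by (simp add: emeasure_ball V_def[symmetric] ennreal_mult ennreal_power[symmetric])
  qed
  also have "\<dots> = 5 ^ DIM('a) * (\<integral>\<^sup>+i. emeasure lborel (ball i (r i)) \<partial>count_space C)"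
    by (rule nn_integral_cmult) auto
  finally have "ennreal l * emeasure lborel S \<le> 5 ^ DIM('a) * (\<integral>\<^sup>+i. ennreal l * emeasure lborel (ball i (r i)) \<partial>count_space C)"
    by (subst nn_integral_cmult) (auto intro: mult_left_mono simp: mult.left_commute)
  also have "\<dots> \<le> 5 ^ DIM('a) * (\<integral>\<^sup>+i. emeasure N (ball i (r i)) \<partial>count_space C)"
    using r(2) C(2) by (intro mult_left_mono nn_integral_mono) auto
  also have "(\<integral>\<^sup>+i. emeasure N (ball i (r i)) \<partial>count_space C) = emeasure N (\<Union>i\<in>C. ball i (r i))"
    using C by (intro emeasure_UN_countable[symmetric])
      (auto simp: N_def disjoint_family_on_def pairwise_def disjnt_def)
  also have "5 ^ DIM('a) * \<dots> \<le> 5 ^ DIM('a) * ennreal A"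
    using NU by (intro mult_left_mono) auto
  finally show ?thesis unfolding A(2) S_def .
qed

lemma hl_maximal_le:
  fixes f :: "'a::euclidean_space \<Rightarrow> 'b::real_normed_vector"
  assumes "\<And>x. norm (f x) \<le> b"
  shows "hl_maximal f x \<le> ennreal b"
  unfolding hl_maximal_ball_avg
proof (rule SUP_least)
  fix \<rho> :: real assume "\<rho> \<in> {0<..}"
  then have \<rho>: "0 < \<rho>" by simp
  have "(\<integral>\<^sup>+y\<in>ball x \<rho>. ennreal (norm (f y)) \<partial>lborel) \<le> (\<integral>\<^sup>+y\<in>ball x \<rho>. ennreal b \<partial>lborel)"
    using assms by (intro nn_integral_mono mult_right_mono ennreal_leI) auto
  also have "\<dots> = emeasure lborel (ball x \<rho>) * ennreal b"
    by (subst nn_integral_cmult_indicator) (auto simp: mult.commute)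
  finally show "ball_avg f x \<rho> \<le> ennreal b"
    by (simp add: ball_avg_le_iff[OF \<rho>])
qed

lemma hl_maximal_split:
  fixes f :: "'a::euclidean_space \<Rightarrow> 'b::real_normed_vector"
  assumes [measurable]: "f \<in> borel_measurable borel" and "0 \<le> l"
  shows "hl_maximal f x \<le> hl_maximal (\<lambda>y. indicator {y. l < norm (f y)} y * norm (f y)) x + ennreal l"
  unfolding hl_maximal_ball_avg[of f]
proof (rule SUP_least)
  fix \<rho> :: real assume "\<rho> \<in> {0<..}"
  then have \<rho>: "0 < \<rho>" by simp
  let ?g = "\<lambda>y. indicator {y. l < norm (f y)} y * norm (f y)"
  have [measurable]: "ball x \<rho> \<in> sets borel" by simp
  have "(\<integral>\<^sup>+y\<in>ball x \<rho>. ennreal (norm (f y)) \<partial>lborel)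
      \<le> (\<integral>\<^sup>+y. ennreal (norm (?g y)) * indicator (ball x \<rho>) y + ennreal l * indicator (ball x \<rho>) y \<partial>lborel)"
    using assms by (intro nn_integral_mono) (auto simp: indicator_def intro!: ennreal_leI)
  also have "\<dots> = (\<integral>\<^sup>+y\<in>ball x \<rho>. ennreal (norm (?g y)) \<partial>lborel) + emeasure lborel (ball x \<rho>) * ennreal l"
  proof (subst nn_integral_add)
    show "(\<integral>\<^sup>+y\<in>ball x \<rho>. ennreal (norm (?g y)) \<partial>lborel) + (\<integral>\<^sup>+y\<in>ball x \<rho>. ennreal l \<partial>lborel)
      = (\<integral>\<^sup>+y\<in>ball x \<rho>. ennreal (norm (?g y)) \<partial>lborel) + emeasure lborel (ball x \<rho>) * ennreal l"
      using nn_integral_cmult_indicator[of "ball x \<rho>" lborel "ennreal l"] by (simp add: mult.commute)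
  qed measurable
  also have "\<dots> \<le> emeasure lborel (ball x \<rho>) * (hl_maximal ?g x + ennreal l)"
    using nn_integral_ball_le_hl_maximal[OF \<rho>, of ?g x] by (simp add: distrib_left add_right_mono)
  finally show "ball_avg f x \<rho> \<le> hl_maximal ?g x + ennreal l"
    by (simp add: ball_avg_le_iff[OF \<rho>])
qed

text \<open>Marcinkiewicz interpolation between the weak bound on L^1 and the trivial bound on
  L^infinity. The uniform bound \<open>b\<close> keeps the maximal function finite, so that
  \<open>enn2real\<close> never replaces top by 0.\<close>

theorem hl_maximal_strong_type:
  fixes f :: "'a::euclidean_space \<Rightarrow> 'b::real_normed_vector"
  assumes [measurable]: "f \<in> borel_measurable borel" and b: "\<And>x. norm (f x) \<le> b" and m: "1 < m"
  shows "(\<integral>\<^sup>+x. ennreal (enn2real (hl_maximal f x) powr m) \<partial>lborel)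
    \<le> ennreal (5 ^ DIM('a) * m * 2 powr m / (m - 1)) * (\<integral>\<^sup>+x. ennreal (norm (f x) powr m) \<partial>lborel)"
proof -
  have fin: "hl_maximal f x < top" for x
    using hl_maximal_le[of f b x, OF b] by (auto intro: le_less_trans)
  have "(\<integral>\<^sup>+x. ennreal (enn2real (hl_maximal f x) powr m) \<partial>lborel)
    \<le> ennreal ((2 * 5 ^ DIM('a)) * m / (m - 1)) * (\<integral>\<^sup>+x. ennreal (norm (f x) * (2 * norm (f x)) powr (m - 1)) \<partial>lborel)"
  proof (rule weak_type_layer_cake)
    fix l :: real assume l: "0 < l"
    \<comment> \<open>Cutting at half the level: the values of |f| up to l / 2 contribute at most l
      / 2 to the maximal function, so where it exceeds l the truncated function must contribute more
      than l / 2.\<close>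
    let ?g = "\<lambda>y. indicator {y. l / 2 < norm (f y)} y * norm (f y)"
    have "ennreal (l / 2) < hl_maximal ?g x" if "l < enn2real (hl_maximal f x)" for x
    proof -
      have "ennreal l < hl_maximal f x"
        using that fin[of x] l by (metis ennreal_enn2real_if ennreal_less_iff less_eq_real_def top.not_eq_extremum)
      also have "\<dots> \<le> hl_maximal ?g x + ennreal (l / 2)" using l by (intro hl_maximal_split) auto
      finally have *: "ennreal (l / 2) + ennreal (l / 2) < hl_maximal ?g x + ennreal (l / 2)"
        using l by (subst ennreal_plus[symmetric]) auto
      show ?thesis
      proof (rule ccontr)
        assume "\<not> ?thesis"
        then have "hl_maximal ?g x + ennreal (l / 2) \<le> ennreal (l / 2) + ennreal (l / 2)"
          by (intro add_right_mono) auto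
        with * show False by simp
      qed
    qed
    then have "emeasure lborel {x\<in>space lborel. l < enn2real (hl_maximal f x)}
       \<le> emeasure lborel {x. ennreal (l / 2) < hl_maximal ?g x}"
      by (intro emeasure_mono borel_open[THEN lborelD] open_hl_maximal_greater) auto
    then have "ennreal (l / 2) * emeasure lborel {x\<in>space lborel. l < enn2real (hl_maximal f x)}
      \<le> ennreal (l / 2) * emeasure lborel {x. ennreal (l / 2) < hl_maximal ?g x}"
      by (intro mult_left_mono) auto
    also have "\<dots> \<le> 5 ^ DIM('a) * (\<integral>\<^sup>+x. ennreal (norm (?g x)) \<partial>lborel)"
      using l by (intro hl_maximal_weak_type) auto
    also have "\<dots> \<le> 5 ^ DIM('a) * (\<integral>\<^sup>+x. ennreal (norm (f x)) * indicator {x. l \<le> 2 * norm (f x)} x \<partial>lborel)"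
      by (intro mult_left_mono nn_integral_mono) (auto simp: indicator_def)
    finally have "ennreal (2 / l) * (ennreal (l / 2) * emeasure lborel {x\<in>space lborel. l < enn2real (hl_maximal f x)})
       \<le> ennreal (2 / l) * (5 ^ DIM('a) * (\<integral>\<^sup>+x. ennreal (norm (f x)) * indicator {x. l \<le> 2 * norm (f x)} x \<partial>lborel))"
      by (intro mult_left_mono) auto
    moreover have "ennreal (2 / l) * ennreal (l / 2) = 1" using l by (simp add: ennreal_mult[symmetric])
    moreover have "ennreal (2 / l) * 5 ^ DIM('a) = ennreal (2 * 5 ^ DIM('a) * l powr (- 1))"
      using l by (simp add: ennreal_mult ennreal_power[symmetric] powr_minus divide_inverse mult_ac)
    ultimately show "emeasure lborel {x\<in>space lborel. l < enn2real (hl_maximal f x)}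
       \<le> ennreal (2 * 5 ^ DIM('a) * l powr (- 1)) * (\<integral>\<^sup>+x. ennreal (norm (f x)) * indicator {x. l \<le> 2 * norm (f x)} x \<partial>lborel)"
      by (simp add: mult.assoc[symmetric])
  qed (use m in \<open>auto intro: lborel.sigma_finite_measure_axioms\<close>)
  also have "(\<lambda>x. ennreal (norm (f x) * (2 * norm (f x)) powr (m - 1))) = (\<lambda>x. ennreal (2 powr (m - 1)) * ennreal (norm (f x) powr m))"
  proof
    fix x
    show "ennreal (norm (f x) * (2 * norm (f x)) powr (m - 1)) = ennreal (2 powr (m - 1)) * ennreal (norm (f x) powr m)"
      by (cases "f x = 0") (auto simp: ennreal_mult[symmetric] powr_mult powr_diff)
  qed
  also have "(\<integral>\<^sup>+x. ennreal (2 powr (m - 1)) * ennreal (norm (f x) powr m) \<partial>lborel) = ennreal (2 powr (m - 1)) * (\<integral>\<^sup>+x. ennreal (norm (f x) powr m) \<partial>lborel)"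
    by (rule nn_integral_cmult) auto
  also have "ennreal ((2 * 5 ^ DIM('a)) * m / (m - 1)) * (ennreal (2 powr (m - 1)) * (\<integral>\<^sup>+x. ennreal (norm (f x) powr m) \<partial>lborel))
     = ennreal (5 ^ DIM('a) * m * 2 powr m / (m - 1)) * (\<integral>\<^sup>+x. ennreal (norm (f x) powr m) \<partial>lborel)"
  proof -
    have "(2 * 5 ^ DIM('a)) * m / (m - 1) * 2 powr (m - 1) = 5 ^ DIM('a) * m * 2 powr m / (m - 1)"
      using m by (simp add: powr_diff field_simps)
    then have "ennreal ((2 * 5 ^ DIM('a)) * m / (m - 1)) * ennreal (2 powr (m - 1)) = ennreal (5 ^ DIM('a) * m * 2 powr m / (m - 1))"
      using m by (subst ennreal_mult[symmetric]) auto
    then show ?thesis by (simp only: mult.assoc[symmetric])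
  qed
  finally show ?thesis .
qed

section \<open>The Hausdorff--Young inequality\<close>

definition fourier_char :: "real \<Rightarrow> complex" where
  "fourier_char t = exp (- 2 * complex_of_real pi * \<i> * complex_of_real t)"

lemma fourier_char_measurable [measurable]: "fourier_char \<in> borel_measurable borel"
  unfolding fourier_char_def by measurable

lemma cnj_measurable [measurable]: "cnj \<in> borel_measurable borel"
  by (intro borel_measurable_continuous_onI continuous_intros)

lemma norm_fourier_char [simp]: "norm (fourier_char t) = 1"
  by (simp add: fourier_char_def norm_exp_eq_Re)

lemma fourier_char_add: "fourier_char (s + t) = fourier_char s * fourier_char t"
  by (simp add: fourier_char_def exp_add[symmetric] algebra_simps)

lemma cnj_fourier_char: "cnj (fourier_char t) = fourier_char (- t)"
  by (simp add: fourier_char_def exp_cnj)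

lemma fourier_eq: "fourier f \<xi> = (\<integral>x. fourier_char (x \<bullet> \<xi>) * f x \<partial>lborel)"
  by (simp add: fourier_def fourier_char_def)

lemma integrable_fourier_char_mult:
  fixes f :: "'a::euclidean_space \<Rightarrow> complex" and h :: "'a \<Rightarrow> real"
  assumes "integrable lborel f" and [measurable]: "h \<in> borel_measurable borel"
  shows "integrable lborel (\<lambda>x. fourier_char (h x) * f x)"
proof -
  have [measurable]: "f \<in> borel_measurable borel" using assms by auto
  show ?thesis by (rule Bochner_Integration.integrable_bound[OF assms(1)]) (auto simp: norm_mult)
qed

lemma fourier_measurable [measurable]:
  fixes f :: "'a::euclidean_space \<Rightarrow> complex"
  assumes [measurable]: "f \<in> borel_measurable borel"
  shows "fourier f \<in> borel_measurable borel"
  unfolding fourier_eq[abs_def] by measurable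

lemma norm_fourier_le:
  fixes f :: "'a::euclidean_space \<Rightarrow> complex"
  shows "norm (fourier f \<xi>) \<le> (\<integral>x. norm (f x) \<partial>lborel)"
proof -
  have "norm (fourier f \<xi>) \<le> (\<integral>x. norm (fourier_char (x \<bullet> \<xi>) * f x) \<partial>lborel)"
    unfolding fourier_eq by (rule integral_norm_bound)
  then show ?thesis by (simp add: norm_mult)
qed

lemma fourier_add:
  fixes f g :: "'a::euclidean_space \<Rightarrow> complex"
  assumes "integrable lborel f" "integrable lborel g"
  shows "fourier (\<lambda>x. f x + g x) \<xi> = fourier f \<xi> + fourier g \<xi>"
  unfolding fourier_eq using assms
  by (simp add: distrib_left integrable_fourier_char_mult)

lemma integrable_pair_mult:
  fixes f :: "'a::euclidean_space \<Rightarrow> complex" and g :: "'b::euclidean_space \<Rightarrow> complex"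
  assumes "integrable lborel f" "integrable lborel g"
  shows "integrable (lborel \<Otimes>\<^sub>M lborel) (\<lambda>(x, y). f x * g y)"
proof (rule integrableI_bounded)
  have [measurable]: "f \<in> borel_measurable borel" "g \<in> borel_measurable borel" using assms by auto
  show "(\<lambda>(x, y). f x * g y) \<in> borel_measurable (lborel \<Otimes>\<^sub>M lborel)" by measurable
  have "(\<integral>\<^sup>+ z. ennreal (norm (case z of (x, y) \<Rightarrow> f x * g y)) \<partial>(lborel \<Otimes>\<^sub>M lborel))
     = (\<integral>\<^sup>+ x. \<integral>\<^sup>+ y. ennreal (norm (f x)) * ennreal (norm (g y)) \<partial>lborel \<partial>lborel)"
    by (subst lborel.nn_integral_fst[symmetric]) (auto simp: norm_mult ennreal_mult)
  also have "\<dots> = (\<integral>\<^sup>+ x. ennreal (norm (f x)) \<partial>lborel) * (\<integral>\<^sup>+ y. ennreal (norm (g y)) \<partial>lborel)"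
    by (simp add: nn_integral_cmult nn_integral_multc)
  also have "\<dots> < \<infinity>"
    using assms by (simp add: integrable_iff_bounded ennreal_mult_less_top)
  finally show "(\<integral>\<^sup>+ z. ennreal (norm (case z of (x, y) \<Rightarrow> f x * g y)) \<partial>(lborel \<Otimes>\<^sub>M lborel)) < \<infinity>" .
qed

text \<open>Tonelli and Fubini, the kernel being symmetric in the two variables. This identity plays
  the role of Parseval throughout, so that Fourier inversion is avoided.\<close>

lemma fourier_multiplication:
  fixes f g :: "'a::euclidean_space \<Rightarrow> complex"
  assumes f: "integrable lborel f" and g: "integrable lborel g"
  shows "(\<integral>\<xi>. fourier f \<xi> * g \<xi> \<partial>lborel) = (\<integral>x. f x * fourier g x \<partial>lborel)"
proof -
  have [measurable]: "f \<in> borel_measurable borel" "g \<in> borel_measurable borel" using assms by auto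
  have "integrable (lborel \<Otimes>\<^sub>M lborel) (\<lambda>(x, \<xi>). fourier_char (x \<bullet> \<xi>) * (f x * g \<xi>))"
    by (rule Bochner_Integration.integrable_bound[OF integrable_pair_mult[OF f g]]) (auto simp: norm_mult)
  from lborel_pair.Fubini_integral[OF this]
  have "(\<integral>\<xi>. \<integral>x. fourier_char (x \<bullet> \<xi>) * (f x * g \<xi>) \<partial>lborel \<partial>lborel) =
     (\<integral>x. \<integral>\<xi>. fourier_char (x \<bullet> \<xi>) * (f x * g \<xi>) \<partial>lborel \<partial>lborel)" .
  moreover have "(\<integral>x. fourier_char (x \<bullet> \<xi>) * (f x * g \<xi>) \<partial>lborel) = fourier f \<xi> * g \<xi>" for \<xi>
    using integral_mult_left_zero[of lborel "\<lambda>x. fourier_char (x \<bullet> \<xi>) * f x" "g \<xi>"]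
    by (simp add: fourier_eq mult.assoc)
  moreover have "(\<integral>\<xi>. fourier_char (x \<bullet> \<xi>) * (f x * g \<xi>) \<partial>lborel) = f x * fourier g x" for x
    using integral_mult_right_zero[of lborel "f x" "\<lambda>\<xi>. fourier_char (\<xi> \<bullet> x) * g \<xi>"]
    by (simp add: fourier_eq mult.left_commute inner_commute)
  ultimately show ?thesis by simp
qed

lemma fourier_convolution:
  fixes f g :: "'a::euclidean_space \<Rightarrow> complex"
  assumes f: "integrable lborel f" and g: "integrable lborel g"
  shows "fourier (\<lambda>z. \<integral>u. f u * g (z - u) \<partial>lborel) \<xi> = fourier f \<xi> * fourier g \<xi>"
    and "integrable lborel (\<lambda>z. \<integral>u. f u * g (z - u) \<partial>lborel)"
proof -
  have [measurable]: "f \<in> borel_measurable borel" "g \<in> borel_measurable borel" using assms by auto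
  have int: "integrable (lborel \<Otimes>\<^sub>M lborel) (\<lambda>(u, z). f u * g (z - u))"
  proof (rule integrableI_bounded)
    show "(\<lambda>(u, z). f u * g (z - u)) \<in> borel_measurable (lborel \<Otimes>\<^sub>M lborel)" by measurable
    have "(\<integral>\<^sup>+ p. ennreal (norm (case p of (u, z) \<Rightarrow> f u * g (z - u))) \<partial>(lborel \<Otimes>\<^sub>M lborel))
       = (\<integral>\<^sup>+ u. \<integral>\<^sup>+ z. ennreal (norm (f u)) * ennreal (norm (g (z - u))) \<partial>lborel \<partial>lborel)"
      by (subst lborel.nn_integral_fst[symmetric]) (auto simp: norm_mult ennreal_mult)
    also have "\<dots> = (\<integral>\<^sup>+ u. ennreal (norm (f u)) * (\<integral>\<^sup>+ z. ennreal (norm (g z)) \<partial>lborel) \<partial>lborel)"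
      using nn_integral_lborel_plus[of "\<lambda>z. ennreal (norm (g z))" "- _"]
      by (intro nn_integral_cong) (simp add: nn_integral_cmult)
    also have "\<dots> = (\<integral>\<^sup>+ u. ennreal (norm (f u)) \<partial>lborel) * (\<integral>\<^sup>+ z. ennreal (norm (g z)) \<partial>lborel)"
      by (simp add: nn_integral_multc)
    also have "\<dots> < \<infinity>"
      using assms by (simp add: integrable_iff_bounded ennreal_mult_less_top)
    finally show "(\<integral>\<^sup>+ p. ennreal (norm (case p of (u, z) \<Rightarrow> f u * g (z - u))) \<partial>(lborel \<Otimes>\<^sub>M lborel)) < \<infinity>" .
  qed
  show "integrable lborel (\<lambda>z. \<integral>u. f u * g (z - u) \<partial>lborel)"
    using lborel_pair.integrable_snd[OF int] by simp
  have "integrable (lborel \<Otimes>\<^sub>M lborel) (\<lambda>(u, z). fourier_char (z \<bullet> \<xi>) * (f u * g (z - u)))"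
    by (rule Bochner_Integration.integrable_bound[OF int]) (auto simp: norm_mult)
  from lborel_pair.Fubini_integral[OF this]
  have "fourier (\<lambda>z. \<integral>u. f u * g (z - u) \<partial>lborel) \<xi> =
     (\<integral>u. \<integral>z. fourier_char (z \<bullet> \<xi>) * (f u * g (z - u)) \<partial>lborel \<partial>lborel)"
    by (simp add: fourier_eq)
  also have "\<dots> = (\<integral>u. (fourier_char (u \<bullet> \<xi>) * f u) * fourier g \<xi> \<partial>lborel)"
  proof (rule Bochner_Integration.integral_cong[OF refl])
    fix u
    have "(\<integral>z. fourier_char (z \<bullet> \<xi>) * (f u * g (z - u)) \<partial>lborel)
      = (\<integral>z. fourier_char ((u + z) \<bullet> \<xi>) * (f u * g ((u + z) - u)) \<partial>lborel)"
      by (rule lborel_integral_plus[symmetric]) measurable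
    also have "\<dots> = (\<integral>z. (fourier_char (u \<bullet> \<xi>) * f u) * (fourier_char (z \<bullet> \<xi>) * g z) \<partial>lborel)"
      by (simp add: inner_add_left fourier_char_add mult_ac)
    finally show "(\<integral>z. fourier_char (z \<bullet> \<xi>) * (f u * g (z - u)) \<partial>lborel) = (fourier_char (u \<bullet> \<xi>) * f u) * fourier g \<xi>"
      by (simp add: fourier_eq)
  qed
  also have "\<dots> = fourier f \<xi> * fourier g \<xi>"
    by (simp add: fourier_eq)
  finally show "fourier (\<lambda>z. \<integral>u. f u * g (z - u) \<partial>lborel) \<xi> = fourier f \<xi> * fourier g \<xi>" .
qed

section \<open>Gaussians and Plancherel's inequality\<close>

lemma gaussian_fourier_1:
  fixes a x :: real
  assumes a: "0 < a"
  shows "(\<integral>y. fourier_char (y * x) * complex_of_real (exp (- a * y\<^sup>2)) \<partial>lborel)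
    = complex_of_real (sqrt (pi / a) * exp (- pi\<^sup>2 * x\<^sup>2 / a))"
    and "integrable lborel (\<lambda>y. exp (- a * y\<^sup>2))"
proof -
  \<comment> \<open>The scale with a c^2 = 1/2, which turns exp(-a y^2) into a multiple of the
    standard normal density. Its characteristic function then gives the transform.\<close>
  define c where "c = 1 / sqrt (2 * a)"
  have c: "0 < c" "c\<^sup>2 = 1 / (2 * a)" using a by (auto simp: c_def power_divide)
  have e: "exp (- a * (c * y)\<^sup>2) = sqrt (2 * pi) * std_normal_density y" for y
    using a by (simp add: normal_density_def power_mult_distrib c)
  have "integrable lborel (\<lambda>y. exp (- a * (0 + c * y)\<^sup>2))"
    unfolding add_0 e by (intro integrable_mult_right) simp
  then show "integrable lborel (\<lambda>y. exp (- a * y\<^sup>2))"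
    using lborel_integrable_real_affine_iff[of c "\<lambda>y. exp (- a * y\<^sup>2)" 0] c by simp
  have "complex_of_real (exp (- ((- 2 * pi * x * c)\<^sup>2) / 2)) = char std_normal_distribution (- 2 * pi * x * c)"
    by (simp add: char_std_normal_distribution)
  also have "\<dots> = (\<integral>y. std_normal_density y *\<^sub>R iexp ((- 2 * pi * x * c) * y) \<partial>lborel)"
    unfolding char_def by (subst integral_density) (auto simp: normal_density_nonneg)
  finally have ch: "(\<integral>y. std_normal_density y *\<^sub>R iexp ((- 2 * pi * x * c) * y) \<partial>lborel)
    = complex_of_real (exp (- ((- 2 * pi * x * c)\<^sup>2) / 2))" by simp
  have "(\<integral>y. fourier_char (y * x) * complex_of_real (exp (- a * y\<^sup>2)) \<partial>lborel)
     = c *\<^sub>R (\<integral>y. fourier_char ((0 + c * y) * x) * complex_of_real (exp (- a * (0 + c * y)\<^sup>2)) \<partial>lborel)"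
    using c by (subst lborel_integral_real_affine[where c=c and t=0]) auto
  also have "\<dots> = c *\<^sub>R (\<integral>y. complex_of_real (sqrt (2 * pi)) * (std_normal_density y *\<^sub>R iexp ((- 2 * pi * x * c) * y)) \<partial>lborel)"
    unfolding add_0 e
    by (intro arg_cong[where f="\<lambda>z. c *\<^sub>R z"] Bochner_Integration.integral_cong)
       (auto simp: fourier_char_def scaleR_conv_of_real mult_ac)
  also have "\<dots> = complex_of_real (c * sqrt (2 * pi) * exp (- ((- 2 * pi * x * c)\<^sup>2) / 2))"
    unfolding integral_mult_right_zero ch by (simp add: scaleR_conv_of_real)
  also have "c * sqrt (2 * pi) = sqrt (pi / a)"
    using a by (simp add: c_def real_sqrt_divide real_sqrt_mult)
  also have "- ((- 2 * pi * x * c)\<^sup>2) / 2 = - pi\<^sup>2 * x\<^sup>2 / a"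
    by (simp add: power_mult_distrib c)
  finally show "(\<integral>y. fourier_char (y * x) * complex_of_real (exp (- a * y\<^sup>2)) \<partial>lborel)
    = complex_of_real (sqrt (pi / a) * exp (- pi\<^sup>2 * x\<^sup>2 / a))" .
qed

lemma lborel_integral_prod_Basis:
  fixes f :: "'a::euclidean_space \<Rightarrow> real \<Rightarrow> 'b::{real_normed_field, banach, second_countable_topology}"
  assumes int: "\<And>b. b \<in> Basis \<Longrightarrow> integrable lborel (f b)"
  shows "(\<integral>x. (\<Prod>b\<in>Basis. f b (x \<bullet> b)) \<partial>lborel) = (\<Prod>b\<in>Basis. \<integral>x. f b x \<partial>lborel)" (is ?A)
    and "integrable lborel (\<lambda>x. \<Prod>b\<in>Basis. f b (x \<bullet> b))" (is ?B)
proof -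
  interpret product_sigma_finite "\<lambda>_::'a. lborel :: real measure" by standard
  have [measurable]: "f b \<in> borel_measurable borel" if "b \<in> Basis" for b
    using int[OF that] by auto
  let ?T = "\<lambda>g. \<Sum>b\<in>Basis. g b *\<^sub>R (b::'a)"
  have T: "?T \<in> measurable (\<Pi>\<^sub>M b\<in>Basis. lborel) borel" by measurable
  have m: "(\<lambda>x. \<Prod>b\<in>Basis. f b (x \<bullet> b)) \<in> borel_measurable borel" by measurable
  have e: "(\<lambda>g. \<Prod>b\<in>Basis. f b (?T g \<bullet> b)) = (\<lambda>g. \<Prod>b\<in>Basis. f b (g b))"
    by (intro ext prod.cong refl) simp
  show ?A
    by (subst lborel_eq, subst integral_distr[OF T m]) (simp only: e, rule product_integral_prod[OF finite_Basis int])
  show ?B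
    by (subst lborel_eq, subst integrable_distr_eq[OF T m]) (simp only: e, rule product_integrable_prod[OF finite_Basis int])
qed

lemma exp_norm_sq_prod_Basis:
  fixes x :: "'a::euclidean_space"
  shows "exp (- a * (norm x)\<^sup>2) = (\<Prod>b\<in>Basis. exp (- a * (x \<bullet> b)\<^sup>2))"
proof -
  have "(norm x)\<^sup>2 = (\<Sum>b\<in>Basis. (x \<bullet> b)\<^sup>2)"
    by (subst power2_norm_eq_inner, subst euclidean_inner) (simp add: power2_eq_square)
  then show ?thesis by (simp add: exp_sum[symmetric] sum_distrib_left)
qed

lemma fourier_gaussian:
  fixes x :: "'a::euclidean_space" and a :: real
  assumes a: "0 < a"
  shows "fourier (\<lambda>y::'a. complex_of_real (exp (- a * (norm y)\<^sup>2))) x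
    = complex_of_real (sqrt (pi / a) ^ DIM('a) * exp (- (pi\<^sup>2 / a) * (norm x)\<^sup>2))"
    and "integrable lborel (\<lambda>y::'a. exp (- a * (norm y)\<^sup>2))"
proof -
  show "integrable lborel (\<lambda>y::'a. exp (- a * (norm y)\<^sup>2))"
    unfolding exp_norm_sq_prod_Basis using gaussian_fourier_1(2)[OF a]
    by (intro lborel_integral_prod_Basis(2))
  have ch: "fourier_char (y \<bullet> x) = (\<Prod>b\<in>Basis. fourier_char ((y \<bullet> b) * (x \<bullet> b)))" for y :: 'a
    unfolding fourier_char_def
    by (subst exp_sum[symmetric]) (auto simp: sum_distrib_left[symmetric] euclidean_inner[of y x] sum_negf)
  have int: "integrable lborel (\<lambda>y. fourier_char (y * c) * complex_of_real (exp (- a * y\<^sup>2)))" for c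
    using gaussian_fourier_1(2)[OF a] by (intro integrable_fourier_char_mult) (auto simp: integrable_of_real)
  have "fourier (\<lambda>y::'a. complex_of_real (exp (- a * (norm y)\<^sup>2))) x
    = (\<integral>y. (\<Prod>b\<in>Basis. fourier_char ((y \<bullet> b) * (x \<bullet> b)) * complex_of_real (exp (- a * (y \<bullet> b)\<^sup>2))) \<partial>lborel)"
    unfolding fourier_eq ch exp_norm_sq_prod_Basis by (simp add: prod.distrib)
  also have "\<dots> = (\<Prod>b\<in>Basis. \<integral>y. fourier_char (y * (x \<bullet> b)) * complex_of_real (exp (- a * y\<^sup>2)) \<partial>lborel)"
    by (rule lborel_integral_prod_Basis(1)[where f="\<lambda>b y. fourier_char (y * (x \<bullet> b)) * complex_of_real (exp (- a * y\<^sup>2))", OF int])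
  also have "\<dots> = complex_of_real (\<Prod>b\<in>Basis. sqrt (pi / a) * exp (- (pi\<^sup>2 / a) * (x \<bullet> b)\<^sup>2))"
    unfolding gaussian_fourier_1(1)[OF a] by (simp add: mult_ac)
  also have "(\<Prod>b\<in>Basis. sqrt (pi / a) * exp (- (pi\<^sup>2 / a) * (x \<bullet> b)\<^sup>2)) = sqrt (pi / a) ^ DIM('a) * exp (- (pi\<^sup>2 / a) * (norm x)\<^sup>2)"
    unfolding exp_norm_sq_prod_Basis by (simp add: prod.distrib)
  finally show "fourier (\<lambda>y::'a. complex_of_real (exp (- a * (norm y)\<^sup>2))) x
    = complex_of_real (sqrt (pi / a) ^ DIM('a) * exp (- (pi\<^sup>2 / a) * (norm x)\<^sup>2))" .
qed

lemma integral_gaussian: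
  fixes a :: real
  assumes a: "0 < a"
  shows "(\<integral>x. exp (- a * (norm (x::'a::euclidean_space))\<^sup>2) \<partial>lborel) = sqrt (pi / a) ^ DIM('a)"
proof -
  have "complex_of_real (\<integral>x. exp (- a * (norm (x::'a))\<^sup>2) \<partial>lborel) = fourier (\<lambda>y::'a. complex_of_real (exp (- a * (norm y)\<^sup>2))) 0"
    by (simp add: fourier_eq fourier_char_def)
  also have "\<dots> = complex_of_real (sqrt (pi / a) ^ DIM('a))"
    by (subst fourier_gaussian(1)[OF a]) simp
  finally show ?thesis by (simp only: of_real_eq_iff)
qed

text \<open>The Gaussian weight makes all integrals converge for f merely in L^1. The left side is
  the pairing of \<open>fourier f\<close> with g = cnj (fourier f) times the Gaussian, hence of f
  with \<open>fourier g\<close>, and |fourier g| is at most the convolution of |f| with a Gaussian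
  of mass 1, uniformly in a.\<close>

lemma fourier_gaussian_regularised:
  fixes f :: "'a::euclidean_space \<Rightarrow> complex"
  assumes f: "integrable lborel f" and a: "0 < a"
  shows "(\<integral>\<^sup>+\<xi>. ennreal ((norm (fourier f \<xi>))\<^sup>2 * exp (- a * (norm \<xi>)\<^sup>2)) \<partial>lborel)
    \<le> (\<integral>\<^sup>+x. ennreal ((norm (f x))\<^sup>2) \<partial>lborel)"
proof -
  have [measurable]: "f \<in> borel_measurable borel" using f by auto
  define B where "B = (\<integral>x. norm (f x) \<partial>lborel)"
  have B: "norm (fourier f \<xi>) \<le> B" for \<xi> unfolding B_def by (rule norm_fourier_le)
  have B0: "0 \<le> B" using B[of 0] norm_ge_zero order.trans by blast
  define E where "E \<xi> = exp (- a * (norm (\<xi>::'a))\<^sup>2)" for \<xi>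
  have [measurable]: "E \<in> borel_measurable borel" unfolding E_def by measurable
  have E: "integrable lborel E" unfolding E_def[abs_def] by (rule fourier_gaussian(2)[OF a])
  have E': "integrable lborel (\<lambda>\<xi>. complex_of_real (E \<xi>))" using E by (rule integrable_of_real)
  have E0: "0 \<le> E \<xi>" for \<xi> by (simp add: E_def)
  define K where "K x = sqrt (pi / a) ^ DIM('a) * exp (- (pi\<^sup>2 / a) * (norm (x::'a))\<^sup>2)" for x
  have [measurable]: "K \<in> borel_measurable borel" unfolding K_def by measurable
  have K0: "0 \<le> K x" for x using a by (simp add: K_def)
  have Kint: "(\<integral>\<^sup>+x. ennreal (K (t - x)) \<partial>lborel) = 1" "(\<integral>\<^sup>+x. ennreal (K (x - t)) \<partial>lborel) = 1" for t
  proof -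
    have p: "0 < pi\<^sup>2 / a" using a by simp
    have "(\<integral>x. K x \<partial>lborel) = sqrt (pi / a) ^ DIM('a) * sqrt (pi / (pi\<^sup>2 / a)) ^ DIM('a)"
      unfolding K_def integral_mult_right_zero integral_gaussian[OF p] ..
    also have "\<dots> = (sqrt (pi / a) * sqrt (pi / (pi\<^sup>2 / a))) ^ DIM('a)" by (simp only: power_mult_distrib)
    also have "sqrt (pi / a) * sqrt (pi / (pi\<^sup>2 / a)) = 1"
      using a by (simp add: real_sqrt_mult[symmetric] power2_eq_square)
    finally have "(\<integral>x. K x \<partial>lborel) = 1" by simp
    moreover have "integrable lborel K"
      unfolding K_def[abs_def] by (intro integrable_mult_right fourier_gaussian(2)[OF p])
    ultimately have K1: "(\<integral>\<^sup>+x. ennreal (K x) \<partial>lborel) = 1"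
      using K0 by (subst nn_integral_eq_integral) auto
    show "(\<integral>\<^sup>+x. ennreal (K (t - x)) \<partial>lborel) = 1"
      using nn_integral_lborel_minus[of "\<lambda>x. ennreal (K x)" t] K1 by simp
    show "(\<integral>\<^sup>+x. ennreal (K (x - t)) \<partial>lborel) = 1"
      using nn_integral_lborel_plus[of "\<lambda>x. ennreal (K x)" "- t"] K1 by simp
  qed
  define g where "g \<xi> = cnj (fourier f \<xi>) * complex_of_real (E \<xi>)" for \<xi>
  have [measurable]: "g \<in> borel_measurable borel"
    unfolding g_def by (intro borel_measurable_times measurable_compose[OF _ cnj_measurable]) measurable
  have g: "integrable lborel g"
    by (rule Bochner_Integration.integrable_bound[OF integrable_mult_right[OF E, of B]])
       (auto simp: g_def norm_mult E0 B0 intro!: mult_right_mono B)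
  have gh: "norm (fourier g x) \<le> (\<integral>y. norm (f y) * K (y - x) \<partial>lborel)" for x
  proof -
    \<comment> \<open>A modulated Gaussian: its transform at y is the kernel K(y - x), which
      exhibits \<open>fourier g x\<close> as the conjugate of an integral of f against K.\<close>
    define G where "G \<xi> = fourier_char (- (\<xi> \<bullet> x)) * complex_of_real (E \<xi>)" for \<xi>
    have G: "integrable lborel G" unfolding G_def[abs_def]
      by (rule integrable_fourier_char_mult[OF E']) simp
    have Gh: "fourier G y = complex_of_real (K (y - x))" for y
    proof -
      have "fourier G y = fourier (\<lambda>\<xi>. complex_of_real (E \<xi>)) (y - x)"
        unfolding fourier_eq G_def
        by (intro Bochner_Integration.integral_cong refl)
           (simp add: mult.assoc[symmetric] fourier_char_add[symmetric] inner_diff_right)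
      then show ?thesis unfolding E_def fourier_gaussian(1)[OF a] K_def .
    qed
    have "fourier g x = (\<integral>\<xi>. cnj (fourier f \<xi> * G \<xi>) \<partial>lborel)"
      unfolding fourier_eq[of g] g_def G_def
      by (intro Bochner_Integration.integral_cong refl) (simp add: cnj_fourier_char mult_ac)
    also have "\<dots> = cnj (\<integral>y. f y * fourier G y \<partial>lborel)"
      unfolding fourier_multiplication[OF f G, symmetric] by (rule Bochner_Integration.integral_cnj)
    finally have "norm (fourier g x) = norm (\<integral>y. f y * complex_of_real (K (y - x)) \<partial>lborel)"
      by (simp add: Gh)
    also have "\<dots> \<le> (\<integral>y. norm (f y * complex_of_real (K (y - x))) \<partial>lborel)"
      by (rule integral_norm_bound)
    finally show ?thesis by (simp add: norm_mult K0)
  qed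
  have Kb: "K x \<le> sqrt (pi / a) ^ DIM('a)" for x
    unfolding K_def using a by (intro mult_left_le) auto
  have gh': "ennreal (norm (fourier g x)) \<le> (\<integral>\<^sup>+y. ennreal (norm (f y) * K (y - x)) \<partial>lborel)" for x
  proof -
    have "integrable lborel (\<lambda>y. norm (f y) * K (y - x))"
      by (rule Bochner_Integration.integrable_bound[OF integrable_mult_left[OF integrable_norm[OF f], of "sqrt (pi / a) ^ DIM('a)"]])
         (use a Kb K0 in \<open>auto intro!: mult_left_mono\<close>)
    then have "(\<integral>\<^sup>+y. ennreal (norm (f y) * K (y - x)) \<partial>lborel) = ennreal (\<integral>y. norm (f y) * K (y - x) \<partial>lborel)"
      by (intro nn_integral_eq_integral) (auto simp: K0)
    then show ?thesis using gh[of x] by (simp add: ennreal_leI)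
  qed
  have "(\<integral>\<^sup>+\<xi>. ennreal ((norm (fourier f \<xi>))\<^sup>2 * E \<xi>) \<partial>lborel) = ennreal (\<integral>\<xi>. (norm (fourier f \<xi>))\<^sup>2 * E \<xi> \<partial>lborel)"
  proof (rule nn_integral_eq_integral)
    show "integrable lborel (\<lambda>\<xi>. (norm (fourier f \<xi>))\<^sup>2 * E \<xi>)"
      by (rule Bochner_Integration.integrable_bound[OF integrable_mult_right[OF E, of "B\<^sup>2"]])
         (use B B0 E0 in \<open>auto intro!: mult_right_mono power_mono simp: abs_mult\<close>)
  qed (use E0 in auto)
  also have "\<dots> = ennreal (norm (\<integral>\<xi>. fourier f \<xi> * g \<xi> \<partial>lborel))"
  proof -
    have "(\<integral>\<xi>. fourier f \<xi> * g \<xi> \<partial>lborel) = (\<integral>\<xi>. complex_of_real ((norm (fourier f \<xi>))\<^sup>2 * E \<xi>) \<partial>lborel)"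
      by (intro Bochner_Integration.integral_cong refl)
         (simp only: g_def of_real_mult complex_norm_square mult.assoc)
    also have "\<dots> = complex_of_real (\<integral>\<xi>. (norm (fourier f \<xi>))\<^sup>2 * E \<xi> \<partial>lborel)"
      by (rule integral_complex_of_real)
    finally show ?thesis
      by (simp add: Bochner_Integration.integral_nonneg E0)
  qed
  also have "\<dots> \<le> (\<integral>\<^sup>+x. ennreal (norm (f x * fourier g x)) \<partial>lborel)"
    unfolding fourier_multiplication[OF f g]
  proof (rule integral_norm_bound_ennreal)
    show "integrable lborel (\<lambda>x. f x * fourier g x)"
      by (rule Bochner_Integration.integrable_bound[OF integrable_mult_left[OF integrable_norm[OF f], of "\<integral>x. norm (g x) \<partial>lborel"]])
         (auto simp: norm_mult abs_mult intro!: mult_left_mono order.trans[OF norm_fourier_le])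
  qed
  also have "\<dots> \<le> (\<integral>\<^sup>+x. \<integral>\<^sup>+y. ennreal (norm (f x)) * ennreal (norm (f y) * K (y - x)) \<partial>lborel \<partial>lborel)"
    by (intro nn_integral_mono) (simp add: norm_mult ennreal_mult nn_integral_cmult gh' mult_left_mono)
  \<comment> \<open>Schur's test in its simplest form: 2 |f(x)| |f(y)| \<le> |f(x)|^2 + |f(y)|^2,
    and K has mass 1 in either variable.\<close>
  also have "\<dots> \<le> (\<integral>\<^sup>+x. \<integral>\<^sup>+y. ennreal ((norm (f x))\<^sup>2 / 2) * ennreal (K (y - x)) + ennreal ((norm (f y))\<^sup>2 / 2) * ennreal (K (y - x)) \<partial>lborel \<partial>lborel)"
  proof (intro nn_integral_mono)
    fix x y
    have "norm (f x) * (norm (f y) * K (y - x)) \<le> ((norm (f x))\<^sup>2 / 2 + (norm (f y))\<^sup>2 / 2) * K (y - x)"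
      unfolding mult.assoc[symmetric] using sum_squares_bound[of "norm (f x)" "norm (f y)"]
      by (intro mult_right_mono K0) simp
    then show "ennreal (norm (f x)) * ennreal (norm (f y) * K (y - x)) \<le>
       ennreal ((norm (f x))\<^sup>2 / 2) * ennreal (K (y - x)) + ennreal ((norm (f y))\<^sup>2 / 2) * ennreal (K (y - x))"
      by (simp add: ennreal_mult[symmetric] K0 ennreal_plus[symmetric] distrib_right del: ennreal_plus)
  qed
  also have "\<dots> = (\<integral>\<^sup>+x. \<integral>\<^sup>+y. ennreal ((norm (f x))\<^sup>2 / 2) * ennreal (K (y - x)) \<partial>lborel \<partial>lborel)
     + (\<integral>\<^sup>+x. \<integral>\<^sup>+y. ennreal ((norm (f y))\<^sup>2 / 2) * ennreal (K (y - x)) \<partial>lborel \<partial>lborel)"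
    by (simp add: nn_integral_add)
  also have "(\<integral>\<^sup>+x. \<integral>\<^sup>+y. ennreal ((norm (f y))\<^sup>2 / 2) * ennreal (K (y - x)) \<partial>lborel \<partial>lborel)
     = (\<integral>\<^sup>+y. \<integral>\<^sup>+x. ennreal ((norm (f y))\<^sup>2 / 2) * ennreal (K (y - x)) \<partial>lborel \<partial>lborel)"
    by (rule nn_integral_swap_lborel) measurable
  also have "(\<integral>\<^sup>+x. \<integral>\<^sup>+y. ennreal ((norm (f x))\<^sup>2 / 2) * ennreal (K (y - x)) \<partial>lborel \<partial>lborel) = (\<integral>\<^sup>+x. ennreal ((norm (f x))\<^sup>2 / 2) \<partial>lborel)"
    by (simp add: nn_integral_cmult Kint)
  also have "(\<integral>\<^sup>+y. \<integral>\<^sup>+x. ennreal ((norm (f y))\<^sup>2 / 2) * ennreal (K (y - x)) \<partial>lborel \<partial>lborel) = (\<integral>\<^sup>+x. ennreal ((norm (f x))\<^sup>2 / 2) \<partial>lborel)"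
    by (simp add: nn_integral_cmult Kint)
  also have "(\<integral>\<^sup>+x. ennreal ((norm (f x))\<^sup>2 / 2) \<partial>lborel) + (\<integral>\<^sup>+x. ennreal ((norm (f x))\<^sup>2 / 2) \<partial>lborel) = (\<integral>\<^sup>+x. ennreal ((norm (f x))\<^sup>2) \<partial>lborel)"
    by (subst nn_integral_add[symmetric]) (auto simp: ennreal_plus[symmetric] simp del: ennreal_plus)
  finally show ?thesis by (simp add: E_def)
qed

text \<open>Fatou's lemma along the weights a = 1 / (n + 1). The inequality alone suffices for
  estimating level sets of the transform.\<close>

lemma plancherel_le:
  fixes f :: "'a::euclidean_space \<Rightarrow> complex"
  assumes f: "integrable lborel f"
  shows "(\<integral>\<^sup>+\<xi>. ennreal ((norm (fourier f \<xi>))\<^sup>2) \<partial>lborel) \<le> (\<integral>\<^sup>+x. ennreal ((norm (f x))\<^sup>2) \<partial>lborel)"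
proof -
  have [measurable]: "f \<in> borel_measurable borel" using f by auto
  define u where "u n \<xi> = ennreal ((norm (fourier f \<xi>))\<^sup>2 * exp (- (1 / real (Suc n)) * (norm \<xi>)\<^sup>2))" for n \<xi>
  have [measurable]: "u n \<in> borel_measurable borel" for n unfolding u_def by measurable
  have lim: "(\<lambda>n. u n \<xi>) \<longlonglongrightarrow> ennreal ((norm (fourier f \<xi>))\<^sup>2)" for \<xi>
  proof -
    have "(\<lambda>n. 1 / real (Suc n)) \<longlonglongrightarrow> 0" by real_asymp
    then have "(\<lambda>n. - (1 / real (Suc n)) * (norm \<xi>)\<^sup>2) \<longlonglongrightarrow> - 0 * (norm \<xi>)\<^sup>2"
      by (rule tendsto_mult[OF tendsto_minus tendsto_const])
    then have "(\<lambda>n. u n \<xi>) \<longlonglongrightarrow> ennreal ((norm (fourier f \<xi>))\<^sup>2 * exp (- 0 * (norm \<xi>)\<^sup>2))"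
      unfolding u_def by (intro tendsto_ennrealI tendsto_mult[OF tendsto_const] tendsto_exp)
    then show ?thesis by simp
  qed
  have "(\<integral>\<^sup>+\<xi>. ennreal ((norm (fourier f \<xi>))\<^sup>2) \<partial>lborel) = (\<integral>\<^sup>+\<xi>. liminf (\<lambda>n. u n \<xi>) \<partial>lborel)"
    using lim_imp_Liminf[OF _ lim] by (intro nn_integral_cong) simp
  also have "\<dots> \<le> liminf (\<lambda>n. \<integral>\<^sup>+\<xi>. u n \<xi> \<partial>lborel)"
    by (rule nn_integral_liminf) simp
  also have "\<dots> \<le> liminf (\<lambda>n::nat. \<integral>\<^sup>+x. ennreal ((norm (f x))\<^sup>2) \<partial>lborel)"
    unfolding u_def by (intro Liminf_mono always_eventually allI fourier_gaussian_regularised f) simp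
  also have "\<dots> = (\<integral>\<^sup>+x. ennreal ((norm (f x))\<^sup>2) \<partial>lborel)"
    by (rule Liminf_const) simp
  finally show ?thesis .
qed

text \<open>Split \<open>f\<close> at a height depending on the level \<open>l\<close>: the large part has a Fourier transform
  bounded by \<open>l / 2\<close>, and the small part is controlled in \<open>L\<^sup>2\<close>.\<close>

theorem Hausdorff_Young_weak_constant:
  fixes f :: "'a::euclidean_space \<Rightarrow> complex"
  assumes f: "integrable lborel f" and s: "2 < s" and t: "t = s / (s - 1)" and A: "0 < A"
    and fA: "(\<integral>\<^sup>+x. ennreal (norm (f x) powr t) \<partial>lborel) \<le> ennreal A"
  shows "(\<integral>\<^sup>+\<xi>. ennreal (norm (fourier f \<xi>) powr s) \<partial>lborel)
    \<le> ennreal (4 * s / (s - 2) * 2 powr (s - 2) * A powr (s - 1))"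
proof -
  have [measurable]: "f \<in> borel_measurable borel" using f by auto
  have t1: "t - 1 = 1 / (s - 1)" "1 < t" using s by (auto simp: t field_simps)
  \<comment> \<open>As 1 - t < 0, the set where \<open>Y x < l\<close> carries the large values of
    |f|. On it |f| \<le> l / (2 A) |f|^t, which integrates to at most l / 2; this is where the
    factor 2 A comes from.\<close>
  define Y where "Y x = 2 * A * norm (f x) powr (1 - t)" for x
  have [measurable]: "Y \<in> borel_measurable borel" unfolding Y_def by measurable
  have "(\<integral>\<^sup>+\<xi>. ennreal (norm (fourier f \<xi>) powr s) \<partial>lborel)
    \<le> ennreal (4 * s / (s - 2)) * (\<integral>\<^sup>+x. ennreal ((norm (f x))\<^sup>2 * Y x powr (s - 2)) \<partial>lborel)"
  proof (rule weak_type_layer_cake)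
    fix l :: real assume l: "0 < l"
    define f1 where "f1 x = indicator {x. Y x < l} x *\<^sub>R f x" for x
    define f2 where "f2 x = indicator {x. l \<le> Y x} x *\<^sub>R f x" for x
    have f1: "integrable lborel f1" and f2: "integrable lborel f2"
      unfolding f1_def[abs_def] f2_def[abs_def] by (intro integrable_mult_indicator f; simp)+
    have [measurable]: "f2 \<in> borel_measurable borel" using f2 by auto
    have "(\<integral>\<^sup>+x. ennreal (norm (f1 x)) \<partial>lborel) \<le> (\<integral>\<^sup>+x. ennreal (l / (2 * A)) * ennreal (norm (f x) powr t) \<partial>lborel)"
    proof (rule nn_integral_mono)
      fix x
      have "norm (f1 x) \<le> l / (2 * A) * norm (f x) powr t"
      proof (cases "Y x < l \<and> f x \<noteq> 0")
        case True
        have "norm (f x) = Y x / (2 * A) * norm (f x) powr t"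
          using A True by (simp add: Y_def powr_add[symmetric])
        also have "\<dots> \<le> l / (2 * A) * norm (f x) powr t"
          using A True by (intro mult_right_mono divide_right_mono) auto
        finally show ?thesis using True by (simp add: f1_def)
      qed (use l A in \<open>auto simp: f1_def\<close>)
      then show "ennreal (norm (f1 x)) \<le> ennreal (l / (2 * A)) * ennreal (norm (f x) powr t)"
        using l A by (simp add: ennreal_mult[symmetric] ennreal_leI)
    qed
    also have "\<dots> = ennreal (l / (2 * A)) * (\<integral>\<^sup>+x. ennreal (norm (f x) powr t) \<partial>lborel)"
      by (rule nn_integral_cmult) measurable
    also have "\<dots> \<le> ennreal (l / (2 * A)) * ennreal A" by (intro mult_left_mono fA) auto
    also have "\<dots> = ennreal (l / 2)" using l A by (simp add: ennreal_mult[symmetric])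
    finally have "(\<integral>\<^sup>+x. ennreal (norm (f1 x)) \<partial>lborel) \<le> ennreal (l / 2)" .
    then have "(\<integral>x. norm (f1 x) \<partial>lborel) \<le> l / 2"
      using nn_integral_eq_integral[OF integrable_norm[OF f1]] l by simp
    then have f1h: "norm (fourier f1 \<xi>) \<le> l / 2" for \<xi>
      using norm_fourier_le[of f1 \<xi>] by simp
    have split: "fourier f \<xi> = fourier f1 \<xi> + fourier f2 \<xi>" for \<xi>
    proof -
      have "f = (\<lambda>x. f1 x + f2 x)" by (auto simp: f1_def f2_def indicator_def fun_eq_iff)
      then show ?thesis using fourier_add[OF f1 f2] by simp
    qed
    have sub: "l / 2 \<le> norm (fourier f2 \<xi>)" if "l < norm (fourier f \<xi>)" for \<xi>
      using that f1h[of \<xi>] norm_triangle_ineq[of "fourier f1 \<xi>" "fourier f2 \<xi>"] by (simp add: split)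
    have "emeasure lborel {x\<in>space lborel. l < norm (fourier f x)}
      = (\<integral>\<^sup>+\<xi>. indicator {x\<in>space lborel. l < norm (fourier f x)} \<xi> \<partial>lborel)"
      by (rule nn_integral_indicator[symmetric]) measurable
    also have "\<dots> \<le> (\<integral>\<^sup>+\<xi>. ennreal (4 * l powr (- 2)) * ennreal ((norm (fourier f2 \<xi>))\<^sup>2) \<partial>lborel)"
    proof (rule nn_integral_mono)
      fix \<xi> :: 'a
      show "indicator {x\<in>space lborel. l < norm (fourier f x)} \<xi>
        \<le> ennreal (4 * l powr (- 2)) * ennreal ((norm (fourier f2 \<xi>))\<^sup>2)"
      proof (cases "l < norm (fourier f \<xi>)")
        case True
        have "(l / 2)\<^sup>2 \<le> (norm (fourier f2 \<xi>))\<^sup>2" using sub[OF True] l by (intro power_mono) auto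
        then have "1 \<le> 4 * l powr (- 2) * (norm (fourier f2 \<xi>))\<^sup>2"
          using l by (simp add: powr_minus field_simps)
        then show ?thesis by (simp add: ennreal_mult[symmetric] indicator_def)
      qed auto
    qed
    also have "\<dots> = ennreal (4 * l powr (- 2)) * (\<integral>\<^sup>+\<xi>. ennreal ((norm (fourier f2 \<xi>))\<^sup>2) \<partial>lborel)"
      by (rule nn_integral_cmult) measurable
    also have "\<dots> \<le> ennreal (4 * l powr (- 2)) * (\<integral>\<^sup>+x. ennreal ((norm (f2 x))\<^sup>2) \<partial>lborel)"
      by (intro mult_left_mono plancherel_le f2) auto
    also have "(\<integral>\<^sup>+x. ennreal ((norm (f2 x))\<^sup>2) \<partial>lborel) = (\<integral>\<^sup>+x. ennreal ((norm (f x))\<^sup>2) * indicator {x. l \<le> Y x} x \<partial>lborel)"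
      by (intro nn_integral_cong) (auto simp: f2_def indicator_def)
    finally show "emeasure lborel {x\<in>space lborel. l < norm (fourier f x)}
      \<le> ennreal (4 * l powr (- 2)) * (\<integral>\<^sup>+x. ennreal ((norm (f x))\<^sup>2) * indicator {x. l \<le> Y x} x \<partial>lborel)" .
  qed (use s A in \<open>auto simp: Y_def intro: lborel.sigma_finite_measure_axioms\<close>)
  also have "(\<lambda>x. ennreal ((norm (f x))\<^sup>2 * Y x powr (s - 2)))
     = (\<lambda>x. ennreal ((2 * A) powr (s - 2)) * ennreal (norm (f x) powr t))"
  proof
    fix x
    have "(norm (f x))\<^sup>2 * Y x powr (s - 2) = (2 * A) powr (s - 2) * norm (f x) powr t"
    proof (cases "f x = 0")
      case False
      \<comment> \<open>The relation between s and t that turns the interpolated integral back into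
        the integral of |f|^t.\<close>
      have "2 + (1 - t) * (s - 2) = t" using s by (simp add: t field_simps)
      then have "norm (f x) powr 2 * norm (f x) powr ((1 - t) * (s - 2)) = norm (f x) powr t"
        by (simp only: powr_add[symmetric])
      then show ?thesis using False A by (simp add: Y_def powr_mult powr_powr)
    qed auto
    then show "ennreal ((norm (f x))\<^sup>2 * Y x powr (s - 2)) = ennreal ((2 * A) powr (s - 2)) * ennreal (norm (f x) powr t)"
      by (simp add: ennreal_mult)
  qed
  also have "(\<integral>\<^sup>+x. ennreal ((2 * A) powr (s - 2)) * ennreal (norm (f x) powr t) \<partial>lborel)
    = ennreal ((2 * A) powr (s - 2)) * (\<integral>\<^sup>+x. ennreal (norm (f x) powr t) \<partial>lborel)"
    by (rule nn_integral_cmult) measurable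
  also have "ennreal (4 * s / (s - 2)) * \<dots> \<le> ennreal (4 * s / (s - 2)) * (ennreal ((2 * A) powr (s - 2)) * ennreal A)"
    by (intro mult_left_mono fA) auto
  also have "\<dots> = ennreal (4 * s / (s - 2) * ((2 * A) powr (s - 2) * A))"
    using s A by (simp add: ennreal_mult[symmetric])
  also have "(2 * A) powr (s - 2) * A = 2 powr (s - 2) * A powr (s - 1)"
    using A powr_add[of A "s - 2" 1] by (simp add: powr_mult)
  finally show ?thesis by (simp add: mult.assoc)
qed

section \<open>Fractional integration\<close>

text \<open>Hedberg's pointwise bound for the fractional integral. The kernel is written as a superposition
  of indicators of balls; small balls are estimated by the maximal function and large ones by
  Hoelder's inequality, the two bounds balancing at radius \<open>(B / N)\<^sup>m\<close>.\<close>

lemma Hedberg: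
  fixes v :: "real \<Rightarrow> real" and a m :: real
  assumes a: "0 < a" "a < 1" and m: "m = 2 / (2 - a)"
    and [measurable]: "v \<in> borel_measurable borel" and v0: "\<And>y. 0 \<le> v y" and vb: "\<And>y. v y \<le> b"
    and B: "0 < B" and vB: "(\<integral>\<^sup>+y. ennreal (v y powr m) \<partial>lborel) \<le> ennreal (B powr m)"
  shows "(\<integral>\<^sup>+y. ennreal (v y * \<bar>x - y\<bar> powr (- a)) \<partial>lborel)
    \<le> ennreal ((4 * a / (1 - a) + 2 * 4 powr (a / 2)) * B powr (2 - m) * enn2real (hl_maximal v x) powr (m - 1))"
proof -
  define N where "N = enn2real (hl_maximal v x)"
  have "hl_maximal v x < top"
    using hl_maximal_le[where f=v and b=b and x=x] v0 vb by (auto intro: le_less_trans)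
  then have N: "hl_maximal v x = ennreal N" "0 \<le> N" by (simp_all add: N_def)
  have m1: "1 < m" "m * (a / 2) = m - 1" "m * (1 - a) = 2 - m" using a by (auto simp: m field_simps)
  define J where "J l = (\<integral>\<^sup>+y. ennreal (v y) * (if \<bar>x - y\<bar> \<le> l then 1 else 0) \<partial>lborel)" for l
  have [measurable]: "J \<in> borel_measurable borel" unfolding J_def by measurable
  \<comment> \<open>The closed interval of radius l is enlarged to the open ball of radius 2 l, as
    the maximal function uses open balls. This is why lengths appear as 4 l.\<close>
  have J: "J l \<le> (\<integral>\<^sup>+y\<in>ball x (2 * l). ennreal (norm (v y)) \<partial>lborel)" if "0 < l" for l
    unfolding J_def using v0 that by (intro nn_integral_mono) (auto simp: indicator_def dist_real_def)
  have vol: "emeasure lborel (ball x (2 * l)) = ennreal (4 * l)" if "0 < l" for l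
    using that by (subst emeasure_ball) auto
  have J1: "J l \<le> ennreal (4 * l * N)" if "0 < l" for l
  proof -
    have "J l \<le> emeasure lborel (ball x (2 * l)) * hl_maximal v x"
      using J[OF that] nn_integral_ball_le_hl_maximal[of "2 * l" v x] that by (intro order.trans[OF J]) auto
    then show ?thesis using that N by (simp add: vol ennreal_mult)
  qed
  have J2: "J l \<le> ennreal (B * (4 * l) powr (a / 2))" if l: "0 < l" for l
  proof -
    have "(\<integral>\<^sup>+y\<in>ball x (2 * l). ennreal (norm (v y)) \<partial>lborel) = (\<integral>\<^sup>+y. ennreal (v y * indicator (ball x (2 * l)) y) \<partial>lborel)"
      using v0 by (intro nn_integral_cong) (auto simp: indicator_def)
    also have "\<dots> \<le> ennreal (B * (4 * l) powr (a / 2))"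
    proof (rule nn_integral_Holder[OF _ _ _ _ m1(1), where q="2 / a"])
      have "(\<integral>\<^sup>+y. ennreal (indicator (ball x (2 * l)) y powr (2 / a)) \<partial>lborel) = (\<integral>\<^sup>+y. indicator (ball x (2 * l)) y \<partial>lborel)"
        by (intro nn_integral_cong) (auto simp: indicator_def)
      also have "\<dots> = ennreal (4 * l)" using l vol by simp
      finally show "(\<integral>\<^sup>+y. ennreal (indicator (ball x (2 * l)) y powr (2 / a)) \<partial>lborel) \<le> ennreal (((4 * l) powr (a / 2)) powr (2 / a))"
        using a l by (simp add: powr_powr)
    qed (use a v0 vB B in \<open>auto simp: m field_simps intro!: borel_measurable_indicator\<close>)
    finally show ?thesis using J[OF l] by (rule order.trans[rotated])
  qed
  \<comment> \<open>For d > 0, d^(-a) is the integral of a l^(-a-1) over l \<ge> d. On the diagonal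
    \<open>0 powr (- a)\<close> is 0, so nothing is claimed there.\<close>
  have ker: "(\<integral>\<^sup>+l. ennreal (a * l powr (- a - 1)) * (ennreal (v y) * (if \<bar>x - y\<bar> \<le> l then 1 else 0)) * indicator {0<..} l \<partial>lborel)
     \<ge> ennreal (v y * \<bar>x - y\<bar> powr (- a))" for y
  proof (cases "x = y")
    case False
    then have d: "0 < \<bar>x - y\<bar>" by simp
    have "ennreal (v y * \<bar>x - y\<bar> powr (- a)) = ennreal (a * v y) * (\<integral>\<^sup>+l. ennreal (l powr (- a - 1)) * indicator {\<bar>x - y\<bar>..} l \<partial>lborel)"
      using a v0 by (subst nn_integral_powr_Ici[OF a(1) d]) (simp add: ennreal_mult[symmetric])
    also have "\<dots> = (\<integral>\<^sup>+l. ennreal (a * v y) * (ennreal (l powr (- a - 1)) * indicator {\<bar>x - y\<bar>..} l) \<partial>lborel)"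
      by (rule nn_integral_cmult[symmetric]) measurable
    also have "\<dots> \<le> (\<integral>\<^sup>+l. ennreal (a * l powr (- a - 1)) * (ennreal (v y) * (if \<bar>x - y\<bar> \<le> l then 1 else 0)) * indicator {0<..} l \<partial>lborel)"
      using a v0 d by (intro nn_integral_mono) (auto simp: indicator_def ennreal_mult[symmetric] mult_ac)
    finally show ?thesis .
  qed auto
  have "(\<integral>\<^sup>+y. ennreal (v y * \<bar>x - y\<bar> powr (- a)) \<partial>lborel) \<le>
    (\<integral>\<^sup>+y. \<integral>\<^sup>+l. ennreal (a * l powr (- a - 1)) * (ennreal (v y) * (if \<bar>x - y\<bar> \<le> l then 1 else 0)) * indicator {0<..} l \<partial>lborel \<partial>lborel)"
    by (intro nn_integral_mono ker)
  also have "\<dots> = (\<integral>\<^sup>+l. \<integral>\<^sup>+y. ennreal (a * l powr (- a - 1)) * (ennreal (v y) * (if \<bar>x - y\<bar> \<le> l then 1 else 0)) * indicator {0<..} l \<partial>lborel \<partial>lborel)"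
    by (rule nn_integral_swap_lborel) measurable
  also have "\<dots> = (\<integral>\<^sup>+l. ennreal (a * l powr (- a - 1)) * J l * indicator {0<..} l \<partial>lborel)"
    unfolding J_def by (intro nn_integral_cong) (simp add: nn_integral_cmult nn_integral_multc)
  finally have IJ: "(\<integral>\<^sup>+y. ennreal (v y * \<bar>x - y\<bar> powr (- a)) \<partial>lborel)
     \<le> (\<integral>\<^sup>+l. ennreal (a * l powr (- a - 1)) * J l * indicator {0<..} l \<partial>lborel)" .
  show ?thesis
  \<comment> \<open>The balancing radius needs N > 0. For N = 0 every local mass \<open>J l\<close>
    with l > 0 vanishes.\<close>
  proof (cases "N = 0")
    case True
    have J0: "J l * indicator {0<..} l = 0" for l
      using J1[of l] True by (auto simp: indicator_def)
    have "(\<integral>\<^sup>+l. ennreal (a * l powr (- a - 1)) * J l * indicator {0<..} l \<partial>lborel) = 0"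
      by (simp only: mult.assoc J0 mult_zero_right nn_integral_const mult_zero_left)
    with IJ show ?thesis by simp
  next
    case False
    with N have N0: "0 < N" by simp
    define R where "R = (B / N) powr m"
    have R: "0 < R" using B N0 by (simp add: R_def)
    have "(\<integral>\<^sup>+l. ennreal (a * l powr (- a - 1)) * J l * indicator {0<..} l \<partial>lborel)
      \<le> (\<integral>\<^sup>+l. ennreal (4 * a * N) * (ennreal (l powr ((1 - a) - 1)) * indicator {0..R} l)
         + ennreal (a * B * 4 powr (a / 2)) * (ennreal (l powr (- (a / 2) - 1)) * indicator {R..} l) \<partial>lborel)"
    proof (rule nn_integral_mono)
      fix l
      consider "l \<le> 0" | "0 < l" "l \<le> R" | "0 < l" "R < l" by linarith
      then show "ennreal (a * l powr (- a - 1)) * J l * indicator {0<..} l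
        \<le> ennreal (4 * a * N) * (ennreal (l powr ((1 - a) - 1)) * indicator {0..R} l)
         + ennreal (a * B * 4 powr (a / 2)) * (ennreal (l powr (- (a / 2) - 1)) * indicator {R..} l)"
      proof cases
        case 2
        have "ennreal (a * l powr (- a - 1)) * J l \<le> ennreal (a * l powr (- a - 1)) * ennreal (4 * l * N)"
          using 2 by (intro mult_left_mono J1) auto
        also have "\<dots> = ennreal (a * l powr (- a - 1) * (4 * l * N))"
          using 2 N a by (simp add: ennreal_mult[symmetric])
        also have "a * l powr (- a - 1) * (4 * l * N) = 4 * a * N * l powr ((1 - a) - 1)"
          using 2 powr_add[of l "- a - 1" 1] by simp
        also have "ennreal \<dots> = ennreal (4 * a * N) * ennreal (l powr ((1 - a) - 1))"
          using a N by (simp add: ennreal_mult)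
        finally show ?thesis using 2 by (auto simp: indicator_def intro: add_increasing2)
      next
        case 3
        have "ennreal (a * l powr (- a - 1)) * J l \<le> ennreal (a * l powr (- a - 1)) * ennreal (B * (4 * l) powr (a / 2))"
          using 3 by (intro mult_left_mono J2) auto
        also have "\<dots> = ennreal (a * l powr (- a - 1) * (B * (4 * l) powr (a / 2)))"
          using 3 N a B by (simp add: ennreal_mult[symmetric])
        also have "a * l powr (- a - 1) * (B * (4 * l) powr (a / 2)) = a * B * 4 powr (a / 2) * (l powr (- a - 1) * l powr (a / 2))"
          using 3 by (simp add: powr_mult)
        also have "l powr (- a - 1) * l powr (a / 2) = l powr (- (a / 2) - 1)"
          by (simp add: powr_add[symmetric])
        also have "ennreal (a * B * 4 powr (a / 2) * l powr (- (a / 2) - 1)) = ennreal (a * B * 4 powr (a / 2)) * ennreal (l powr (- (a / 2) - 1))"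
          using a B by (simp add: ennreal_mult)
        finally show ?thesis using 3 by (auto simp: indicator_def)
      qed auto
    qed
    also have "\<dots> = ennreal (4 * a * N) * ennreal (R powr (1 - a) / (1 - a))
       + ennreal (a * B * 4 powr (a / 2)) * ennreal (R powr (- (a / 2)) / (a / 2))"
      using nn_integral_powr_Icc_0[of "1 - a" R] nn_integral_powr_Ici[of "a / 2" R] a R
      by (simp add: nn_integral_add nn_integral_cmult)
    also have "\<dots> = ennreal (4 * a * N * (R powr (1 - a) / (1 - a)) + a * B * 4 powr (a / 2) * (R powr (- (a / 2)) / (a / 2)))"
      using a N B by (simp add: ennreal_mult[symmetric] ennreal_plus[symmetric] del: ennreal_plus)
    also have "4 * a * N * (R powr (1 - a) / (1 - a)) + a * B * 4 powr (a / 2) * (R powr (- (a / 2)) / (a / 2))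
       = 4 * a / (1 - a) * (N * R powr (1 - a)) + 2 * 4 powr (a / 2) * (B * R powr (- (a / 2)))"
      using a by simp
    also have "N * R powr (1 - a) = B powr (2 - m) * N powr (m - 1)"
    proof -
      have "N * R powr (1 - a) = N * (B / N) powr (2 - m)" unfolding R_def powr_powr m1(3) ..
      also have "\<dots> = B powr (2 - m) * (N powr 1 * N powr (- (2 - m)))"
        unfolding powr_minus using B N0 by (simp add: powr_divide field_simps)
      also have "N powr 1 * N powr (- (2 - m)) = N powr (m - 1)" by (simp only: powr_add[symmetric]) simp
      finally show ?thesis .
    qed
    also have "B * R powr (- (a / 2)) = B powr (2 - m) * N powr (m - 1)"
    proof -
      have "B * R powr (- (a / 2)) = B * (B / N) powr (- (m - 1))"
        unfolding R_def powr_powr mult_minus_right m1(2) ..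
      also have "\<dots> = (B powr 1 * B powr (- (m - 1))) * N powr (m - 1)"
        unfolding powr_minus using B N0 by (simp add: powr_divide field_simps)
      also have "B powr 1 * B powr (- (m - 1)) = B powr (2 - m)" by (simp only: powr_add[symmetric]) simp
      finally show ?thesis .
    qed
    finally show ?thesis using IJ unfolding N_def[symmetric]
      by (simp add: distrib_right mult.assoc)
  qed
qed

text \<open>The first factor is the constant of Hedberg's bound. The second is the L^m constant of
  the maximal theorem in dimension one, raised to a / 2 = 1 - 1/m by Hoelder's inequality.\<close>

definition HLS_const :: "real \<Rightarrow> real" where
  "HLS_const a = (let m = 2 / (2 - a) in
     (4 * a / (1 - a) + 2 * 4 powr (a / 2)) * (5 * m * 2 powr m / (m - 1)) powr (a / 2))"

lemma HLS_const_pos: "0 < a \<Longrightarrow> a < 1 \<Longrightarrow> 0 < HLS_const a"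
  unfolding HLS_const_def Let_def by (intro mult_pos_pos add_pos_pos) (auto simp: field_simps)

text \<open>The diagonal case 2/m + a = 2. Hedberg's bound replaces the fractional integral of v by
  a power m - 1 of its maximal function. Hoelder's inequality with exponents m and 2 / a then asks
  for exactly the L^m norm of that maximal function.\<close>

theorem Hardy_Littlewood_Sobolev_real:
  fixes u v :: "real \<Rightarrow> real" and a A B b :: real
  defines "m \<equiv> 2 / (2 - a)"
  assumes a: "0 < a" "a < 1"
    and [measurable]: "u \<in> borel_measurable borel" "v \<in> borel_measurable borel"
    and u0: "\<And>x. 0 \<le> u x" and v0: "\<And>x. 0 \<le> v x" and vb: "\<And>x. v x \<le> b" and AB: "0 < A" "0 < B"
    and uA: "(\<integral>\<^sup>+x. ennreal (u x powr m) \<partial>lborel) \<le> ennreal (A powr m)"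
    and vB: "(\<integral>\<^sup>+x. ennreal (v x powr m) \<partial>lborel) \<le> ennreal (B powr m)"
  shows "(\<integral>\<^sup>+x. \<integral>\<^sup>+y. ennreal (u x * v y * \<bar>x - y\<bar> powr (- a)) \<partial>lborel \<partial>lborel) \<le> ennreal (HLS_const a * A * B)"
proof -
  have m1: "1 < m" "m * (a / 2) = m - 1" "(m - 1) * (2 / a) = m" using a by (auto simp: m_def field_simps)
  define c where "c = 4 * a / (1 - a) + 2 * 4 powr (a / 2)"
  define K where "K = 5 * m * 2 powr m / (m - 1)"
  have c: "0 < c" unfolding c_def using a by (intro add_pos_pos) auto
  have K: "0 < K" unfolding K_def using m1 by auto
  define N where "N x = enn2real (hl_maximal v x)" for x
  have [measurable]: "N \<in> borel_measurable borel" unfolding N_def by measurable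
  have NB: "(\<integral>\<^sup>+x. ennreal (N x powr m) \<partial>lborel) \<le> ennreal (K * B powr m)"
  proof -
    have "(\<integral>\<^sup>+x. ennreal (N x powr m) \<partial>lborel) \<le> ennreal K * (\<integral>\<^sup>+x. ennreal (norm (v x) powr m) \<partial>lborel)"
      using hl_maximal_strong_type[of v b m] v0 vb m1(1) unfolding N_def K_def by simp
    also have "\<dots> \<le> ennreal K * ennreal (B powr m)"
      using vB v0 by (intro mult_left_mono) auto
    finally show ?thesis using K by (simp add: ennreal_mult)
  qed
  have "(\<integral>\<^sup>+x. \<integral>\<^sup>+y. ennreal (u x * v y * \<bar>x - y\<bar> powr (- a)) \<partial>lborel \<partial>lborel)
    = (\<integral>\<^sup>+x. ennreal (u x) * (\<integral>\<^sup>+y. ennreal (v y * \<bar>x - y\<bar> powr (- a)) \<partial>lborel) \<partial>lborel)"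
    using u0 v0 by (simp add: mult.assoc ennreal_mult nn_integral_cmult)
  also have "\<dots> \<le> (\<integral>\<^sup>+x. ennreal (u x) * ennreal (c * B powr (2 - m) * N x powr (m - 1)) \<partial>lborel)"
    unfolding c_def N_def
    by (intro nn_integral_mono mult_left_mono Hedberg[OF a meta_eq_to_obj_eq[OF m_def] _ v0 vb AB(2) vB]) auto
  also have "\<dots> = ennreal (c * B powr (2 - m)) * (\<integral>\<^sup>+x. ennreal (u x * N x powr (m - 1)) \<partial>lborel)"
    using c u0 by (subst nn_integral_cmult[symmetric]) (auto simp: ennreal_mult[symmetric] mult_ac)
  also have "\<dots> \<le> ennreal (c * B powr (2 - m)) * ennreal (A * (K * B powr m) powr (a / 2))"
  proof (intro mult_left_mono nn_integral_Holder[where p=m and q="2 / a"])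
    show "(\<integral>\<^sup>+x. ennreal ((N x powr (m - 1)) powr (2 / a)) \<partial>lborel) \<le> ennreal (((K * B powr m) powr (a / 2)) powr (2 / a))"
      using NB a K AB unfolding powr_powr m1(3) by simp
  qed (use a m1 uA u0 AB in \<open>auto simp: m_def field_simps\<close>)
  also have "\<dots> = ennreal (c * B powr (2 - m) * (A * (K * B powr m) powr (a / 2)))"
    using c AB by (simp add: ennreal_mult[symmetric])
  also have "c * B powr (2 - m) * (A * (K * B powr m) powr (a / 2)) = c * K powr (a / 2) * A * (B powr (2 - m) * B powr (m - 1))"
    using K AB m1(2) by (simp add: powr_mult powr_powr del: times_divide_eq_right)
  also have "B powr (2 - m) * B powr (m - 1) = B" using AB by (simp add: powr_add[symmetric])
  finally show ?thesis unfolding HLS_const_def m_def[symmetric] Let_def c_def K_def by (simp add: mult_ac)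
qed

section \<open>The singular kernel on the circle\<close>

lemma half_le_abs_sin:
  fixes y :: real
  assumes "\<bar>y\<bar> \<le> pi / 2"
  shows "\<bar>y\<bar> / 2 \<le> \<bar>sin y\<bar>"
proof -
  have "\<bar>sin y - (\<Sum>m<3. sin_coeff m * y ^ m)\<bar> \<le> inverse (fact 3) * \<bar>y\<bar> ^ 3"
    by (rule Maclaurin_sin_bound)
  also have "(\<Sum>m<3. sin_coeff m * y ^ m) = y"
    by (simp add: numeral_3_eq_3 sin_coeff_def)
  also have "inverse (fact 3) * \<bar>y\<bar> ^ 3 = \<bar>y\<bar> * (\<bar>y\<bar>\<^sup>2 / 6)"
    by (simp add: fact_numeral power3_eq_cube power2_eq_square)
  \<comment> \<open>pi / 2 is below 17 / 10, and (17 / 10)^2 / 6 is below 1 / 2.\<close>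
  also have "\<dots> \<le> \<bar>y\<bar> * (1 / 2)"
  proof (rule mult_left_mono)
    have "pi \<le> 34 / 10" using pi_approx(2) by simp
    then have "\<bar>y\<bar> \<le> 17 / 10" using assms by linarith
    then have "\<bar>y\<bar>\<^sup>2 \<le> (17 / 10)\<^sup>2" by (intro power_mono) auto
    then show "\<bar>y\<bar>\<^sup>2 / 6 \<le> 1 / 2" by (simp add: power2_eq_square)
  qed simp
  finally show ?thesis by linarith
qed

text \<open>The multiple of pi nearest to t has index at most 2 in modulus, and |sin t| is at least
  half the distance to it. Summing over all five indices removes the dependence of the index on t
  and leaves translates of one kernel. If sin t = 0, the left side is 0 by the convention for
  \<open>powr\<close>.\<close>

lemma abs_sin_powr_le:
  fixes t a :: real
  assumes a: "0 < a" and t: "\<bar>t\<bar> < 2 * pi"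
  shows "\<bar>sin t\<bar> powr (- a) \<le> 2 powr a * (\<Sum>k\<in>{-2..2::int}. \<bar>t - of_int k * pi\<bar> powr (- a))"
proof (cases "sin t = 0")
  case False
  define k where "k = round (t / pi)"
  define y where "y = t - of_int k * pi"
  have r: "\<bar>of_int k - t / pi\<bar> \<le> 1 / 2" unfolding k_def by (rule of_int_round_abs_le)
  have "y = pi * (t / pi - of_int k)" by (simp add: y_def algebra_simps)
  then have "\<bar>y\<bar> = pi * \<bar>of_int k - t / pi\<bar>" by (simp add: abs_mult abs_minus_commute)
  also have "\<dots> \<le> pi * (1 / 2)" using r by (intro mult_left_mono) auto
  finally have y: "\<bar>y\<bar> \<le> pi / 2" by simp
  have "\<bar>t / pi\<bar> < 2" using t by (simp add: field_simps)
  then have "\<bar>of_int k\<bar> < (3 :: real)" using r by linarith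
  then have k: "k \<in> {-2..2}" by auto
  have "sin t = sin y * cos (pi * of_int k)"
    using sin_add[of y "pi * of_int k"] by (simp add: y_def mult.commute)
  then have sy: "\<bar>sin t\<bar> = \<bar>sin y\<bar>" by (simp add: abs_mult)
  then have y0: "0 < \<bar>y\<bar>" using False by auto
  have "\<bar>sin t\<bar> powr (- a) \<le> (\<bar>y\<bar> / 2) powr (- a)"
    unfolding sy using half_le_abs_sin[OF y] y0 a by (intro powr_mono2') auto
  also have "\<dots> = 2 powr a * \<bar>y\<bar> powr (- a)"
    using y0 by (simp add: powr_divide powr_minus_divide)
  also have "\<bar>y\<bar> powr (- a) \<le> (\<Sum>k\<in>{-2..2::int}. \<bar>t - of_int k * pi\<bar> powr (- a))"
    unfolding y_def using k by (intro member_le_sum) auto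
  finally show ?thesis by simp
qed (simp add: sum_nonneg)

text \<open>Each of the five kernels pairs u with a translate of u by a multiple of pi, which has
  the same norm and the same bound. The estimate on the line therefore applies five times, hence the
  factor 5.\<close>

theorem Hardy_Littlewood_Sobolev_circle:
  fixes u :: "real \<Rightarrow> real" and a A b :: real
  assumes a: "0 < a" "a < 1"
    and [measurable]: "u \<in> borel_measurable borel" and u: "\<And>x. 0 \<le> u x" "\<And>x. u x \<le> b"
    and us: "\<And>x. x \<notin> {0..<2 * pi} \<Longrightarrow> u x = 0"
    and A: "0 < A" and uA: "(\<integral>\<^sup>+x. ennreal (u x powr (2 / (2 - a))) \<partial>lborel) \<le> ennreal (A powr (2 / (2 - a)))"
  shows "(\<integral>\<^sup>+x. \<integral>\<^sup>+y. ennreal (u x * u y * \<bar>sin (x - y)\<bar> powr (- a)) \<partial>lborel \<partial>lborel)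
    \<le> ennreal (2 powr a * 5 * HLS_const a * A\<^sup>2)"
proof -
  note C = HLS_const_pos[OF a]
  have "(\<integral>\<^sup>+x. \<integral>\<^sup>+y. ennreal (u x * u y * \<bar>sin (x - y)\<bar> powr (- a)) \<partial>lborel \<partial>lborel)
    \<le> (\<integral>\<^sup>+x. \<integral>\<^sup>+y. ennreal (2 powr a) * (\<Sum>k\<in>{-2..2::int}. ennreal (u x * u y * \<bar>x - y - of_int k * pi\<bar> powr (- a))) \<partial>lborel \<partial>lborel)"
  proof (intro nn_integral_mono)
    fix x y
    have "u x * u y * \<bar>sin (x - y)\<bar> powr (- a) \<le> 2 powr a * (\<Sum>k\<in>{-2..2::int}. u x * u y * \<bar>x - y - of_int k * pi\<bar> powr (- a))"
    proof (cases "x \<in> {0..<2 * pi} \<and> y \<in> {0..<2 * pi}")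
      case True
      then have "\<bar>x - y\<bar> < 2 * pi" by auto
      then have "u x * u y * \<bar>sin (x - y)\<bar> powr (- a) \<le> u x * u y * (2 powr a * (\<Sum>k\<in>{-2..2::int}. \<bar>x - y - of_int k * pi\<bar> powr (- a)))"
        using u a by (intro mult_left_mono abs_sin_powr_le) auto
      then show ?thesis by (simp only: sum_distrib_left mult_ac)
    qed (use us in auto)
    then show "ennreal (u x * u y * \<bar>sin (x - y)\<bar> powr (- a)) \<le>
       ennreal (2 powr a) * (\<Sum>k\<in>{-2..2::int}. ennreal (u x * u y * \<bar>x - y - of_int k * pi\<bar> powr (- a)))"
      using u by (subst sum_ennreal) (auto simp: ennreal_mult[symmetric] sum_nonneg intro!: ennreal_leI)
  qed
  also have "\<dots> = ennreal (2 powr a) * (\<Sum>k\<in>{-2..2::int}. \<integral>\<^sup>+x. \<integral>\<^sup>+y. ennreal (u x * u y * \<bar>x - y - of_int k * pi\<bar> powr (- a)) \<partial>lborel \<partial>lborel)"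
    by (simp add: nn_integral_cmult nn_integral_sum del: sum_ennreal)
  also have "\<dots> \<le> ennreal (2 powr a) * (\<Sum>k\<in>{-2..2::int}. ennreal (HLS_const a * A * A))"
  proof (intro mult_left_mono sum_mono)
    fix k :: int
    define v where "v y = u (- (of_int k * pi) + y)" for y
    have [measurable]: "v \<in> borel_measurable borel" unfolding v_def by measurable
    have "(\<integral>\<^sup>+x. \<integral>\<^sup>+y. ennreal (u x * u y * \<bar>x - y - of_int k * pi\<bar> powr (- a)) \<partial>lborel \<partial>lborel)
      = (\<integral>\<^sup>+x. \<integral>\<^sup>+y. ennreal (u x * v y * \<bar>x - y\<bar> powr (- a)) \<partial>lborel \<partial>lborel)"
    proof (rule nn_integral_cong)
      fix x
      show "(\<integral>\<^sup>+y. ennreal (u x * u y * \<bar>x - y - of_int k * pi\<bar> powr (- a)) \<partial>lborel) = (\<integral>\<^sup>+y. ennreal (u x * v y * \<bar>x - y\<bar> powr (- a)) \<partial>lborel)"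
        using nn_integral_lborel_plus[of "\<lambda>y. ennreal (u x * u y * \<bar>x - y - of_int k * pi\<bar> powr (- a))" "- (of_int k * pi)"]
        by (simp add: v_def)
    qed
    also have "\<dots> \<le> ennreal (HLS_const a * A * A)"
    proof (rule Hardy_Littlewood_Sobolev_real[OF a, where b=b])
      show "(\<integral>\<^sup>+x. ennreal (v x powr (2 / (2 - a))) \<partial>lborel) \<le> ennreal (A powr (2 / (2 - a)))"
        using nn_integral_lborel_plus[of "\<lambda>y. ennreal (u y powr (2 / (2 - a)))" "- (of_int k * pi)"] uA
        by (simp add: v_def)
    qed (use u uA A in \<open>auto simp: v_def\<close>)
    finally show "(\<integral>\<^sup>+x. \<integral>\<^sup>+y. ennreal (u x * u y * \<bar>x - y - of_int k * pi\<bar> powr (- a)) \<partial>lborel \<partial>lborel) \<le> ennreal (HLS_const a * A * A)" .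
  qed auto
  also have "\<dots> = ennreal (2 powr a * (5 * (HLS_const a * A * A)))"
    using C A by (simp add: ennreal_mult)
  finally show ?thesis by (simp add: power2_eq_square mult_ac)
qed

section \<open>Sums of two points of the circle\<close>

lemma vec2_measurable [measurable]:
  fixes f g :: "'a \<Rightarrow> real"
  assumes [measurable]: "f \<in> borel_measurable M" "g \<in> borel_measurable M"
  shows "(\<lambda>x. vector [f x, g x] :: real^2) \<in> borel_measurable M"
proof (subst borel_measurable_euclidean_space, intro ballI)
  fix i :: "real^2" assume "i \<in> Basis"
  then obtain j where "i = axis j 1" by (auto simp: Basis_vec_def)
  then show "(\<lambda>x. (vector [f x, g x] :: real^2) \<bullet> i) \<in> borel_measurable M"
    using exhaust_2[of j] by (auto simp: inner_axis)
qed

lemma vec_nth_measurable [measurable]: "(\<lambda>x::real^2. x $ i) \<in> borel_measurable borel"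
  by (intro borel_measurable_continuous_onI continuous_intros)

lemma Basis_real2: "(Basis :: (real^2) set) = {axis 1 1, axis 2 1}"
  by (auto simp: Basis_vec_def) (metis exhaust_2)

lemma lborel_real2: "(lborel :: (real^2) measure) = distr (lborel \<Otimes>\<^sub>M lborel) borel (\<lambda>(a, b). vector [a, b])"
proof (rule lborel_eqI)
  fix l u :: "real^2"
  assume le: "\<And>b. b \<in> Basis \<Longrightarrow> l \<bullet> b \<le> u \<bullet> b"
  have le': "l $ 1 \<le> u $ 1" "l $ 2 \<le> u $ 2"
    using le[of "axis 1 1"] le[of "axis 2 1"] by (auto simp: Basis_real2 inner_axis)
  have "emeasure (distr (lborel \<Otimes>\<^sub>M lborel) borel (\<lambda>(a, b). vector [a, b])) (box l u)
    = emeasure (lborel \<Otimes>\<^sub>M lborel) ({l $ 1<..<u $ 1} \<times> {l $ 2<..<u $ 2})"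
    by (subst emeasure_distr)
       (auto intro!: arg_cong2[where f=emeasure] simp: mem_box_cart forall_2 space_pair_measure)
  also have "\<dots> = ennreal ((u $ 1 - l $ 1) * (u $ 2 - l $ 2))"
    using le' by (subst lborel.emeasure_pair_measure_Times) (auto simp: ennreal_mult)
  also have "(u $ 1 - l $ 1) * (u $ 2 - l $ 2) = (\<Prod>b\<in>Basis. (u - l) \<bullet> b)"
    by (simp add: Basis_real2 axis_eq_axis inner_axis)
  finally show "emeasure (distr (lborel \<Otimes>\<^sub>M lborel) borel (\<lambda>(a, b). vector [a, b])) (box l u) = (\<Prod>b\<in>Basis. (u - l) \<bullet> b)" .
qed simp

lemma nn_integral_real2:
  fixes F :: "real \<Rightarrow> real \<Rightarrow> ennreal"
  assumes [measurable]: "(\<lambda>(a, b). F a b) \<in> borel_measurable (borel \<Otimes>\<^sub>M borel)"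
  shows "(\<integral>\<^sup>+x. F (x $ 1) (x $ 2) \<partial>(lborel :: (real^2) measure)) = (\<integral>\<^sup>+a. \<integral>\<^sup>+b. F a b \<partial>lborel \<partial>lborel)"
proof -
  have "(\<integral>\<^sup>+x. F (x $ 1) (x $ 2) \<partial>(lborel :: (real^2) measure)) = (\<integral>\<^sup>+(a, b). F a b \<partial>(lborel \<Otimes>\<^sub>M lborel))"
    unfolding lborel_real2 by (subst nn_integral_distr) (auto simp: case_prod_unfold)
  also have "\<dots> = (\<integral>\<^sup>+a. \<integral>\<^sup>+b. F a b \<partial>lborel \<partial>lborel)"
    by (subst lborel.nn_integral_fst[symmetric]) auto
  finally show ?thesis .
qed

definition circ :: "real \<Rightarrow> real^2" where
  "circ t = vector [cos t, sin t]"

lemma circ_measurable [measurable]: "circ \<in> borel_measurable borel"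
  unfolding circ_def by measurable

text \<open>A nonzero sum of two unit vectors determines the unordered pair: in complex notation the product
  of the two is the quotient of the sum by its conjugate.\<close>

lemma cis_sum_inj:
  assumes eq: "cis a + cis b = cis c + cis d" and nz: "cis a + cis b \<noteq> 0"
  shows "(cis a = cis c \<and> cis b = cis d) \<or> (cis a = cis d \<and> cis b = cis c)"
proof -
  have prod: "cis x * cis y * cnj (cis x + cis y) = cis x + cis y" for x y
    by (simp add: cis_cnj distrib_left cis_mult)
  have "cis a * cis b * cnj (cis a + cis b) = cis c * cis d * cnj (cis a + cis b)"
    using prod[of a b] prod[of c d] eq by metis
  moreover have "cnj (cis a + cis b) \<noteq> 0" using nz by (metis complex_cnj_zero_iff)
  ultimately have p: "cis a * cis b = cis c * cis d" by simp
  have "(cis a - cis c) * (cis a - cis d) = cis a * cis a - cis a * (cis c + cis d) + cis c * cis d"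
    by (simp add: algebra_simps)
  also have "\<dots> = 0" by (simp add: eq[symmetric] p[symmetric] algebra_simps)
  finally have "cis a = cis c \<or> cis a = cis d" by simp
  then show ?thesis using eq by auto
qed

lemma cis_inj_on: "inj_on cis {0..<2 * pi}"
proof (rule inj_onI)
  fix x y assume xy: "x \<in> {0..<2 * pi}" "y \<in> {0..<2 * pi}" and "cis x = cis y"
  then have "sin x = sin y \<and> cos x = cos y" by (simp add: complex_eq_iff)
  then obtain n :: int where n: "x = y + 2 * n * pi" using sin_cos_eq_iff[of x y] by auto
  have "\<bar>x - y\<bar> < 2 * pi" using xy by auto
  then have "\<bar>of_int n\<bar> * (2 * pi) < 1 * (2 * pi)" using n by (simp add: abs_mult)
  then have "\<bar>of_int n :: real\<bar> < 1" by (subst (asm) mult_less_cancel_right) auto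
  then show "x = y" using n by simp
qed

definition circ_sum :: "real^2 \<Rightarrow> real^2" where
  "circ_sum x = circ (x $ 1) + circ (x $ 2)"

text \<open>One ordering of each pair of angles. Pairs differing by pi are removed because all of
  them have sum 0, so that injectivity fails there; they form a null set on which the Jacobian
  vanishes.\<close>

definition circ_triangle :: "(real^2) set" where
  "circ_triangle = {x. 0 \<le> x $ 1 \<and> x $ 1 < x $ 2 \<and> x $ 2 < 2 * pi \<and> x $ 2 \<noteq> x $ 1 + pi}"

lemma circ_sum_inj: "inj_on circ_sum circ_triangle"
proof (rule inj_onI)
  fix x y assume x: "x \<in> circ_triangle" and y: "y \<in> circ_triangle" and eq: "circ_sum x = circ_sum y"
  have e: "cis (x $ 1) + cis (x $ 2) = cis (y $ 1) + cis (y $ 2)"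
    using eq by (simp add: circ_sum_def circ_def vec_eq_iff forall_2 complex_eq_iff)
  \<comment> \<open>A vanishing sum makes the difference of the angles an odd multiple of pi, and in
    (0, 2 pi) only the excluded value pi is one.\<close>
  have nz: "cis (x $ 1) + cis (x $ 2) \<noteq> 0"
  proof
    assume "cis (x $ 1) + cis (x $ 2) = 0"
    then have "cis (x $ 2) = cis (x $ 1 + pi)"
      by (simp add: complex_eq_iff add_eq_0_iff2)
    then have sc: "sin (x $ 2) = sin (x $ 1 + pi) \<and> cos (x $ 2) = cos (x $ 1 + pi)" by (simp add: complex_eq_iff)
    then obtain n :: int where n: "x $ 2 = x $ 1 + pi + 2 * n * pi" using sin_cos_eq_iff[of "x $ 2" "x $ 1 + pi"] by auto
    have "0 < x $ 2 - x $ 1" "x $ 2 - x $ 1 < 2 * pi" using x by (auto simp: circ_triangle_def)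
    then have "0 * pi < (1 + 2 * of_int n) * pi" "(1 + 2 * of_int n) * pi < 2 * pi"
      using n by (auto simp: algebra_simps)
    then have "0 < 1 + 2 * real_of_int n" "(1 + 2 * of_int n :: real) < 2"
      by (simp_all only: mult_less_cancel_right_pos[OF pi_gt_zero])
    then have "n = 0" by simp
    then show False using n x by (auto simp: circ_triangle_def)
  qed
  have r: "x $ 1 \<in> {0..<2 * pi}" "x $ 2 \<in> {0..<2 * pi}" "y $ 1 \<in> {0..<2 * pi}" "y $ 2 \<in> {0..<2 * pi}"
    using x y by (auto simp: circ_triangle_def)
  note i = inj_onD[OF cis_inj_on]
  from cis_sum_inj[OF e nz] have "x $ 1 = y $ 1 \<and> x $ 2 = y $ 2 \<or> x $ 1 = y $ 2 \<and> x $ 2 = y $ 1"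
    using i[OF _ r(1,3)] i[OF _ r(2,4)] i[OF _ r(1,4)] i[OF _ r(2,3)] by metis
  then have "x $ 1 = y $ 1 \<and> x $ 2 = y $ 2"
    using x y unfolding circ_triangle_def mem_Collect_eq by linarith
  then show "x = y" by (simp add: vec_eq_iff forall_2)
qed

definition circ_sum_deriv :: "real^2 \<Rightarrow> real^2 \<Rightarrow> real^2" where
  "circ_sum_deriv x h = vector [- sin (x $ 1) * h $ 1 - sin (x $ 2) * h $ 2, cos (x $ 1) * h $ 1 + cos (x $ 2) * h $ 2]"

lemma has_derivative_circ_sum: "(circ_sum has_derivative circ_sum_deriv x) (at x within S)"
proof -
  have nth: "((\<lambda>x. x $ i) has_derivative (\<lambda>h. h $ i)) (at x within S)" for i :: 2 and x :: "real^2" and S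
    using bounded_linear_vec_nth by (rule bounded_linear_imp_has_derivative)
  have nth_eq: "circ_sum x $ 1 = cos (x $ 1) + cos (x $ 2)" "circ_sum x $ 2 = sin (x $ 1) + sin (x $ 2)" for x
    by (simp_all add: circ_sum_def circ_def)
  show ?thesis
  proof (subst has_derivative_componentwise_within, intro ballI)
    fix i :: "real^2" assume "i \<in> Basis"
    then have "i = axis 1 1 \<or> i = axis 2 1" by (simp add: Basis_real2)
    moreover have "((\<lambda>x. cos (x $ 1) + cos (x $ 2)) has_derivative (\<lambda>h. - sin (x $ 1) * h $ 1 - sin (x $ 2) * h $ 2)) (at x within S)"
      by (auto intro!: derivative_eq_intros nth)
    moreover have "((\<lambda>x. sin (x $ 1) + sin (x $ 2)) has_derivative (\<lambda>h. cos (x $ 1) * h $ 1 + cos (x $ 2) * h $ 2)) (at x within S)"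
      by (auto intro!: derivative_eq_intros nth)
    ultimately show "((\<lambda>x. circ_sum x \<bullet> i) has_derivative (\<lambda>h. circ_sum_deriv x h \<bullet> i)) (at x within S)"
      by (auto simp: nth_eq circ_sum_deriv_def inner_axis)
  qed
qed

lemma det_circ_sum_deriv: "det (matrix (circ_sum_deriv x)) = sin (x $ 2 - x $ 1)"
  by (simp add: det_2 matrix_def circ_sum_deriv_def axis_def sin_diff)

lemma circ_triangle_sets [measurable]: "circ_triangle \<in> sets borel"
  unfolding circ_triangle_def by measurable

text \<open>Change of variables with Jacobian sin of the angle difference. It is an inequality
  because the integral over the image is enlarged to one over the whole plane.\<close>

lemma nn_integral_circ_triangle_le:
  fixes W :: "real^2 \<Rightarrow> real"
  assumes [measurable]: "W \<in> borel_measurable borel" and W: "\<And>z. 0 \<le> W z"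
  shows "(\<integral>\<^sup>+x\<in>circ_triangle. ennreal (\<bar>sin (x $ 2 - x $ 1)\<bar> * W (circ_sum x)) \<partial>lborel) \<le> (\<integral>\<^sup>+z. ennreal (W z) \<partial>lborel)"
proof (cases "(\<integral>\<^sup>+z. ennreal (W z) \<partial>lborel) = \<infinity>")
  case False
  have cs [measurable]: "circ_sum \<in> borel_measurable borel" unfolding circ_sum_def by measurable
  have Wi: "integrable lborel W"
    using False W by (intro integrableI_nonneg) (auto simp: top.not_eq_extremum)
  have Wa: "W absolutely_integrable_on UNIV"
    using Wi by (simp add: set_integrable_def integrable_completion)
  have T: "circ_triangle \<in> sets lebesgue" by simp
  have "circ_sum differentiable_on circ_triangle"
    unfolding differentiable_on_def differentiable_def using has_derivative_circ_sum by blast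
  then have I: "circ_sum ` circ_triangle \<in> sets lebesgue"
    by (intro differentiable_image_in_sets_lebesgue T) auto
  have WI: "W absolutely_integrable_on (circ_sum ` circ_triangle)"
    by (rule set_integrable_subset[OF Wa I]) simp
  \<comment> \<open>The scalar integrand is wrapped into \<open>real^1\<close> because the change of
    variables theorem is stated for vector-valued integrands.\<close>
  define J where "J = (\<lambda>x. vec (\<bar>sin (x $ 2 - x $ 1)\<bar> * W (circ_sum x)) :: real^1)"
  have J: "J = (\<lambda>x. \<bar>det (matrix (circ_sum_deriv x))\<bar> *\<^sub>R vec (W (circ_sum x)))"
    by (simp add: J_def det_circ_sum_deriv vec_eq_iff fun_eq_iff)
  note cv = has_absolute_integral_change_of_variables[OF T has_derivative_circ_sum circ_sum_inj, where f="\<lambda>z. vec (W z) :: real^1"]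
  have Wim: "(\<lambda>z. vec (W z) :: real^1) absolutely_integrable_on (circ_sum ` circ_triangle)"
    using WI by (simp add: absolutely_integrable_on_1_iff)
  have JT: "J absolutely_integrable_on circ_triangle"
    "integral circ_triangle J = integral (circ_sum ` circ_triangle) (\<lambda>z. vec (W z) :: real^1)"
    using cv Wim unfolding J by blast+
  let ?h = "\<lambda>x. \<bar>sin (x $ 2 - x $ 1)\<bar> * W (circ_sum x)"
  have h: "?h absolutely_integrable_on circ_triangle"
    using JT(1) by (simp add: absolutely_integrable_on_1_iff J_def)
  have "integral circ_triangle ?h = integral (circ_sum ` circ_triangle) W"
    using JT(2) by (simp add: integral_on_1_eq J_def)
  also have "\<dots> \<le> integral UNIV W"
    using Wa WI W by (intro integral_subset_le) (auto simp: absolutely_integrable_on_def)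
  finally have le: "integral circ_triangle ?h \<le> integral UNIV W" .
  have "(\<integral>\<^sup>+x\<in>circ_triangle. ennreal (?h x) \<partial>lborel) = ennreal (integral circ_triangle ?h)"
    using h W by (intro nn_integral_has_integral_lebesgue' integrable_integral) (auto simp: absolutely_integrable_on_def)
  also have "\<dots> \<le> ennreal (integral UNIV W)" using le by (rule ennreal_leI)
  also have "\<dots> = (\<integral>\<^sup>+z\<in>UNIV. ennreal (W z) \<partial>lborel)"
    using Wa W by (intro nn_integral_has_integral_lebesgue'[symmetric] integrable_integral) (auto simp: absolutely_integrable_on_def)
  finally show ?thesis by simp
qed simp

text \<open>The factor 2 counts the two orderings of a pair. On the diagonal and on antipodal pairs,
  which lie in neither triangle, the weight |sin| is 0.\<close>

theorem nn_integral_circ_sum_le: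
  fixes W :: "real^2 \<Rightarrow> real"
  assumes [measurable]: "W \<in> borel_measurable borel" and W: "\<And>z. 0 \<le> W z"
  shows "(\<integral>\<^sup>+a. \<integral>\<^sup>+b. ennreal (\<bar>sin (a - b)\<bar> * W (circ a + circ b)) * indicator {0..<2 * pi} a * indicator {0..<2 * pi} b \<partial>lborel \<partial>lborel)
    \<le> 2 * (\<integral>\<^sup>+z. ennreal (W z) \<partial>lborel)"
proof -
  define F where "F a b = ennreal (\<bar>sin (b - a)\<bar> * W (circ a + circ b)) *
    (if 0 \<le> a \<and> a < b \<and> b < 2 * pi \<and> b \<noteq> a + pi then 1 else 0)" for a b
  have F [measurable]: "(\<lambda>(a, b). F a b) \<in> borel_measurable (borel \<Otimes>\<^sub>M borel)"
    unfolding F_def by measurable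
  have "(\<integral>\<^sup>+a. \<integral>\<^sup>+b. F a b \<partial>lborel \<partial>lborel) = (\<integral>\<^sup>+x. F (x $ 1) (x $ 2) \<partial>(lborel :: (real^2) measure))"
    by (rule nn_integral_real2[symmetric, OF F])
  also have "\<dots> = (\<integral>\<^sup>+x\<in>circ_triangle. ennreal (\<bar>sin (x $ 2 - x $ 1)\<bar> * W (circ_sum x)) \<partial>lborel)"
    by (intro nn_integral_cong) (auto simp: F_def circ_triangle_def circ_sum_def indicator_def)
  also have "\<dots> \<le> (\<integral>\<^sup>+z. ennreal (W z) \<partial>lborel)"
    by (rule nn_integral_circ_triangle_le[OF assms])
  finally have le: "(\<integral>\<^sup>+a. \<integral>\<^sup>+b. F a b \<partial>lborel \<partial>lborel) \<le> (\<integral>\<^sup>+z. ennreal (W z) \<partial>lborel)" .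
  have swap: "(\<integral>\<^sup>+a. \<integral>\<^sup>+b. F b a \<partial>lborel \<partial>lborel) = (\<integral>\<^sup>+a. \<integral>\<^sup>+b. F a b \<partial>lborel \<partial>lborel)"
    by (rule nn_integral_swap_lborel) measurable
  have 1: "(\<integral>\<^sup>+a. \<integral>\<^sup>+b. ennreal (\<bar>sin (a - b)\<bar> * W (circ a + circ b)) * indicator {0..<2 * pi} a * indicator {0..<2 * pi} b \<partial>lborel \<partial>lborel)
    \<le> (\<integral>\<^sup>+a. \<integral>\<^sup>+b. F a b + F b a \<partial>lborel \<partial>lborel)"
  proof (intro nn_integral_mono)
    fix a b :: real
    have s: "\<bar>sin (b - a)\<bar> = \<bar>sin (a - b)\<bar>"
      using sin_minus[of "a - b"] by simp
    consider "a \<notin> {0..<2 * pi} \<or> b \<notin> {0..<2 * pi}" | "b = a + pi \<or> a = b + pi \<or> a = b"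
      | "0 \<le> a" "a < b" "b < 2 * pi" "b \<noteq> a + pi" | "0 \<le> b" "b < a" "a < 2 * pi" "a \<noteq> b + pi"
      unfolding atLeastLessThan_iff by linarith
    then show "ennreal (\<bar>sin (a - b)\<bar> * W (circ a + circ b)) * indicator {0..<2 * pi} a * indicator {0..<2 * pi} b \<le> F a b + F b a"
    proof cases
      case 1
      then show ?thesis by (auto simp: indicator_def)
    next
      case 2
      then have "sin (a - b) = 0" by auto
      then show ?thesis by simp
    next
      case 3
      then have "ennreal (\<bar>sin (a - b)\<bar> * W (circ a + circ b)) = F a b" by (simp add: F_def s)
      then show ?thesis by (simp add: indicator_def)
    next
      case 4
      then have "ennreal (\<bar>sin (a - b)\<bar> * W (circ a + circ b)) = F b a" by (simp add: F_def add.commute)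
      then show ?thesis by (simp add: indicator_def)
    qed
  qed
  have 2: "(\<integral>\<^sup>+a. \<integral>\<^sup>+b. F a b + F b a \<partial>lborel \<partial>lborel)
    = (\<integral>\<^sup>+a. \<integral>\<^sup>+b. F a b \<partial>lborel \<partial>lborel) + (\<integral>\<^sup>+a. \<integral>\<^sup>+b. F b a \<partial>lborel \<partial>lborel)"
    by (simp add: nn_integral_add)
  show ?thesis
    unfolding mult_2[of "\<integral>\<^sup>+z. ennreal (W z) \<partial>lborel"]
    by (rule order.trans[OF 1]) (unfold 2, rule add_mono[OF le order.trans[OF eq_refl[OF swap] le]])
qed

section \<open>Averages over pairs of discs\<close>

text \<open>Real-valued for use in powers and products. The conversion by \<open>enn2real\<close>
  loses nothing for bounded f, the only case considered.\<close>

definition quad_avg :: "('a::euclidean_space \<Rightarrow> real) \<Rightarrow> 'a \<Rightarrow> real \<Rightarrow> real" where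
  "quad_avg f x \<rho> = sqrt (enn2real (ball_avg (\<lambda>u. (f u)\<^sup>2) x \<rho>))"

lemma quad_avg_nonneg: "0 \<le> quad_avg f x \<rho>"
  by (simp add: quad_avg_def)

lemma ball_avg_quad_avg:
  fixes f :: "'a::euclidean_space \<Rightarrow> real"
  assumes b: "\<And>x. \<bar>f x\<bar> \<le> b" and \<rho>: "0 < \<rho>"
  shows "ball_avg (\<lambda>u. (f u)\<^sup>2) x \<rho> = ennreal ((quad_avg f x \<rho>)\<^sup>2)" "quad_avg f x \<rho> \<le> b"
proof -
  have b0: "0 \<le> b" using b[of undefined] by linarith
  have sq: "norm ((f x)\<^sup>2) \<le> b\<^sup>2" for x
    using power_mono[OF b[of x], of 2] by simp
  have le: "ball_avg (\<lambda>u. (f u)\<^sup>2) x \<rho> \<le> ennreal (b\<^sup>2)"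
    using order.trans[OF ball_avg_le_hl_maximal[OF \<rho>] hl_maximal_le[OF sq]] .
  then have fin: "ball_avg (\<lambda>u. (f u)\<^sup>2) x \<rho> < top" by (auto intro: le_less_trans)
  then show "ball_avg (\<lambda>u. (f u)\<^sup>2) x \<rho> = ennreal ((quad_avg f x \<rho>)\<^sup>2)"
    by (simp add: quad_avg_def)
  have "enn2real (ball_avg (\<lambda>u. (f u)\<^sup>2) x \<rho>) \<le> b\<^sup>2"
    using le by (rule enn2real_leI[rotated]) simp
  then show "quad_avg f x \<rho> \<le> b" unfolding quad_avg_def using b0 by (intro real_le_lsqrt) auto
qed

definition ball_vol :: "real \<Rightarrow> real" where
  "ball_vol \<rho> = pi * \<rho>\<^sup>2"

lemma ball_vol_pos: "0 < \<rho> \<Longrightarrow> 0 < ball_vol \<rho>"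
  by (simp add: ball_vol_def)

lemma emeasure_ball_real2: "0 < \<rho> \<Longrightarrow> emeasure lborel (ball (x::real^2) \<rho>) = ennreal (ball_vol \<rho>)"
  by (simp add: emeasure_ball ball_vol_def eval_unit_ball_vol)

text \<open>The definition of the average solved for the L^2 norm of f on the disc, in the shape
  that the Hoelder lemma expects.\<close>

lemma nn_integral_ball_quad_avg:
  fixes f :: "real^2 \<Rightarrow> real"
  assumes f0: "\<And>x. 0 \<le> f x" and b: "\<And>x. \<bar>f x\<bar> \<le> b" and \<rho>: "0 < \<rho>"
  shows "(\<integral>\<^sup>+u. ennreal ((f u * (if dist x u < \<rho> then 1 else 0)) powr 2) \<partial>lborel) = ennreal ((sqrt (ball_vol \<rho>) * quad_avg f x \<rho>) powr 2)"
proof -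
  have "(\<integral>\<^sup>+u. ennreal ((f u * (if dist x u < \<rho> then 1 else 0)) powr 2) \<partial>lborel) = (\<integral>\<^sup>+u\<in>ball x \<rho>. ennreal (norm ((f u)\<^sup>2)) \<partial>lborel)"
    using f0 by (intro nn_integral_cong) (auto simp: indicator_def)
  also have "\<dots> = ennreal (ball_vol \<rho>) * ennreal ((quad_avg f x \<rho>)\<^sup>2)"
    unfolding emeasure_times_ball_avg[OF \<rho>, symmetric] ball_avg_quad_avg(1)[OF b \<rho>] emeasure_ball_real2[OF \<rho>] ..
  also have "\<dots> = ennreal (ball_vol \<rho> * (quad_avg f x \<rho>)\<^sup>2)"
    using ball_vol_pos[OF \<rho>] by (simp add: ennreal_mult)
  also have "ball_vol \<rho> * (quad_avg f x \<rho>)\<^sup>2 = (sqrt (ball_vol \<rho>) * quad_avg f x \<rho>) powr 2"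
    using ball_vol_pos[OF \<rho>] quad_avg_nonneg[of f x \<rho>] by (simp add: power_mult_distrib)
  finally show ?thesis .
qed

text \<open>A real-valued indicator with centre, radius and point as arguments, so that it is
  measurable when all three vary.\<close>

definition disc :: "real^2 \<Rightarrow> real \<Rightarrow> real^2 \<Rightarrow> real" where
  "disc x \<rho> u = (if dist x u < \<rho> then 1 else 0)"

lemma disc_measurable [measurable]:
  assumes [measurable]: "f \<in> borel_measurable M" "r \<in> borel_measurable M" "g \<in> borel_measurable M"
  shows "(\<lambda>x. disc (f x) (r x) (g x)) \<in> borel_measurable M"
  unfolding disc_def by measurable

lemma disc_nonneg: "0 \<le> disc x \<rho> u"
  by (simp add: disc_def)

text \<open>The translate of the larger disc by a vector of the smaller disc stays inside the doubled larger
  disc around \<open>x + y\<close>, so Cauchy--Schwarz in the larger disc produces the maximal function there.\<close>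

lemma bilinear_disc_bound_ordered:
  fixes f h :: "real^2 \<Rightarrow> real"
  assumes [measurable]: "f \<in> borel_measurable borel" "h \<in> borel_measurable borel"
    and f0: "\<And>u. 0 \<le> f u" and fb: "\<And>u. f u \<le> b" and h0: "\<And>u. 0 \<le> h u" and hb: "\<And>u. h u \<le> c"
    and \<rho>: "0 < \<sigma>" "\<sigma> \<le> \<rho>"
  shows "(\<integral>\<^sup>+v. \<integral>\<^sup>+u. ennreal ((f u * disc x \<rho> u) * (f v * disc y \<sigma> v) * h (u + v)) \<partial>lborel \<partial>lborel)
    \<le> ennreal (ball_vol \<rho> * ball_vol \<sigma> * quad_avg f x \<rho> * quad_avg f y \<sigma> * (2 * sqrt (enn2real (hl_maximal (\<lambda>z. (h z)\<^sup>2) (x + y)))))"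
proof -
  have \<rho>0: "0 < \<rho>" using \<rho> by simp
  have fa: "\<bar>f u\<bar> \<le> b" for u using f0 fb by simp
  have hc: "norm ((h z)\<^sup>2) \<le> c\<^sup>2" for z using h0[of z] hb[of z] by (simp add: power_mono)
  define m where "m = sqrt (enn2real (hl_maximal (\<lambda>z. (h z)\<^sup>2) (x + y)))"
  have "hl_maximal (\<lambda>z. (h z)\<^sup>2) (x + y) \<le> ennreal (c\<^sup>2)" using hl_maximal_le[of "\<lambda>z. (h z)\<^sup>2", OF hc] .
  then have M: "hl_maximal (\<lambda>z. (h z)\<^sup>2) (x + y) = ennreal (m\<^sup>2)" and m0: "0 \<le> m"
    by (auto simp: m_def intro!: ennreal_enn2real[symmetric] intro: le_less_trans)
  have V: "0 < ball_vol \<rho>" "0 < ball_vol \<sigma>" using \<rho> \<rho>0 by (simp_all add: ball_vol_pos)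
  \<comment> \<open>With v fixed in the smaller disc, Cauchy--Schwarz over the larger disc separates
    f from the translate of h by v.\<close>
  have inner: "(\<integral>\<^sup>+u. ennreal ((f u * disc x \<rho> u) * (h (v + u) * disc x \<rho> u)) \<partial>lborel)
    \<le> ennreal (sqrt (ball_vol \<rho>) * quad_avg f x \<rho> * (2 * sqrt (ball_vol \<rho>) * m))" if v: "dist y v < \<sigma>" for v
  proof (rule nn_integral_Holder[where p=2 and q=2])
    have "(\<integral>\<^sup>+u. ennreal ((h (v + u) * disc x \<rho> u) powr 2) \<partial>lborel) \<le>
       (\<integral>\<^sup>+u. ennreal (norm ((h (v + u))\<^sup>2)) * indicator (ball (x + y) (2 * \<rho>)) (v + u) \<partial>lborel)"
    proof (rule nn_integral_mono)
      fix u
      have "dist (x + y) (v + u) < 2 * \<rho>" if "dist x u < \<rho>"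
        using norm_triangle_ineq[of "x - u" "y - v"] that v \<rho> by (simp add: dist_norm algebra_simps)
      then show "ennreal ((h (v + u) * disc x \<rho> u) powr 2) \<le> ennreal (norm ((h (v + u))\<^sup>2)) * indicator (ball (x + y) (2 * \<rho>)) (v + u)"
        using h0 by (auto simp: disc_def indicator_def)
    qed
    also have "\<dots> = (\<integral>\<^sup>+z\<in>ball (x + y) (2 * \<rho>). ennreal (norm ((h z)\<^sup>2)) \<partial>lborel)"
      by (rule nn_integral_lborel_plus) (intro borel_measurable_times_ennreal borel_measurable_indicator; measurable)
    also have "\<dots> \<le> emeasure lborel (ball (x + y) (2 * \<rho>)) * hl_maximal (\<lambda>z. (h z)\<^sup>2) (x + y)"
      using \<rho>0 by (intro nn_integral_ball_le_hl_maximal) simp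
    also have "\<dots> = ennreal (ball_vol (2 * \<rho>) * m\<^sup>2)"
      using \<rho>0 by (simp add: emeasure_ball_real2 M ennreal_mult ball_vol_def)
    \<comment> \<open>Doubling the radius multiplies the area by 4, hence the L^2 norm by 2.\<close>
    also have "ball_vol (2 * \<rho>) * m\<^sup>2 = (2 * sqrt (ball_vol \<rho>) * m) powr 2"
      using V m0 by (simp add: power_mult_distrib ball_vol_def)
    finally show "(\<integral>\<^sup>+u. ennreal ((h (v + u) * disc x \<rho> u) powr 2) \<partial>lborel) \<le> ennreal ((2 * sqrt (ball_vol \<rho>) * m) powr 2)" .
    show "(\<integral>\<^sup>+u. ennreal ((f u * disc x \<rho> u) powr 2) \<partial>lborel) \<le> ennreal ((sqrt (ball_vol \<rho>) * quad_avg f x \<rho>) powr 2)"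
      unfolding disc_def nn_integral_ball_quad_avg[OF f0 fa \<rho>0] ..
  qed (use f0 h0 m0 V disc_nonneg quad_avg_nonneg in \<open>auto intro!: mult_nonneg_nonneg\<close>)
  \<comment> \<open>What remains is the mean of f over the smaller disc; Cauchy--Schwarz against the
    indicator bounds it by the quadratic mean.\<close>
  have outer: "(\<integral>\<^sup>+v. ennreal ((f v * disc y \<sigma> v) * disc y \<sigma> v) \<partial>lborel) \<le> ennreal (sqrt (ball_vol \<sigma>) * quad_avg f y \<sigma> * sqrt (ball_vol \<sigma>))"
  proof (rule nn_integral_Holder[where p=2 and q=2])
    show "(\<integral>\<^sup>+u. ennreal ((f u * disc y \<sigma> u) powr 2) \<partial>lborel) \<le> ennreal ((sqrt (ball_vol \<sigma>) * quad_avg f y \<sigma>) powr 2)"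
      unfolding disc_def nn_integral_ball_quad_avg[OF f0 fa \<rho>(1)] ..
    have "(\<integral>\<^sup>+v. ennreal (disc y \<sigma> v powr 2) \<partial>lborel) = (\<integral>\<^sup>+v. indicator (ball y \<sigma>) v \<partial>lborel)"
      by (intro nn_integral_cong) (auto simp: disc_def indicator_def)
    also have "\<dots> = ennreal (ball_vol \<sigma>)" using \<rho> by (simp add: emeasure_ball_real2)
    finally show "(\<integral>\<^sup>+v. ennreal (disc y \<sigma> v powr 2) \<partial>lborel) \<le> ennreal (sqrt (ball_vol \<sigma>) powr 2)"
      using V by simp
  qed (use f0 V disc_nonneg quad_avg_nonneg in \<open>auto intro!: mult_nonneg_nonneg\<close>)
  define E where "E = sqrt (ball_vol \<rho>) * quad_avg f x \<rho> * (2 * sqrt (ball_vol \<rho>) * m)"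
  have E0: "0 \<le> E" unfolding E_def using V m0 quad_avg_nonneg[of f x \<rho>] by simp
  have "(\<integral>\<^sup>+v. \<integral>\<^sup>+u. ennreal ((f u * disc x \<rho> u) * (f v * disc y \<sigma> v) * h (u + v)) \<partial>lborel \<partial>lborel)
     \<le> (\<integral>\<^sup>+v. ennreal E * ennreal ((f v * disc y \<sigma> v) * disc y \<sigma> v) \<partial>lborel)"
  proof (rule nn_integral_mono)
    fix v
    show "(\<integral>\<^sup>+u. ennreal ((f u * disc x \<rho> u) * (f v * disc y \<sigma> v) * h (u + v)) \<partial>lborel) \<le> ennreal E * ennreal ((f v * disc y \<sigma> v) * disc y \<sigma> v)"
    proof (cases "dist y v < \<sigma>")
      case True
      have "(\<integral>\<^sup>+u. ennreal ((f u * disc x \<rho> u) * (f v * disc y \<sigma> v) * h (u + v)) \<partial>lborel)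
        = (\<integral>\<^sup>+u. ennreal (f v * disc y \<sigma> v) * ennreal ((f u * disc x \<rho> u) * (h (v + u) * disc x \<rho> u)) \<partial>lborel)"
        using f0 h0 by (intro nn_integral_cong) (auto simp: ennreal_mult[symmetric] disc_def add.commute mult_ac)
      also have "\<dots> = ennreal (f v * disc y \<sigma> v) * (\<integral>\<^sup>+u. ennreal ((f u * disc x \<rho> u) * (h (v + u) * disc x \<rho> u)) \<partial>lborel)"
        by (rule nn_integral_cmult) measurable
      also have "\<dots> \<le> ennreal (f v * disc y \<sigma> v) * ennreal E"
        unfolding E_def by (intro mult_left_mono inner True) auto
      finally show ?thesis using True by (simp add: disc_def mult.commute)
    qed (simp add: disc_def)
  qed
  also have "\<dots> = ennreal E * (\<integral>\<^sup>+v. ennreal ((f v * disc y \<sigma> v) * disc y \<sigma> v) \<partial>lborel)"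
    by (rule nn_integral_cmult) measurable
  also have "\<dots> \<le> ennreal E * ennreal (sqrt (ball_vol \<sigma>) * quad_avg f y \<sigma> * sqrt (ball_vol \<sigma>))"
    by (intro mult_left_mono outer) auto
  also have "\<dots> = ennreal (E * (sqrt (ball_vol \<sigma>) * quad_avg f y \<sigma> * sqrt (ball_vol \<sigma>)))"
    using E0 V quad_avg_nonneg[of f y \<sigma>] by (simp add: ennreal_mult)
  also have "E * (sqrt (ball_vol \<sigma>) * quad_avg f y \<sigma> * sqrt (ball_vol \<sigma>))
    = (sqrt (ball_vol \<rho>) * sqrt (ball_vol \<rho>)) * (sqrt (ball_vol \<sigma>) * sqrt (ball_vol \<sigma>)) * quad_avg f x \<rho> * quad_avg f y \<sigma> * (2 * m)"
    unfolding E_def by (simp only: mult_ac)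
  also have "\<dots> = ball_vol \<rho> * ball_vol \<sigma> * quad_avg f x \<rho> * quad_avg f y \<sigma> * (2 * m)"
    using V by simp
  finally show ?thesis unfolding m_def .
qed

text \<open>The inner integration must run over the larger disc: Tonelli arranges this when
  \<open>\<sigma> \<le> \<rho>\<close>, and exchanging the roles of the two discs does so
  otherwise.\<close>

lemma bilinear_disc_bound:
  fixes f h :: "real^2 \<Rightarrow> real"
  assumes [measurable]: "f \<in> borel_measurable borel" "h \<in> borel_measurable borel"
    and f0: "\<And>u. 0 \<le> f u" and fb: "\<And>u. f u \<le> b" and h0: "\<And>u. 0 \<le> h u" and hb: "\<And>u. h u \<le> c"
    and \<rho>: "0 < \<sigma>" "0 < \<rho>"
  shows "(\<integral>\<^sup>+u. \<integral>\<^sup>+v. ennreal ((f u * disc x \<rho> u) * (f v * disc y \<sigma> v) * h (u + v)) \<partial>lborel \<partial>lborel)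
    \<le> ennreal (ball_vol \<rho> * ball_vol \<sigma> * quad_avg f x \<rho> * quad_avg f y \<sigma> * (2 * sqrt (enn2real (hl_maximal (\<lambda>z. (h z)\<^sup>2) (x + y)))))"
proof (cases "\<sigma> \<le> \<rho>")
  case True
  have "(\<integral>\<^sup>+u. \<integral>\<^sup>+v. ennreal ((f u * disc x \<rho> u) * (f v * disc y \<sigma> v) * h (u + v)) \<partial>lborel \<partial>lborel)
    = (\<integral>\<^sup>+v. \<integral>\<^sup>+u. ennreal ((f u * disc x \<rho> u) * (f v * disc y \<sigma> v) * h (u + v)) \<partial>lborel \<partial>lborel)"
    by (rule nn_integral_swap_lborel) measurable
  with bilinear_disc_bound_ordered[OF assms(1-6) \<rho>(1) True] show ?thesis by simp
next
  case False
  then have "\<rho> \<le> \<sigma>" by simp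
  have "(\<lambda>u v. ennreal ((f u * disc x \<rho> u) * (f v * disc y \<sigma> v) * h (u + v))) = (\<lambda>u v. ennreal ((f v * disc y \<sigma> v) * (f u * disc x \<rho> u) * h (v + u)))"
    by (simp add: fun_eq_iff mult_ac add.commute)
  with bilinear_disc_bound_ordered[OF assms(1-6) \<rho>(2) \<open>\<rho> \<le> \<sigma>\<close>, of y x] show ?thesis
    by (simp add: add.commute mult_ac)
qed

section \<open>Self-convolutions\<close>

text \<open>At zeros of the sine both \<open>powr (1 / s)\<close> and
  \<open>powr (- (1 / s))\<close> give 0 and do not cancel, so the Jacobian can be split off only
  almost everywhere.\<close>

lemma AE_sin_diff_nonzero: "AE y in lborel. sin (x - y) \<noteq> (0::real)"
proof -
  have "{y. sin (x - y) = 0} \<subseteq> range (\<lambda>k::int. x - of_int k * pi)"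
  proof
    fix y assume "y \<in> {y. sin (x - y) = 0}"
    then obtain k :: int where "x - y = of_int k * pi" by (auto simp: sin_zero_iff_int2)
    then show "y \<in> range (\<lambda>k::int. x - of_int k * pi)" by (intro range_eqI[of _ _ k]) simp
  qed
  then have "countable {y. sin (x - y) = 0}" by (rule countable_subset) auto
  then have "{y. sin (x - y) = 0} \<in> null_sets lborel" by (rule countable_imp_null_set_lborel)
  then show ?thesis by (rule AE_I') auto
qed

text \<open>The constant of the circle estimate with kernel exponent a = 1 / (s - 1), to the power 1
  / s' with s' conjugate to s. This a is s' / s, the power of |sin| left when |sin|^(-1/s) is raised
  to s'.\<close>

definition circ_const :: "real \<Rightarrow> real" where
  "circ_const s = (2 powr (1 / (s - 1)) * 5 * HLS_const (1 / (s - 1))) powr ((s - 1) / s)"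

text \<open>The density of \<open>g d\<sigma> * g d\<sigma>\<close> with respect to Lebesgue measure is \<open>g g / \<bar>sin\<bar>\<close>, so Hoelder's
  inequality is applied after splitting off the Jacobian \<open>\<bar>sin\<bar>\<close>.\<close>

lemma circle_bilinear_bound:
  fixes g :: "real \<Rightarrow> real" and K :: "real^2 \<Rightarrow> real"
  assumes s: "2 < s" and [measurable]: "g \<in> borel_measurable borel" "K \<in> borel_measurable borel"
    and g: "\<And>x. 0 \<le> g x" "\<And>x. g x \<le> b" and gs: "\<And>x. x \<notin> {0..<2 * pi} \<Longrightarrow> g x = 0" and K: "\<And>z. 0 \<le> K z"
    and A: "0 < A" and gA: "(\<integral>\<^sup>+x. ennreal (g x powr (2 * s / (2 * s - 3))) \<partial>lborel) \<le> ennreal (A powr (2 * s / (2 * s - 3)))"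
    and B: "0 \<le> B" and KB: "(\<integral>\<^sup>+z. ennreal (K z powr s) \<partial>lborel) \<le> ennreal (B powr s)"
  shows "(\<integral>\<^sup>+x. \<integral>\<^sup>+y. ennreal (g x * g y * K (circ x + circ y)) \<partial>lborel \<partial>lborel)
    \<le> ennreal (circ_const s * A\<^sup>2 * (2 powr (1 / s) * B))"
proof -
  define t where "t = s / (s - 1)"
  define a where "a = 1 / (s - 1)"
  define q where "q = 2 * s / (2 * s - 3)"
  have a: "0 < a" "a < 1" using s by (auto simp: a_def)
  \<comment> \<open>Fractional integration is applied to g^t, which has to lie in L^(2/(2-a)). As t
    times 2 / (2 - a) is 2 s / (2 s - 3), this is the given bound on g.\<close>
  have "2 - a = (2 * s - 3) / (s - 1)" using s by (simp add: a_def field_simps)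
  then have "t * (2 / (2 - a)) = (s - 1) / (s - 1) * (2 * s / (2 * s - 3))"
    by (simp only: t_def divide_divide_eq_right times_divide_times_eq mult_ac)
  then have "t * (2 / (2 - a)) = q" using s by (simp add: q_def)
  moreover have "1 < t" "1 / t + 1 / s = 1" "(- (1 / s)) * t = - a"
    using s by (auto simp: t_def a_def field_simps)
  ultimately have t: "1 < t" "1 / t + 1 / s = 1" "(- (1 / s)) * t = - a" "t * (2 / (2 - a)) = q" by auto
  have C: "0 < 2 powr a * 5 * HLS_const a" using HLS_const_pos[OF a] by simp
  define f1 where "f1 = (\<lambda>p. g (fst p) * g (snd p) * \<bar>sin (fst p - snd p)\<bar> powr (- (1 / s)))"
  define f2 where "f2 = (\<lambda>p. \<bar>sin (fst p - snd p)\<bar> powr (1 / s) * K (circ (fst p) + circ (snd p)) * indicator {0..<2 * pi} (fst p) * indicator {0..<2 * pi} (snd p))"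
  have m1 [measurable]: "f1 \<in> borel_measurable (lborel \<Otimes>\<^sub>M lborel)" unfolding f1_def by measurable
  have m2 [measurable]: "f2 \<in> borel_measurable (lborel \<Otimes>\<^sub>M lborel)" unfolding f2_def by measurable
  have "(\<integral>\<^sup>+x. \<integral>\<^sup>+y. ennreal (g x * g y * K (circ x + circ y)) \<partial>lborel \<partial>lborel)
    = (\<integral>\<^sup>+x. \<integral>\<^sup>+y. ennreal (f1 (x, y) * f2 (x, y)) \<partial>lborel \<partial>lborel)"
  proof (rule nn_integral_cong, rule nn_integral_cong_AE)
    fix x :: real
    show "AE y in lborel. ennreal (g x * g y * K (circ x + circ y)) = ennreal (f1 (x, y) * f2 (x, y))"
      using AE_sin_diff_nonzero[of x]
    proof eventually_elim
      case (elim y)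
      then have "\<bar>sin (x - y)\<bar> powr (- (1 / s)) * \<bar>sin (x - y)\<bar> powr (1 / s) = 1"
        by (simp add: powr_add[symmetric])
      then have "f1 (x, y) * f2 (x, y) = g x * g y * K (circ x + circ y) * (indicator {0..<2 * pi} x * indicator {0..<2 * pi} y)"
        by (simp add: f1_def f2_def mult_ac)
      also have "\<dots> = g x * g y * K (circ x + circ y)" using gs by (auto simp: indicator_def)
      finally show ?case by simp
    qed
  qed
  also have "\<dots> = (\<integral>\<^sup>+p. ennreal (f1 p * f2 p) \<partial>(lborel \<Otimes>\<^sub>M lborel))"
    by (subst lborel.nn_integral_fst[symmetric]) auto
  also have "\<dots> \<le> ennreal ((2 powr a * 5 * HLS_const a * (A powr t)\<^sup>2) powr (1 / t) * (2 powr (1 / s) * B))"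
  proof (rule nn_integral_Holder[OF m1 m2 _ _ t(1) _ t(2)])
    have "(\<integral>\<^sup>+p. ennreal (f1 p powr t) \<partial>(lborel \<Otimes>\<^sub>M lborel)) = (\<integral>\<^sup>+x. \<integral>\<^sup>+y. ennreal (f1 (x, y) powr t) \<partial>lborel \<partial>lborel)"
      by (subst lborel.nn_integral_fst[symmetric]) auto
    also have "\<dots> = (\<integral>\<^sup>+x. \<integral>\<^sup>+y. ennreal (g x powr t * g y powr t * \<bar>sin (x - y)\<bar> powr (- a)) \<partial>lborel \<partial>lborel)"
      using g by (simp add: f1_def powr_mult powr_powr t(3)[simplified])
    also have "\<dots> \<le> ennreal (2 powr a * 5 * HLS_const a * (A powr t)\<^sup>2)"
    proof (rule Hardy_Littlewood_Sobolev_circle[OF a, where b="b powr t"])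
      show "(\<integral>\<^sup>+x. ennreal ((g x powr t) powr (2 / (2 - a))) \<partial>lborel) \<le> ennreal ((A powr t) powr (2 / (2 - a)))"
        using gA unfolding powr_powr t(4) q_def[symmetric] .
      show "g x powr t \<le> b powr t" for x using g[of x] t by (intro powr_mono2) auto
    qed (use gs A in auto)
    finally show "(\<integral>\<^sup>+p. ennreal (f1 p powr t) \<partial>(lborel \<Otimes>\<^sub>M lborel)) \<le> ennreal (((2 powr a * 5 * HLS_const a * (A powr t)\<^sup>2) powr (1 / t)) powr t)"
      using t(1) C by (simp add: powr_powr)
    have "(\<integral>\<^sup>+p. ennreal (f2 p powr s) \<partial>(lborel \<Otimes>\<^sub>M lborel)) = (\<integral>\<^sup>+x. \<integral>\<^sup>+y. ennreal (f2 (x, y) powr s) \<partial>lborel \<partial>lborel)"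
      by (subst lborel.nn_integral_fst[symmetric]) auto
    also have "\<dots> = (\<integral>\<^sup>+x. \<integral>\<^sup>+y. ennreal (\<bar>sin (x - y)\<bar> * K (circ x + circ y) powr s) * indicator {0..<2 * pi} x * indicator {0..<2 * pi} y \<partial>lborel \<partial>lborel)"
      using s K by (intro nn_integral_cong) (auto simp: f2_def powr_mult powr_powr indicator_def)
    also have "\<dots> \<le> 2 * (\<integral>\<^sup>+z. ennreal (K z powr s) \<partial>lborel)"
      by (rule nn_integral_circ_sum_le) auto
    also have "\<dots> \<le> 2 * ennreal (B powr s)" by (intro mult_left_mono KB) auto
    also have "\<dots> = ennreal ((2 powr (1 / s) * B) powr s)"
      using s B by (simp add: powr_mult powr_powr ennreal_mult)
    finally show "(\<integral>\<^sup>+p. ennreal (f2 p powr s) \<partial>(lborel \<Otimes>\<^sub>M lborel)) \<le> ennreal ((2 powr (1 / s) * B) powr s)" .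
  qed (use s g K B in \<open>auto simp: f1_def f2_def\<close>)
  also have "(2 powr a * 5 * HLS_const a * (A powr t)\<^sup>2) powr (1 / t) = circ_const s * A\<^sup>2"
  proof -
    have "((A powr t)\<^sup>2) powr (1 / t) = A powr (t * 2 * (1 / t))"
      using A by (simp add: powr_powr powr_power)
    also have "\<dots> = A\<^sup>2" using A t(1) by simp
    finally have "((A powr t)\<^sup>2) powr (1 / t) = A\<^sup>2" .
    moreover have "1 / t = (s - 1) / s" by (simp add: t_def)
    ultimately show ?thesis
      using C A unfolding circ_const_def a_def[symmetric] by (subst powr_mult) auto
  qed
  finally show ?thesis .
qed

text \<open>Besides \<open>circ_const\<close>: 2^(1/s) from the two-to-one sum map, 2 from the
  doubled disc, and the planar maximal constant for L^(s/2), to the power 1 / s because the operator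
  is the square root of M(h^2) measured in L^s.\<close>

definition conv_const :: "real \<Rightarrow> real" where
  "conv_const s = circ_const s * (2 powr (1 / s) * (2 * (5\<^sup>2 * (s / 2) * 2 powr (s / 2) / (s / 2 - 1)) powr (1 / s)))"

lemma conv_const_pos: "2 < s \<Longrightarrow> 0 < conv_const s"
  using HLS_const_pos[of "1 / (s - 1)"]
  unfolding conv_const_def circ_const_def by (intro mult_pos_pos) auto

text \<open>Only two facts about G enter the main estimate: it is a superposition of pieces
  \<open>\<alpha> x\<close>, and any two pieces satisfy the bilinear bound. Testing H = G * G
  against its own extremiser gives I \<le> C A^2 I^(1/s) for I the integral of H^t. Boundedness and
  integrability of G make I finite, which allows the division.\<close>

lemma self_convolution_bound:
  fixes G :: "real^2 \<Rightarrow> real" and \<alpha> :: "real \<Rightarrow> real^2 \<Rightarrow> real" and g :: "real \<Rightarrow> real"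
  assumes s: "2 < s" and t: "t = s / (s - 1)"
    and Gm [measurable]: "G \<in> borel_measurable borel" and G0: "\<And>u. 0 \<le> G u" and Gb: "\<And>u. G u \<le> c"
    and Gi: "(\<integral>\<^sup>+u. ennreal (G u) \<partial>lborel) < \<infinity>"
    and \<alpha>m [measurable]: "(\<lambda>(x, u). \<alpha> x u) \<in> borel_measurable (borel \<Otimes>\<^sub>M borel)" and \<alpha>0: "\<And>x u. 0 \<le> \<alpha> x u"
    and G\<alpha>: "\<And>u. ennreal (G u) = (\<integral>\<^sup>+x. ennreal (\<alpha> x u) \<partial>lborel)"
    and gm [measurable]: "g \<in> borel_measurable borel"
    and g: "\<And>x. 0 \<le> g x" "\<And>x. g x \<le> b" and gs: "\<And>x. x \<notin> {0..<2 * pi} \<Longrightarrow> g x = 0"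
    and A: "0 < A" and gA: "(\<integral>\<^sup>+x. ennreal (g x powr (2 * s / (2 * s - 3))) \<partial>lborel) \<le> ennreal (A powr (2 * s / (2 * s - 3)))"
    and bil: "\<And>h d x y. h \<in> borel_measurable borel \<Longrightarrow> (\<And>z. 0 \<le> h z) \<Longrightarrow> (\<And>z. h z \<le> d) \<Longrightarrow>
      (\<integral>\<^sup>+u. \<integral>\<^sup>+v. ennreal (\<alpha> x u * \<alpha> y v * h (u + v)) \<partial>lborel \<partial>lborel)
        \<le> ennreal (g x * g y * (2 * sqrt (enn2real (hl_maximal (\<lambda>z. (h z)\<^sup>2) (circ x + circ y)))))"
  shows "(\<integral>\<^sup>+z. ennreal (enn2real (\<integral>\<^sup>+u. ennreal (G u * G (z - u)) \<partial>lborel) powr t) \<partial>lborel) \<le> ennreal ((conv_const s * A\<^sup>2) powr t)"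
    and "(\<integral>\<^sup>+u. ennreal (G u * G (z - u)) \<partial>lborel) < \<infinity>"
proof -
  define H where "H z = enn2real (\<integral>\<^sup>+u. ennreal (G u * G (z - u)) \<partial>lborel)" for z
  have [measurable]: "H \<in> borel_measurable borel" unfolding H_def by measurable
  have c0: "0 \<le> c" using order.trans[OF G0 Gb] .
  define n where "n = enn2real (\<integral>\<^sup>+u. ennreal (G u) \<partial>lborel)"
  have n: "(\<integral>\<^sup>+u. ennreal (G u) \<partial>lborel) = ennreal n" "0 \<le> n" using Gi by (auto simp: n_def)
  have t1: "1 < t" "1 / t + 1 / s = 1" "(t - 1) * s = t" "1 + (t - 1) = t" using s by (auto simp: t field_simps)
  have conv_le: "(\<integral>\<^sup>+u. ennreal (G u * G (z - u)) \<partial>lborel) \<le> ennreal (c * n)" for z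
  proof -
    have "(\<integral>\<^sup>+u. ennreal (G u * G (z - u)) \<partial>lborel) \<le> (\<integral>\<^sup>+u. ennreal c * ennreal (G u) \<partial>lborel)"
      using G0 Gb c0 by (intro nn_integral_mono) (auto simp: ennreal_mult[symmetric] mult.commute[of c] intro!: ennreal_leI mult_left_mono)
    also have "\<dots> = ennreal (c * n)" using n c0 by (simp add: nn_integral_cmult ennreal_mult)
    finally show ?thesis .
  qed
  then show fin: "(\<integral>\<^sup>+u. ennreal (G u * G (z - u)) \<partial>lborel) < \<infinity>" for z
    using le_less_trans[OF _ ennreal_less_top] by (metis infinity_ennreal_def)
  have H: "ennreal (H z) = (\<integral>\<^sup>+u. ennreal (G u * G (z - u)) \<partial>lborel)" for z
    unfolding H_def using fin[of z] by simp
  have H0: "0 \<le> H z" for z by (simp add: H_def)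
  have Hb: "H z \<le> c * n" for z
    using conv_le[of z] c0 n unfolding H[symmetric] by (simp add: ennreal_le_iff)
  have Hint: "(\<integral>\<^sup>+z. ennreal (H z) \<partial>lborel) = ennreal (n * n)"
  proof -
    have "(\<integral>\<^sup>+z. ennreal (H z) \<partial>lborel) = (\<integral>\<^sup>+u. \<integral>\<^sup>+z. ennreal (G u * G (z - u)) \<partial>lborel \<partial>lborel)"
      unfolding H by (rule nn_integral_swap_lborel) measurable
    also have "\<dots> = (\<integral>\<^sup>+u. ennreal (G u) * ennreal n \<partial>lborel)"
    proof (rule nn_integral_cong)
      fix u
      show "(\<integral>\<^sup>+z. ennreal (G u * G (z - u)) \<partial>lborel) = ennreal (G u) * ennreal n"
        using nn_integral_lborel_plus[of "\<lambda>z. ennreal (G z)" "- u"] G0 n by (simp add: ennreal_mult nn_integral_cmult)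
    qed
    also have "\<dots> = ennreal (n * n)" using n by (simp add: nn_integral_multc ennreal_mult)
    finally show ?thesis .
  qed
  \<comment> \<open>The extremiser for the duality of L^t and L^s: H h = H^t, and h^s = H^t because
    (t - 1) s = t.\<close>
  define h where "h z = H z powr (t - 1)" for z
  have [measurable]: "h \<in> borel_measurable borel" unfolding h_def by measurable
  have h0: "0 \<le> h z" for z by (simp add: h_def)
  have hb: "h z \<le> (c * n) powr (t - 1)" for z
    unfolding h_def using H0 Hb t1 by (intro powr_mono2) auto
  have Ht: "H z powr t = H z * h z" for z
    unfolding h_def using H0[of z] powr_add[of "H z" 1 "t - 1"] by (cases "H z = 0") auto
  have "(\<integral>\<^sup>+z. ennreal (H z powr t) \<partial>lborel) \<le> (\<integral>\<^sup>+z. ennreal ((c * n) powr (t - 1)) * ennreal (H z) \<partial>lborel)"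
    using H0 hb unfolding Ht by (intro nn_integral_mono) (auto simp: ennreal_mult[symmetric] mult.commute[of "_ powr _"] intro!: ennreal_leI mult_left_mono)
  also have "\<dots> < \<infinity>"
    by (subst nn_integral_cmult) (auto simp: Hint ennreal_mult_less_top)
  \<comment> \<open>H is bounded and integrable, hence its t-th power is integrable.\<close>
  finally obtain I where I: "(\<integral>\<^sup>+z. ennreal (H z powr t) \<partial>lborel) = ennreal I" "0 \<le> I"
    by (cases "\<integral>\<^sup>+z. ennreal (H z powr t) \<partial>lborel") auto
  define K where "K z = 2 * sqrt (enn2real (hl_maximal (\<lambda>z. (h z)\<^sup>2) z))" for z
  have [measurable]: "K \<in> borel_measurable borel" unfolding K_def by measurable
  define C where "C = 5\<^sup>2 * (s / 2) * 2 powr (s / 2) / (s / 2 - 1)"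
  have C: "0 < C" using s by (simp add: C_def)
  have KB: "(\<integral>\<^sup>+z. ennreal (K z powr s) \<partial>lborel) \<le> ennreal ((2 * (C powr (1 / s) * I powr (1 / s))) powr s)"
  proof -
    have "(\<integral>\<^sup>+z. ennreal (K z powr s) \<partial>lborel) = (\<integral>\<^sup>+z. ennreal (2 powr s) * ennreal (enn2real (hl_maximal (\<lambda>z. (h z)\<^sup>2) z) powr (s / 2)) \<partial>lborel)"
      by (intro nn_integral_cong) (simp add: K_def powr_mult powr_half_sqrt[symmetric] powr_powr ennreal_mult)
    also have "\<dots> = ennreal (2 powr s) * (\<integral>\<^sup>+z. ennreal (enn2real (hl_maximal (\<lambda>z. (h z)\<^sup>2) z) powr (s / 2)) \<partial>lborel)"
      by (rule nn_integral_cmult) measurable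
    also have "\<dots> \<le> ennreal (2 powr s) * (ennreal (5 ^ DIM(real^2) * (s / 2) * 2 powr (s / 2) / (s / 2 - 1)) * (\<integral>\<^sup>+z. ennreal (norm ((h z)\<^sup>2) powr (s / 2)) \<partial>lborel))"
    proof (intro mult_left_mono hl_maximal_strong_type)
      show "norm ((h z)\<^sup>2) \<le> ((c * n) powr (t - 1))\<^sup>2" for z
        using power_mono[OF hb h0, of z 2] by simp
    qed (use s in auto)
    also have "(\<lambda>z. ennreal (norm ((h z)\<^sup>2) powr (s / 2))) = (\<lambda>z. ennreal (H z powr t))"
    proof
      fix z
      have "((h z)\<^sup>2) powr (s / 2) = (h z powr 2) powr (s / 2)" using h0[of z] by simp
      also have "\<dots> = H z powr ((t - 1) * (2 * (s / 2)))" unfolding powr_powr h_def by (simp only: mult.assoc)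
      also have "\<dots> = H z powr ((t - 1) * s)" by (intro arg_cong[where f="\<lambda>e. H z powr ((t - 1) * e)"]) simp
      also have "\<dots> = H z powr t" unfolding t1(3) ..
      finally show "ennreal (norm ((h z)\<^sup>2) powr (s / 2)) = ennreal (H z powr t)" by simp
    qed
    also have "ennreal (2 powr s) * (ennreal (5 ^ DIM(real^2) * (s / 2) * 2 powr (s / 2) / (s / 2 - 1)) * (\<integral>\<^sup>+z. ennreal (H z powr t) \<partial>lborel))
      = ennreal (2 powr s * (C * I))"
    proof -
      have "5 ^ DIM(real^2) * (s / 2) * 2 powr (s / 2) / (s / 2 - 1) = C" by (simp add: C_def)
      then show ?thesis unfolding I(1) using C I(2) by (simp only: ennreal_mult[symmetric] mult_nonneg_nonneg less_imp_le powr_ge_zero)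
    qed
    also have "2 powr s * (C * I) = (2 * (C powr (1 / s) * I powr (1 / s))) powr s"
      using C I s by (simp add: powr_mult powr_powr)
    finally show ?thesis .
  qed
  have "ennreal I = (\<integral>\<^sup>+z. \<integral>\<^sup>+u. ennreal (G u * G (z - u) * h z) \<partial>lborel \<partial>lborel)"
    unfolding I(1)[symmetric] Ht using H0 h0 G0 by (simp add: ennreal_mult H nn_integral_multc)
  also have "\<dots> = (\<integral>\<^sup>+u. \<integral>\<^sup>+z. ennreal (G u * G (z - u) * h z) \<partial>lborel \<partial>lborel)"
    by (rule nn_integral_swap_lborel) measurable
  also have "\<dots> = (\<integral>\<^sup>+u. \<integral>\<^sup>+v. ennreal (G u * G v * h (u + v)) \<partial>lborel \<partial>lborel)"
  proof (rule nn_integral_cong)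
    fix u
    show "(\<integral>\<^sup>+z. ennreal (G u * G (z - u) * h z) \<partial>lborel) = (\<integral>\<^sup>+v. ennreal (G u * G v * h (u + v)) \<partial>lborel)"
      using nn_integral_lborel_plus[of "\<lambda>z. ennreal (G u * G (z - u) * h z)" u] by simp
  qed
  also have "\<dots> = (\<integral>\<^sup>+u. \<integral>\<^sup>+v. \<integral>\<^sup>+x. \<integral>\<^sup>+y. ennreal (\<alpha> x u * \<alpha> y v * h (u + v)) \<partial>lborel \<partial>lborel \<partial>lborel \<partial>lborel)"
    using G0 h0 \<alpha>0 by (intro nn_integral_cong) (simp add: ennreal_mult G\<alpha> nn_integral_cmult nn_integral_multc)
  \<comment> \<open>Four applications of Tonelli bring the parameters x, y outside, so that the
    bilinear bound applies to each pair of pieces.\<close>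
  also have "\<dots> = (\<integral>\<^sup>+u. \<integral>\<^sup>+x. \<integral>\<^sup>+v. \<integral>\<^sup>+y. ennreal (\<alpha> x u * \<alpha> y v * h (u + v)) \<partial>lborel \<partial>lborel \<partial>lborel \<partial>lborel)"
    by (intro nn_integral_cong nn_integral_swap_lborel) measurable
  also have "\<dots> = (\<integral>\<^sup>+x. \<integral>\<^sup>+u. \<integral>\<^sup>+v. \<integral>\<^sup>+y. ennreal (\<alpha> x u * \<alpha> y v * h (u + v)) \<partial>lborel \<partial>lborel \<partial>lborel \<partial>lborel)"
    by (intro nn_integral_swap_lborel) measurable
  also have "\<dots> = (\<integral>\<^sup>+x. \<integral>\<^sup>+u. \<integral>\<^sup>+y. \<integral>\<^sup>+v. ennreal (\<alpha> x u * \<alpha> y v * h (u + v)) \<partial>lborel \<partial>lborel \<partial>lborel \<partial>lborel)"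
    by (intro nn_integral_cong nn_integral_swap_lborel) measurable
  also have "\<dots> = (\<integral>\<^sup>+x. \<integral>\<^sup>+y. \<integral>\<^sup>+u. \<integral>\<^sup>+v. ennreal (\<alpha> x u * \<alpha> y v * h (u + v)) \<partial>lborel \<partial>lborel \<partial>lborel \<partial>lborel)"
    by (intro nn_integral_cong nn_integral_swap_lborel) measurable
  also have "\<dots> \<le> (\<integral>\<^sup>+x. \<integral>\<^sup>+y. ennreal (g x * g y * K (circ x + circ y)) \<partial>lborel \<partial>lborel)"
    unfolding K_def by (intro nn_integral_mono bil[OF _ h0 hb]) measurable
  also have "\<dots> \<le> ennreal (circ_const s * A\<^sup>2 * (2 powr (1 / s) * (2 * (C powr (1 / s) * I powr (1 / s)))))"
    by (rule circle_bilinear_bound[OF s _ _ g gs _ A gA _ KB]) (auto simp: K_def)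
  also have "circ_const s * A\<^sup>2 * (2 powr (1 / s) * (2 * (C powr (1 / s) * I powr (1 / s)))) = conv_const s * A\<^sup>2 * I powr (1 / s)"
    by (simp add: conv_const_def C_def)
  finally have le: "I \<le> conv_const s * A\<^sup>2 * I powr (1 / s)"
    using conv_const_pos[OF s] by (simp add: ennreal_le_iff)
  have "I \<le> (conv_const s * A\<^sup>2) powr t"
  proof (cases "I = 0")
    case False
    with I have I0: "0 < I" by simp
    have "I = I powr (1 / t) * I powr (1 / s)" using I0 t1(2) by (simp add: powr_add[symmetric])
    with le I0 have "I powr (1 / t) \<le> conv_const s * A\<^sup>2" by (metis mult_le_cancel_right powr_gt_zero less_imp_neq not_le)
    then have "(I powr (1 / t)) powr t \<le> (conv_const s * A\<^sup>2) powr t" using t1 by (intro powr_mono2) auto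
    then show ?thesis using I0 t1 by (simp add: powr_powr)
  qed simp
  then show "(\<integral>\<^sup>+z. ennreal (enn2real (\<integral>\<^sup>+u. ennreal (G u * G (z - u)) \<partial>lborel) powr t) \<partial>lborel) \<le> ennreal ((conv_const s * A\<^sup>2) powr t)"
    unfolding H_def[symmetric] I(1) by (rule ennreal_leI)
qed

section \<open>The linearised estimate\<close>

text \<open>The Hausdorff--Young constant at exponent s, evaluated on G * G. The root is of order 2
  s because |fourier G|^(2s) is |fourier (G * G)|^s.\<close>

definition restriction_const :: "real \<Rightarrow> real" where
  "restriction_const s = (4 * s / (s - 2) * 2 powr (s - 2) * conv_const s powr s) powr (1 / (2 * s))"

lemma restriction_const_pos: "2 < s \<Longrightarrow> 0 < restriction_const s"
  using conv_const_pos[of s] unfolding restriction_const_def by simp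

lemma quad_avg_measurable [measurable]:
  fixes f :: "real^2 \<Rightarrow> real"
  assumes [measurable]: "f \<in> borel_measurable borel" "\<rho> \<in> borel_measurable borel" "c \<in> borel_measurable borel" and \<rho>: "\<And>x. 0 < \<rho> x"
  shows "(\<lambda>x. quad_avg f (c x) (\<rho> x)) \<in> borel_measurable borel"
proof -
  have "quad_avg f (c x) (\<rho> x) = sqrt (enn2real (1 / ennreal (ball_vol (\<rho> x)) * (\<integral>\<^sup>+u. ennreal ((f u)\<^sup>2) * ennreal (disc (c x) (\<rho> x) u) \<partial>lborel)))" for x
    unfolding quad_avg_def ball_avg_def emeasure_ball_real2[OF \<rho>]
    by (intro arg_cong[where f=sqrt] arg_cong[where f=enn2real] arg_cong2[where f="(*)"] refl nn_integral_cong)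
       (auto simp: disc_def indicator_def)
  then show ?thesis unfolding ball_vol_def by simp
qed

lemma norm_circ [simp]: "norm (circ t) = 1"
  by (simp add: circ_def norm_vec_def L2_set_def sum_2)

text \<open>The dual form, with the weight left free. The bounds on weight and radii make the
  averaging kernel bounded with bounded support, so that G is bounded and integrable as the Fourier
  and convolution lemmas require. The final Hoelder inequality pairs f in L^p with
  \<open>fourier G\<close> in L^(2s).\<close>

lemma linearised_restriction_dual:
  fixes f :: "real^2 \<Rightarrow> complex" and \<rho> w :: "real \<Rightarrow> real"
  defines "P \<equiv> \<lambda>x. quad_avg (\<lambda>u. norm (fourier f u)) (circ x) (\<rho> x)"
  assumes s: "2 < s" and f: "integrable lborel f"
    and Fp: "0 \<le> Fp" "(\<integral>\<^sup>+x. ennreal (norm (f x) powr (2 * s / (2 * s - 1))) \<partial>lborel) \<le> ennreal (Fp powr (2 * s / (2 * s - 1)))"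
    and \<rho>m [measurable]: "\<rho> \<in> borel_measurable borel" and \<delta>: "0 < \<delta>" "\<And>x. \<delta> \<le> \<rho> x" and D: "\<And>x. \<rho> x \<le> D"
    and wm [measurable]: "w \<in> borel_measurable borel" and w: "\<And>x. 0 \<le> w x" "\<And>x. w x \<le> wb" and ws: "\<And>x. x \<notin> {0..<2 * pi} \<Longrightarrow> w x = 0"
    and A: "0 < A" and wA: "(\<integral>\<^sup>+x. ennreal ((w x * P x) powr (2 * s / (2 * s - 3))) \<partial>lborel) \<le> ennreal (A powr (2 * s / (2 * s - 3)))"
  shows "(\<integral>\<^sup>+x. ennreal (w x * (P x)\<^sup>2) \<partial>lborel) \<le> ennreal (Fp * (restriction_const s * A))"
proof -
  have [measurable]: "f \<in> borel_measurable borel" using f by auto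
  define t where "t = s / (s - 1)"
  have t1: "1 < t" "t * (s - 1) = s" using s by (auto simp: t_def field_simps)
  define b where "b = (\<integral>x. norm (f x) \<partial>lborel)"
  define F where "F u = norm (fourier f u)" for u
  have [measurable]: "F \<in> borel_measurable borel" unfolding F_def by measurable
  have F0: "0 \<le> F u" and Fb: "F u \<le> b" for u unfolding F_def b_def by (auto intro: norm_fourier_le)
  have Fa: "\<bar>F u\<bar> \<le> b" for u using F0 Fb by simp
  have b0: "0 \<le> b" using order.trans[OF F0 Fb] .
  have wb: "0 \<le> wb" using order.trans[OF w(1) w(2)] .
  have \<rho>0: "0 < \<rho> x" for x using \<delta> less_le_trans by blast
  have P: "P = (\<lambda>x. quad_avg F (circ x) (\<rho> x))" unfolding P_def F_def ..
  have Pm [measurable]: "P \<in> borel_measurable borel" unfolding P using \<rho>0 by measurable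
  have P0: "0 \<le> P x" for x unfolding P by (rule quad_avg_nonneg)
  have Pb: "P x \<le> b" for x unfolding P by (rule ball_avg_quad_avg(2)[OF Fa \<rho>0])
  have V: "0 < ball_vol (\<rho> x)" for x by (rule ball_vol_pos[OF \<rho>0])
  have V\<delta>: "0 < ball_vol \<delta>" "ball_vol \<delta> \<le> ball_vol (\<rho> x)" for x
    using \<delta> by (auto simp: ball_vol_def intro!: mult_left_mono power_mono)
  have [measurable]: "(\<lambda>x. ball_vol (\<rho> x)) \<in> borel_measurable borel" unfolding ball_vol_def by measurable
  \<comment> \<open>Integrating \<open>\<kappa> x u\<close> against F(u)^2 in u gives w P^2 at x,
    while integrating it in x gives the multiplier \<open>k\<close>. The two orders of integration
    link the weighted average to G.\<close>
  define \<kappa> where "\<kappa> x u = w x / ball_vol (\<rho> x) * disc (circ x) (\<rho> x) u" for x u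
  have [measurable]: "(\<lambda>(x, u). \<kappa> x u) \<in> borel_measurable (borel \<Otimes>\<^sub>M borel)"
    unfolding \<kappa>_def by measurable
  have \<kappa>0: "0 \<le> \<kappa> x u" for x u unfolding \<kappa>_def using w V[of x] disc_nonneg by simp
  define kb where "kb = wb / ball_vol \<delta> * (2 * pi)"
  have kb0: "0 \<le> kb" unfolding kb_def using wb V\<delta> by simp
  have \<kappa>_int: "(\<integral>\<^sup>+x. ennreal (\<kappa> x u) \<partial>lborel) \<le> ennreal kb" for u
  proof -
    have "(\<integral>\<^sup>+x. ennreal (\<kappa> x u) \<partial>lborel) \<le> (\<integral>\<^sup>+x. ennreal (wb / ball_vol \<delta>) * indicator {0..<2 * pi} x \<partial>lborel)"
    proof (rule nn_integral_mono)
      fix x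
      have "\<kappa> x u \<le> wb / ball_vol \<delta>"
      proof -
        have "\<kappa> x u \<le> w x / ball_vol (\<rho> x)" unfolding \<kappa>_def disc_def using w V[of x] by auto
        also have "\<dots> \<le> wb / ball_vol \<delta>" using w wb V\<delta> by (intro frac_le) auto
        finally show ?thesis .
      qed
      then show "ennreal (\<kappa> x u) \<le> ennreal (wb / ball_vol \<delta>) * indicator {0..<2 * pi} x"
        using ws[of x] by (auto simp: indicator_def \<kappa>_def intro!: ennreal_leI)
    qed
    also have "\<dots> = ennreal kb" using wb V\<delta> by (simp add: nn_integral_cmult_indicator kb_def ennreal_mult[symmetric])
    finally show ?thesis .
  qed
  define k where "k u = enn2real (\<integral>\<^sup>+x. ennreal (\<kappa> x u) \<partial>lborel)" for u
  have [measurable]: "k \<in> borel_measurable borel" unfolding k_def by measurable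
  have k: "ennreal (k u) = (\<integral>\<^sup>+x. ennreal (\<kappa> x u) \<partial>lborel)" for u
    unfolding k_def using le_less_trans[OF \<kappa>_int ennreal_less_top, of u] by simp
  have k0: "0 \<le> k u" for u by (simp add: k_def)
  have kkb: "k u \<le> kb" for u using \<kappa>_int[of u] kb0 unfolding k[symmetric] by simp
  \<comment> \<open>Centres have norm 1 and radii are at most D.\<close>
  have ks: "k u = 0" if "u \<notin> ball 0 (1 + D)" for u
  proof -
    have "\<kappa> x u = 0" for x
    proof -
      have "1 + D \<le> norm u" using that by simp
      also have "norm u \<le> dist (circ x) u + 1" using norm_triangle_ineq2[of u "circ x"] by (simp add: dist_norm norm_minus_commute)
      finally show ?thesis using D[of x] by (simp add: \<kappa>_def disc_def)
    qed
    then show ?thesis by (simp add: k_def)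
  qed
  define G where "G u = complex_of_real (k u) * cnj (fourier f u)" for u
  have [measurable]: "G \<in> borel_measurable borel"
    unfolding G_def by (intro borel_measurable_times measurable_compose[OF _ cnj_measurable]) measurable
  have nG: "norm (G u) = k u * F u" for u by (simp add: G_def norm_mult k0 F_def)
  have nGb: "norm (G u) \<le> kb * b" for u unfolding nG using k0 kkb F0 Fb kb0 by (intro mult_mono) auto
  have Gfin: "(\<integral>\<^sup>+u. ennreal (norm (G u)) \<partial>lborel) < \<infinity>"
  proof -
    have "(\<integral>\<^sup>+u. ennreal (norm (G u)) \<partial>lborel) \<le> (\<integral>\<^sup>+u. ennreal (kb * b) * indicator (ball (0::real^2) (1 + D)) u \<partial>lborel)"
    proof (rule nn_integral_mono)
      fix u
      show "ennreal (norm (G u)) \<le> ennreal (kb * b) * indicator (ball 0 (1 + D)) u"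
        using nGb[of u] ks[of u] by (cases "u \<in> ball 0 (1 + D)") (auto simp: nG intro!: ennreal_leI)
    qed
    also have "\<dots> = ennreal (kb * b) * emeasure lborel (ball (0::real^2) (1 + D))"
      by (rule nn_integral_cmult_indicator) simp
    also have "\<dots> < \<infinity>" using emeasure_lborel_ball_finite[of "0::real^2" "1 + D"] by (simp add: ennreal_mult_less_top)
    finally show ?thesis .
  qed
  then have Gi: "integrable lborel G" by (intro integrableI_bounded) auto
  define \<alpha> where "\<alpha> x u = \<kappa> x u * F u" for x u
  have \<alpha>m [measurable]: "(\<lambda>(x, u). \<alpha> x u) \<in> borel_measurable (borel \<Otimes>\<^sub>M borel)" unfolding \<alpha>_def by measurable
  have \<alpha>0: "0 \<le> \<alpha> x u" for x u unfolding \<alpha>_def using \<kappa>0 F0 by simp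
  have G\<alpha>: "ennreal (norm (G u)) = (\<integral>\<^sup>+x. ennreal (\<alpha> x u) \<partial>lborel)" for u
    unfolding nG \<alpha>_def using k0 F0 \<kappa>0 by (simp add: ennreal_mult k nn_integral_multc)
  define g where "g x = w x * P x" for x
  have g0: "0 \<le> g x" for x unfolding g_def using w P0 by simp
  have gb: "g x \<le> wb * b" for x unfolding g_def using w P0 Pb wb by (intro mult_mono) auto
  have bil: "(\<integral>\<^sup>+u. \<integral>\<^sup>+v. ennreal (\<alpha> x u * \<alpha> y v * h (u + v)) \<partial>lborel \<partial>lborel)
        \<le> ennreal (g x * g y * (2 * sqrt (enn2real (hl_maximal (\<lambda>z. (h z)\<^sup>2) (circ x + circ y)))))"
    if hm [measurable]: "h \<in> borel_measurable borel" and h0: "\<And>z. 0 \<le> h z" and hd: "\<And>z. h z \<le> d" for h d x y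
  proof -
    define m where "m = 2 * sqrt (enn2real (hl_maximal (\<lambda>z. (h z)\<^sup>2) (circ x + circ y)))"
    define c where "c = w x / ball_vol (\<rho> x) * (w y / ball_vol (\<rho> y))"
    have c0: "0 \<le> c" unfolding c_def using w V[of x] V[of y] by simp
    have m0: "0 \<le> m" by (simp add: m_def)
    have "(\<integral>\<^sup>+u. \<integral>\<^sup>+v. ennreal (\<alpha> x u * \<alpha> y v * h (u + v)) \<partial>lborel \<partial>lborel)
      = (\<integral>\<^sup>+u. \<integral>\<^sup>+v. ennreal c * ennreal ((F u * disc (circ x) (\<rho> x) u) * (F v * disc (circ y) (\<rho> y) v) * h (u + v)) \<partial>lborel \<partial>lborel)"
      using c0 by (intro nn_integral_cong) (simp add: ennreal_mult[symmetric] F0 h0 disc_nonneg \<alpha>_def \<kappa>_def c_def mult_ac)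
    also have "\<dots> = ennreal c * (\<integral>\<^sup>+u. \<integral>\<^sup>+v. ennreal ((F u * disc (circ x) (\<rho> x) u) * (F v * disc (circ y) (\<rho> y) v) * h (u + v)) \<partial>lborel \<partial>lborel)"
      by (simp add: nn_integral_cmult)
    also have "\<dots> \<le> ennreal c * ennreal (ball_vol (\<rho> x) * ball_vol (\<rho> y) * P x * P y * m)"
      unfolding P m_def by (intro mult_left_mono bilinear_disc_bound[OF _ hm F0 Fb h0 hd \<rho>0 \<rho>0]) auto
    also have "\<dots> = ennreal (c * (ball_vol (\<rho> x) * ball_vol (\<rho> y) * P x * P y * m))"
      using c0 V[of x] V[of y] P0 m0 by (intro ennreal_mult[symmetric]) (auto intro!: mult_nonneg_nonneg)
    \<comment> \<open>The disc areas cancel against the normalisations: this is why no relation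
      between the two radii is needed.\<close>
    also have "c * (ball_vol (\<rho> x) * ball_vol (\<rho> y) * P x * P y * m) = g x * g y * m"
      unfolding c_def g_def using V[of x] V[of y] by simp
    finally show ?thesis unfolding m_def .
  qed
  define K where "K = (conv_const s * A\<^sup>2) powr t"
  have K0: "0 < K" unfolding K_def using conv_const_pos[OF s] A by simp
  note sc = self_convolution_bound[OF s t_def _ norm_ge_zero nGb Gfin \<alpha>m \<alpha>0 G\<alpha> _ g0 gb _ A _ bil]
  have sc1: "(\<integral>\<^sup>+z. ennreal (enn2real (\<integral>\<^sup>+u. ennreal (norm (G u) * norm (G (z - u))) \<partial>lborel) powr t) \<partial>lborel) \<le> ennreal K"
    unfolding K_def by (rule sc(1)) (use wA ws in \<open>auto simp: g_def\<close>)
  have sc2: "(\<integral>\<^sup>+u. ennreal (norm (G u) * norm (G (z - u))) \<partial>lborel) < \<infinity>" for z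
    by (rule sc(2)) (use wA ws in \<open>auto simp: g_def\<close>)
  define H where "H z = (\<integral>u. G u * G (z - u) \<partial>lborel)" for z
  have Hi: "integrable lborel H" and Hh: "fourier H \<xi> = fourier G \<xi> * fourier G \<xi>" for \<xi>
    unfolding H_def[abs_def] using fourier_convolution[OF Gi Gi] by auto
  have nH: "norm (H z) \<le> enn2real (\<integral>\<^sup>+u. ennreal (norm (G u) * norm (G (z - u))) \<partial>lborel)" for z
  proof -
    have "integrable lborel (\<lambda>u. G u * G (z - u))"
      using sc2[of z] by (intro integrableI_bounded) (auto simp: norm_mult)
    then have "ennreal (norm (H z)) \<le> (\<integral>\<^sup>+u. ennreal (norm (G u * G (z - u))) \<partial>lborel)"
      unfolding H_def by (rule integral_norm_bound_ennreal)
    also have "\<dots> = ennreal (enn2real (\<integral>\<^sup>+u. ennreal (norm (G u) * norm (G (z - u))) \<partial>lborel))"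
      using sc2[of z] by (simp add: norm_mult)
    finally show ?thesis by (simp add: ennreal_le_iff)
  qed
  have HK: "(\<integral>\<^sup>+z. ennreal (norm (H z) powr t) \<partial>lborel) \<le> ennreal K"
    by (rule order.trans[OF nn_integral_mono sc1]) (use nH t1 in \<open>auto intro!: ennreal_leI powr_mono2\<close>)
  have GK: "(\<integral>\<^sup>+\<xi>. ennreal (norm (fourier G \<xi>) powr (2 * s)) \<partial>lborel) \<le> ennreal ((restriction_const s * A) powr (2 * s))"
  proof -
    have "(\<integral>\<^sup>+\<xi>. ennreal (norm (fourier G \<xi>) powr (2 * s)) \<partial>lborel) = (\<integral>\<^sup>+\<xi>. ennreal (norm (fourier H \<xi>) powr s) \<partial>lborel)"
      by (intro nn_integral_cong) (simp add: Hh norm_mult powr_mult powr_add[symmetric])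
    also have "\<dots> \<le> ennreal (4 * s / (s - 2) * 2 powr (s - 2) * K powr (s - 1))"
      by (rule Hausdorff_Young_weak_constant[OF Hi s t_def K0 HK])
    also have "4 * s / (s - 2) * 2 powr (s - 2) * K powr (s - 1) = (restriction_const s * A) powr (2 * s)"
    proof -
      \<comment> \<open>As t (s - 1) = s, the Hausdorff--Young bound becomes homogeneous of degree 2
        s in A.\<close>
      have "K powr (s - 1) = (conv_const s * A\<^sup>2) powr s" unfolding K_def powr_powr t1(2) ..
      also have "\<dots> = conv_const s powr s * A powr (2 * s)"
        using A conv_const_pos[OF s] by (simp add: powr_mult powr_powr flip: powr_numeral)
      finally have "4 * s / (s - 2) * 2 powr (s - 2) * K powr (s - 1) = (4 * s / (s - 2) * 2 powr (s - 2) * conv_const s powr s) * A powr (2 * s)"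
        by simp
      also have "\<dots> = (restriction_const s * A) powr (2 * s)"
        using s A conv_const_pos[OF s] by (simp add: restriction_const_def powr_mult powr_powr)
      finally show ?thesis .
    qed
    finally show ?thesis .
  qed
  have "(\<integral>\<^sup>+x. ennreal (w x * (P x)\<^sup>2) \<partial>lborel) = (\<integral>\<^sup>+x. \<integral>\<^sup>+u. ennreal (\<kappa> x u) * ennreal ((F u)\<^sup>2) \<partial>lborel \<partial>lborel)"
  proof (rule nn_integral_cong)
    fix x
    have "(\<integral>\<^sup>+u. ennreal (\<kappa> x u) * ennreal ((F u)\<^sup>2) \<partial>lborel)
      = (\<integral>\<^sup>+u. ennreal (w x / ball_vol (\<rho> x)) * ennreal ((F u * (if dist (circ x) u < \<rho> x then 1 else 0)) powr 2) \<partial>lborel)"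
      using w V[of x] F0 by (intro nn_integral_cong) (auto simp: \<kappa>_def disc_def)
    also have "\<dots> = ennreal (w x / ball_vol (\<rho> x)) * (\<integral>\<^sup>+u. ennreal ((F u * (if dist (circ x) u < \<rho> x then 1 else 0)) powr 2) \<partial>lborel)"
      by (rule nn_integral_cmult) measurable
    also have "\<dots> = ennreal (w x / ball_vol (\<rho> x)) * ennreal ((sqrt (ball_vol (\<rho> x)) * P x) powr 2)"
      unfolding nn_integral_ball_quad_avg[OF F0 Fa \<rho>0] P ..
    also have "\<dots> = ennreal (w x / ball_vol (\<rho> x) * (sqrt (ball_vol (\<rho> x)) * P x) powr 2)"
      using w V[of x] by (intro ennreal_mult[symmetric]) auto
    also have "w x / ball_vol (\<rho> x) * (sqrt (ball_vol (\<rho> x)) * P x) powr 2 = w x * (P x)\<^sup>2"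
      using V[of x] P0[of x] by (simp add: power_mult_distrib)
    finally show "ennreal (w x * (P x)\<^sup>2) = (\<integral>\<^sup>+u. ennreal (\<kappa> x u) * ennreal ((F u)\<^sup>2) \<partial>lborel)" ..
  qed
  also have "\<dots> = (\<integral>\<^sup>+u. \<integral>\<^sup>+x. ennreal (\<kappa> x u) * ennreal ((F u)\<^sup>2) \<partial>lborel \<partial>lborel)"
    by (rule nn_integral_swap_lborel) measurable
  also have "\<dots> = (\<integral>\<^sup>+u. ennreal (k u * (F u)\<^sup>2) \<partial>lborel)"
    by (simp add: nn_integral_multc k[symmetric] ennreal_mult k0)
  also have "\<dots> = ennreal (norm (\<integral>u. fourier f u * G u \<partial>lborel))"
  proof -
    \<comment> \<open>The conjugate in G makes the pairing nonnegative, so its modulus is the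
      integral itself.\<close>
    have e: "fourier f u * G u = complex_of_real (k u * (F u)\<^sup>2)" for u
      unfolding G_def F_def by (simp only: of_real_mult complex_norm_square mult_ac)
    have "integrable lborel (\<lambda>u. fourier f u * G u)"
      by (rule Bochner_Integration.integrable_bound[OF integrable_mult_right[OF integrable_norm[OF Gi], of b]])
         (auto simp: norm_mult b0 F_def[symmetric] intro!: mult_right_mono Fb)
    then have "integrable lborel (\<lambda>u. k u * (F u)\<^sup>2)"
      unfolding e using complex_of_real_integrable_eq by blast
    then have "(\<integral>\<^sup>+u. ennreal (k u * (F u)\<^sup>2) \<partial>lborel) = ennreal (\<integral>u. k u * (F u)\<^sup>2 \<partial>lborel)"
      by (intro nn_integral_eq_integral) (auto simp: k0)
    also have "(\<integral>u. k u * (F u)\<^sup>2 \<partial>lborel) = norm (\<integral>u. fourier f u * G u \<partial>lborel)"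
      unfolding e integral_complex_of_real norm_of_real by (simp add: Bochner_Integration.integral_nonneg k0)
    finally show ?thesis .
  qed
  also have "\<dots> \<le> (\<integral>\<^sup>+x. ennreal (norm (f x * fourier G x)) \<partial>lborel)"
    unfolding fourier_multiplication[OF f Gi]
  proof (rule integral_norm_bound_ennreal)
    show "integrable lborel (\<lambda>x. f x * fourier G x)"
      by (rule Bochner_Integration.integrable_bound[OF integrable_mult_left[OF integrable_norm[OF f], of "\<integral>x. norm (G x) \<partial>lborel"]])
         (auto simp: norm_mult abs_mult intro!: mult_left_mono order.trans[OF norm_fourier_le])
  qed
  also have "\<dots> = (\<integral>\<^sup>+x. ennreal (norm (f x) * norm (fourier G x)) \<partial>lborel)"
    by (simp add: norm_mult)
  also have "\<dots> \<le> ennreal (Fp * (restriction_const s * A))"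
    by (rule nn_integral_Holder[OF _ _ _ _ _ _ _ Fp(1) _ Fp(2) GK])
       (use s A restriction_const_pos[OF s] in \<open>auto simp: field_simps\<close>)
  finally show ?thesis .
qed

text \<open>With q = 2 s / 3 the weight w = P^(q-2) satisfies both w P^2 = P^q and (w P)^(q') = P^q,
  so the dual estimate reads Z \<le> C Z^(1/q') for Z the integral of P^q. For q < 2 this weight is
  unbounded near zeros of P, so P is cut off below \<open>\<epsilon>\<close> and the cut is removed
  by Fatou's lemma.\<close>

lemma linearised_restriction:
  fixes f :: "real^2 \<Rightarrow> complex" and \<rho> :: "real \<Rightarrow> real"
  defines "P \<equiv> \<lambda>x. quad_avg (\<lambda>u. norm (fourier f u)) (circ x) (\<rho> x)"
  assumes s: "2 < s" and f: "integrable lborel f"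
    and Fp: "0 \<le> Fp" "(\<integral>\<^sup>+x. ennreal (norm (f x) powr (2 * s / (2 * s - 1))) \<partial>lborel) \<le> ennreal (Fp powr (2 * s / (2 * s - 1)))"
    and \<rho>m [measurable]: "\<rho> \<in> borel_measurable borel" and \<delta>: "0 < \<delta>" "\<And>x. \<delta> \<le> \<rho> x" and D: "\<And>x. \<rho> x \<le> D"
  shows "(\<integral>\<^sup>+x\<in>{0..<2 * pi}. ennreal (P x powr (2 * s / 3)) \<partial>lborel) \<le> ennreal ((restriction_const s * Fp) powr (2 * s / 3))"
proof -
  have [measurable]: "f \<in> borel_measurable borel" using f by auto
  define q where "q = 2 * s / 3"
  define q' where "q' = 2 * s / (2 * s - 3)"
  have q: "1 < q" "0 < q'" "(q - 1) * q' = q" "1 / q + 1 / q' = 1" using s by (auto simp: q_def q'_def field_simps)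
  define b where "b = (\<integral>x. norm (f x) \<partial>lborel)"
  have \<rho>0: "0 < \<rho> x" for x using \<delta> less_le_trans by blast
  have Pm [measurable]: "P \<in> borel_measurable borel" unfolding P_def using \<rho>0 by measurable
  have Peq: "quad_avg (\<lambda>u. norm (fourier f u)) (circ x) (\<rho> x) = P x" for x unfolding P_def ..
  have P0: "0 \<le> P x" for x unfolding P_def by (rule quad_avg_nonneg)
  have Pb: "P x \<le> b" for x unfolding P_def b_def
    by (rule ball_avg_quad_avg(2)[OF _ \<rho>0]) (auto intro: norm_fourier_le)
  define T where "T \<epsilon> x = P x powr q * (if \<epsilon> \<le> P x then 1 else 0) * indicator {0..<2 * pi} x" for \<epsilon> x
  have [measurable]: "T \<epsilon> \<in> borel_measurable borel" for \<epsilon> unfolding T_def by measurable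
  have T0: "0 \<le> T \<epsilon> x" for \<epsilon> x by (simp add: T_def)
  have cut: "(\<integral>\<^sup>+x. ennreal (T \<epsilon> x) \<partial>lborel) \<le> ennreal ((restriction_const s * Fp) powr q)" if \<epsilon>: "0 < \<epsilon>" for \<epsilon>
  proof -
    have "(\<integral>\<^sup>+x. ennreal (T \<epsilon> x) \<partial>lborel) \<le> (\<integral>\<^sup>+x. ennreal (b powr q) * indicator {0..<2 * pi} x \<partial>lborel)"
      using P0 Pb q by (intro nn_integral_mono) (auto simp: T_def indicator_def intro!: ennreal_leI powr_mono2)
    also have "\<dots> < \<infinity>" by (simp add: nn_integral_cmult_indicator ennreal_mult_less_top)
    finally obtain Z where Z: "(\<integral>\<^sup>+x. ennreal (T \<epsilon> x) \<partial>lborel) = ennreal Z" "0 \<le> Z"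
      by (cases "\<integral>\<^sup>+x. ennreal (T \<epsilon> x) \<partial>lborel") auto
    show ?thesis
    proof (cases "Z = 0")
      case False
      with Z have Z0: "0 < Z" by simp
      define w where "w x = P x powr (q - 2) * (if \<epsilon> \<le> P x then 1 else 0) * indicator {0..<2 * pi} x" for x
      have wP: "w x * P x = P x powr (q - 1) * (if \<epsilon> \<le> P x then 1 else 0) * indicator {0..<2 * pi} x" for x
        using \<epsilon> powr_add[of "P x" "q - 2" 1] by (auto simp: w_def)
      have wPP: "w x * (P x)\<^sup>2 = T \<epsilon> x" for x
        using \<epsilon> powr_add[of "P x" "q - 2" 2] by (auto simp: w_def T_def)
      have "ennreal Z = (\<integral>\<^sup>+x. ennreal (w x * (P x)\<^sup>2) \<partial>lborel)"
        unfolding wPP Z ..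
      also have "\<dots> \<le> ennreal (Fp * (restriction_const s * Z powr (1 / q')))"
      proof (rule linearised_restriction_dual[OF s f Fp \<rho>m \<delta> D, unfolded Peq, where wb="b powr (q - 2) + \<epsilon> powr (q - 2)"])
        show "w \<in> borel_measurable borel" unfolding w_def by measurable
        show "0 \<le> w x" for x by (simp add: w_def)
        show "w x = 0" if "x \<notin> {0..<2 * pi}" for x using that by (simp add: w_def)
        \<comment> \<open>The first summand serves q \<ge> 2, where P is bounded above by b; the
          second serves q < 2, where the cut-off bounds P below.\<close>
        show "w x \<le> b powr (q - 2) + \<epsilon> powr (q - 2)" for x
        proof (cases "\<epsilon> \<le> P x")
          case True
          have "P x powr (q - 2) \<le> b powr (q - 2) + \<epsilon> powr (q - 2)"
          proof (cases "2 \<le> q")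
            case True
            then have "P x powr (q - 2) \<le> b powr (q - 2)" using P0 Pb by (intro powr_mono2) auto
            then show ?thesis by (simp add: add_increasing2)
          next
            case False
            then have "P x powr (q - 2) \<le> \<epsilon> powr (q - 2)" using \<epsilon> \<open>\<epsilon> \<le> P x\<close> by (intro powr_mono2') auto
            then show ?thesis by (simp add: add_increasing)
          qed
          then show ?thesis by (auto simp: w_def indicator_def)
        qed (auto simp: w_def intro!: add_nonneg_nonneg)
        show "0 < Z powr (1 / q')" using Z0 by simp
        have "(w x * P x) powr q' = T \<epsilon> x" for x
          unfolding wP T_def using q by (auto simp: powr_powr indicator_def)
        then show "(\<integral>\<^sup>+x. ennreal ((w x * P x) powr (2 * s / (2 * s - 3))) \<partial>lborel) \<le> ennreal ((Z powr (1 / q')) powr (2 * s / (2 * s - 3)))"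
          unfolding q'_def[symmetric] using Z Z0 q by (simp add: powr_powr)
      qed
      finally have "Z \<le> Fp * restriction_const s * Z powr (1 / q')"
        using Fp restriction_const_pos[OF s] by (simp add: ennreal_le_iff)
      moreover have "Z = Z powr (1 / q) * Z powr (1 / q')" using Z0 q(4) by (simp add: powr_add[symmetric])
      ultimately have "Z powr (1 / q) * Z powr (1 / q') \<le> (Fp * restriction_const s) * Z powr (1 / q')" by simp
      then have "Z powr (1 / q) \<le> restriction_const s * Fp"
        using Z0 by (simp add: mult.commute)
      then have "(Z powr (1 / q)) powr q \<le> (restriction_const s * Fp) powr q" using q by (intro powr_mono2) auto
      then show ?thesis unfolding Z using Z0 q by (simp add: powr_powr ennreal_leI)
    qed (simp add: Z)
  qed
  define u where "u n x = ennreal (T (1 / real (Suc n)) x)" for n x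
  have [measurable]: "u n \<in> borel_measurable borel" for n unfolding u_def by measurable
  have "(\<integral>\<^sup>+x\<in>{0..<2 * pi}. ennreal (P x powr q) \<partial>lborel) \<le> (\<integral>\<^sup>+x. liminf (\<lambda>n. u n x) \<partial>lborel)"
  proof (rule nn_integral_mono)
    fix x
    show "ennreal (P x powr q) * indicator {0..<2 * pi} x \<le> liminf (\<lambda>n. u n x)"
    proof (cases "P x = 0")
      case False
      with P0[of x] have "0 < P x" by simp
      moreover have "(\<lambda>n. 1 / real (Suc n)) \<longlonglongrightarrow> 0" by real_asymp
      ultimately have "\<forall>\<^sub>F n in sequentially. 1 / real (Suc n) < P x" by (rule order_tendstoD[rotated])
      then have "\<forall>\<^sub>F n in sequentially. ennreal (P x powr q) * indicator {0..<2 * pi} x \<le> u n x"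
        by eventually_elim (auto simp: u_def T_def indicator_def)
      then show ?thesis by (rule Liminf_bounded)
    qed simp
  qed
  also have "\<dots> \<le> liminf (\<lambda>n. \<integral>\<^sup>+x. u n x \<partial>lborel)"
    by (rule nn_integral_liminf) simp
  also have "\<dots> \<le> liminf (\<lambda>n::nat. ennreal ((restriction_const s * Fp) powr q))"
    unfolding u_def by (intro Liminf_mono always_eventually allI cut) simp
  also have "\<dots> = ennreal ((restriction_const s * Fp) powr q)"
    by (rule Liminf_const) simp
  finally show ?thesis unfolding q_def .
qed

text \<open>The quadratic maximal function as a real number. The underlying
  \<open>hl_maximal\<close> is finite for bounded F, so \<open>enn2real\<close> loses nothing
  there.\<close>

definition max2 :: "(real^2 \<Rightarrow> real) \<Rightarrow> real^2 \<Rightarrow> real" where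
  "max2 F x = sqrt (enn2real (hl_maximal (\<lambda>u. (F u)\<^sup>2) x))"

lemma max2_measurable [measurable]:
  assumes [measurable]: "F \<in> borel_measurable borel"
  shows "max2 F \<in> borel_measurable borel"
  unfolding max2_def by measurable

lemma hl_maximal_max2:
  fixes F :: "real^2 \<Rightarrow> real"
  assumes b: "\<And>x. \<bar>F x\<bar> \<le> b"
  shows "hl_maximal (\<lambda>u. (F u)\<^sup>2) x = ennreal ((max2 F x)\<^sup>2)" "max2 F x \<le> b" "0 \<le> max2 F x"
proof -
  have b0: "0 \<le> b" using b[of undefined] by linarith
  have sq: "norm ((F x)\<^sup>2) \<le> b\<^sup>2" for x using power_mono[OF b[of x], of 2] by simp
  have le: "hl_maximal (\<lambda>u. (F u)\<^sup>2) x \<le> ennreal (b\<^sup>2)" using hl_maximal_le[of "\<lambda>u. (F u)\<^sup>2", OF sq] .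
  then have "hl_maximal (\<lambda>u. (F u)\<^sup>2) x < top" by (auto intro: le_less_trans)
  then show "hl_maximal (\<lambda>u. (F u)\<^sup>2) x = ennreal ((max2 F x)\<^sup>2)" by (simp add: max2_def)
  have "enn2real (hl_maximal (\<lambda>u. (F u)\<^sup>2) x) \<le> b\<^sup>2" using le by (rule enn2real_leI[rotated]) simp
  then show "max2 F x \<le> b" unfolding max2_def using b0 by (intro real_le_lsqrt) auto
  show "0 \<le> max2 F x" by (simp add: max2_def)
qed

text \<open>Measurable selection without a selection theorem: for each n the best of the first n + 1
  rational radii is a measurable choice with finitely many positive values, so the linearised
  estimate applies with a constant free of n. The chosen averages converge pointwise to the maximal
  function.\<close>

theorem maximal_restriction_endpoint:
  fixes f :: "real^2 \<Rightarrow> complex"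
  assumes s: "2 < s" and f: "integrable lborel f"
    and Fp: "0 \<le> Fp" "(\<integral>\<^sup>+x. ennreal (norm (f x) powr (2 * s / (2 * s - 1))) \<partial>lborel) \<le> ennreal (Fp powr (2 * s / (2 * s - 1)))"
  shows "(\<integral>\<^sup>+x\<in>{0..<2 * pi}. ennreal (max2 (\<lambda>u. norm (fourier f u)) (circ x) powr (2 * s / 3)) \<partial>lborel) \<le> ennreal ((restriction_const s * Fp) powr (2 * s / 3))"
proof -
  have [measurable]: "f \<in> borel_measurable borel" using f by auto
  define F where "F u = norm (fourier f u)" for u
  have [measurable]: "F \<in> borel_measurable borel" unfolding F_def by measurable
  define b where "b = (\<integral>x. norm (f x) \<partial>lborel)"
  have Fa: "\<bar>F u\<bar> \<le> b" for u unfolding F_def b_def by (auto intro: norm_fourier_le)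
  define R where "R = ({0<..} \<inter> \<rat> :: real set)"
  have "1 \<in> R" by (simp add: R_def)
  moreover have "countable R" unfolding R_def by (intro countable_Int2 countable_rat)
  ultimately have R: "countable R" "R \<noteq> {}" by auto
  define r where "r = from_nat_into R"
  have rR: "range r = R" unfolding r_def by (rule range_from_nat_into[OF R(2,1)])
  then have r0: "0 < r k" for k using rangeI[of r k] by (auto simp: R_def)
  define \<beta> where "\<beta> k x = quad_avg F (circ x) (r k)" for k x
  have [measurable]: "\<beta> k \<in> borel_measurable borel" for k unfolding \<beta>_def using r0 by measurable
  have \<beta>: "ball_avg (\<lambda>u. (F u)\<^sup>2) (circ x) (r k) = ennreal ((\<beta> k x)\<^sup>2)" for k x
    unfolding \<beta>_def by (rule ball_avg_quad_avg(1)[OF Fa r0])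
  have \<beta>0: "0 \<le> \<beta> k x" for k x unfolding \<beta>_def by (rule quad_avg_nonneg)
  \<comment> \<open>Taking the least maximising index makes the choice unique and measurable, even
    where several radii tie.\<close>
  define best where "best n x = (LEAST k. k \<le> n \<and> (\<forall>j\<le>n. \<beta> j x \<le> \<beta> k x))" for n x
  have best: "best n x \<le> n \<and> (\<forall>j\<le>n. \<beta> j x \<le> \<beta> (best n x) x)" for n x
  proof -
    have "Max ((\<lambda>j. \<beta> j x) ` {..n}) \<in> (\<lambda>j. \<beta> j x) ` {..n}" by (rule Max_in) auto
    then obtain k where k: "Max ((\<lambda>j. \<beta> j x) ` {..n}) = \<beta> k x" "k \<in> {..n}" by (rule imageE)
    have "\<beta> j x \<le> \<beta> k x" if "j \<le> n" for j
      unfolding k(1)[symmetric] using that by (intro Max_ge) auto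
    with k(2) have "k \<le> n \<and> (\<forall>j\<le>n. \<beta> j x \<le> \<beta> k x)" by simp
    then show ?thesis unfolding best_def by (rule LeastI)
  qed
  have [measurable]: "best n \<in> borel \<rightarrow>\<^sub>M count_space UNIV" for n
    unfolding best_def by (intro measurable_Least) measurable
  define \<rho> where "\<rho> n x = r (best n x)" for n x
  have [measurable]: "\<rho> n \<in> borel_measurable borel" for n unfolding \<rho>_def by measurable
  define P where "P n x = quad_avg F (circ x) (\<rho> n x)" for n x
  have P\<beta>: "P n x = \<beta> (best n x) x" for n x unfolding P_def \<rho>_def \<beta>_def ..
  have [measurable]: "P n \<in> borel_measurable borel" for n
    unfolding P_def using r0 by (intro quad_avg_measurable) (auto simp: \<rho>_def)
  have bound: "(\<integral>\<^sup>+x\<in>{0..<2 * pi}. ennreal (P n x powr (2 * s / 3)) \<partial>lborel) \<le> ennreal ((restriction_const s * Fp) powr (2 * s / 3))" for n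
    unfolding P_def F_def
  proof (rule linearised_restriction[OF s f Fp])
    show "\<rho> n \<in> borel_measurable borel" by measurable
    show "0 < Min (r ` {..n})" using r0 by (subst Min_gr_iff) auto
    show "Min (r ` {..n}) \<le> \<rho> n x" for x unfolding \<rho>_def using best by (intro Min_le) auto
    show "\<rho> n x \<le> Max (r ` {..n})" for x unfolding \<rho>_def using best by (intro Max_ge) auto
  qed
  have lim: "(\<lambda>n. P n x) \<longlonglongrightarrow> max2 F (circ x)" for x
  proof -
    have hm: "ennreal ((max2 F (circ x))\<^sup>2) = (SUP k. ennreal ((\<beta> k x)\<^sup>2))"
      unfolding hl_maximal_max2(1)[OF Fa, symmetric] \<beta>[symmetric]
      by (subst hl_maximal_Rats) (auto simp: R_def[symmetric] rR[symmetric] image_image)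
    have up: "P n x \<le> max2 F (circ x)" for n
    proof -
      have "ennreal ((P n x)\<^sup>2) \<le> ennreal ((max2 F (circ x))\<^sup>2)" unfolding hm P\<beta> by (rule SUP_upper) simp
      then have "(P n x)\<^sup>2 \<le> (max2 F (circ x))\<^sup>2" by (simp add: ennreal_le_iff)
      then show ?thesis using hl_maximal_max2(3)[OF Fa] by (rule power2_le_imp_le)
    qed
    show ?thesis
    proof (rule order_tendstoI)
      fix a assume "max2 F (circ x) < a"
      then show "\<forall>\<^sub>F n in sequentially. P n x < a" using up by (intro always_eventually allI) (auto intro: le_less_trans)
    next
      fix a assume a: "a < max2 F (circ x)"
      have "\<exists>k. max a 0 \<le> \<beta> k x \<and> a < \<beta> k x"
      proof (cases "a < 0")
        case True
        then show ?thesis using \<beta>0[of 0 x] by (intro exI[of _ 0]) auto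
      next
        case False
        then have "a\<^sup>2 < (max2 F (circ x))\<^sup>2" using a by (intro power_strict_mono) auto
        then have "ennreal (a\<^sup>2) < (SUP k. ennreal ((\<beta> k x)\<^sup>2))"
          unfolding hm[symmetric] by (simp add: ennreal_less_iff)
        then obtain k where "ennreal (a\<^sup>2) < ennreal ((\<beta> k x)\<^sup>2)" by (auto simp: less_SUP_iff)
        then have "a\<^sup>2 < (\<beta> k x)\<^sup>2" by (simp add: ennreal_less_iff)
        then have "a < \<beta> k x" using \<beta>0 power2_less_imp_less by blast
        then show ?thesis using False by (intro exI[of _ k]) auto
      qed
      then obtain k where k: "a < \<beta> k x" by auto
      have "a < P n x" if "k \<le> n" for n using best[of n x] that k unfolding P\<beta> by (meson less_le_trans)
      then show "\<forall>\<^sub>F n in sequentially. a < P n x" unfolding eventually_sequentially by blast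
    qed
  qed
  have lim': "(\<lambda>n. ennreal (P n x powr (2 * s / 3)) * indicator {0..<2 * pi} x) \<longlonglongrightarrow> ennreal (max2 F (circ x) powr (2 * s / 3)) * indicator {0..<2 * pi} x" for x
  proof -
    have "(\<lambda>n. P n x powr (2 * s / 3)) \<longlonglongrightarrow> max2 F (circ x) powr (2 * s / 3)"
      using s P\<beta> \<beta>0 by (intro tendsto_powr'[OF lim tendsto_const]) auto
    then have "(\<lambda>n. ennreal (P n x powr (2 * s / 3))) \<longlonglongrightarrow> ennreal (max2 F (circ x) powr (2 * s / 3))"
      by (rule tendsto_ennrealI)
    then show ?thesis by (auto simp: indicator_def)
  qed
  have "(\<integral>\<^sup>+x\<in>{0..<2 * pi}. ennreal (max2 F (circ x) powr (2 * s / 3)) \<partial>lborel)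
     = (\<integral>\<^sup>+x. liminf (\<lambda>n. ennreal (P n x powr (2 * s / 3)) * indicator {0..<2 * pi} x) \<partial>lborel)"
    using lim_imp_Liminf[OF _ lim'] by (intro nn_integral_cong) simp
  also have "\<dots> \<le> liminf (\<lambda>n. \<integral>\<^sup>+x\<in>{0..<2 * pi}. ennreal (P n x powr (2 * s / 3)) \<partial>lborel)"
    by (rule nn_integral_liminf) measurable
  also have "\<dots> \<le> liminf (\<lambda>n::nat. ennreal ((restriction_const s * Fp) powr (2 * s / 3)))"
    by (intro Liminf_mono always_eventually allI bound)
  also have "\<dots> = ennreal ((restriction_const s * Fp) powr (2 * s / 3))"
    by (rule Liminf_const) simp
  finally show ?thesis unfolding F_def .
qed

section \<open>Reduction to the endpoint\<close>

text \<open>A weighted Young inequality normalised at a level A: if the r-th power averages to at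
  most A^r, the right side averages to at most A^q. It replaces Jensen's inequality, both for
  lowering the power 2 to r inside the maximal function and for lowering the endpoint exponent to q
  on the circle.\<close>

lemma powr_le_interpolate:
  fixes t A q r :: real
  assumes "0 < q" "q \<le> r" "0 < A" "0 \<le> t"
  shows "t powr q \<le> q / r * A powr (q - r) * t powr r + (1 - q / r) * A powr q"
proof (cases "t = 0")
  case False
  with assms have t: "0 < t" by simp
  have "(t powr r) powr (q / r) * (A powr r) powr (1 - q / r) \<le> q / r * t powr r + (1 - q / r) * A powr r"
    using assms t by (intro Youngs_inequality_0) auto
  moreover have "r * (q / r) = q" "r * (1 - q / r) = r - q" using assms by (auto simp: field_simps)
  ultimately have "t powr q * A powr (r - q) \<le> q / r * t powr r + (1 - q / r) * A powr r"
    by (simp only: powr_powr)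
  then have "t powr q * A powr (r - q) * A powr (q - r) \<le> (q / r * t powr r + (1 - q / r) * A powr r) * A powr (q - r)"
    by (intro mult_right_mono) auto
  moreover have "A powr (r - q) * A powr (q - r) = 1" "A powr r * A powr (q - r) = A powr q"
    using assms by (simp_all add: powr_add[symmetric])
  ultimately show ?thesis by (simp add: algebra_simps)
qed (use assms in \<open>simp add: field_simps\<close>)

lemma ennreal_powr_ennreal: "0 \<le> x \<Longrightarrow> ennreal_powr (ennreal x) s = ennreal (x powr s)"
  by (simp add: ennreal_powr_def)

lemma ennreal_powr_mono:
  assumes "x \<le> y" "0 < s"
  shows "ennreal_powr x s \<le> ennreal_powr y s"
proof (cases "y = \<infinity>")
  case False
  then have fin: "x < top" "y < top" using assms by (auto simp: top.not_eq_extremum intro: le_less_trans)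
  then have "enn2real x \<le> enn2real y" using assms by (intro enn2real_mono) auto
  then have "enn2real x powr s \<le> enn2real y powr s" using assms by (intro powr_mono2) auto
  then show ?thesis using fin by (auto simp: ennreal_powr_def ennreal_leI)
qed (simp add: ennreal_powr_def)

lemma ennreal_powr_measurable [measurable]:
  assumes [measurable]: "g \<in> borel_measurable M"
  shows "(\<lambda>x. ennreal_powr (g x) s) \<in> borel_measurable M"
  unfolding ennreal_powr_def by measurable

text \<open>The pointwise interpolation at level A is averaged over the disc. Taking A strictly
  above \<open>max2 F x\<close> guarantees A > 0, also where the maximal function vanishes.\<close>

lemma ball_avg_powr_le_max2:
  fixes F :: "real^2 \<Rightarrow> real"
  assumes [measurable]: "F \<in> borel_measurable borel" and F0: "\<And>u. 0 \<le> F u" and b: "\<And>u. F u \<le> b"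
    and r: "1 \<le> r" "r \<le> 2" and \<rho>: "0 < \<rho>" and A: "max2 F x < A"
  shows "ball_avg (\<lambda>u. F u powr r) x \<rho> \<le> ennreal (A powr r)"
proof -
  have Fa: "\<bar>F u\<bar> \<le> b" for u using F0 b by simp
  have N0: "0 \<le> max2 F x" by (rule hl_maximal_max2(3)[OF Fa])
  with A have A0: "0 < A" by linarith
  define c where "c = r / 2 * A powr (r - 2)"
  define d where "d = (1 - r / 2) * A powr r"
  define V where "V = ball_vol \<rho>"
  have V: "0 < V" unfolding V_def by (rule ball_vol_pos[OF \<rho>])
  have cd: "0 \<le> c" "0 \<le> d" using r A0 by (auto simp: c_def d_def)
  have pt: "F u powr r \<le> c * (F u)\<^sup>2 + d" for u
    using powr_le_interpolate[of r 2 A "F u"] r A0 F0[of u] by (simp add: c_def d_def)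
  have "(\<integral>\<^sup>+u\<in>ball x \<rho>. ennreal (norm (F u powr r)) \<partial>lborel)
     \<le> (\<integral>\<^sup>+u. ennreal c * (ennreal (norm ((F u)\<^sup>2)) * indicator (ball x \<rho>) u) + ennreal d * indicator (ball x \<rho>) u \<partial>lborel)"
    using pt cd by (intro nn_integral_mono) (auto simp: indicator_def ennreal_mult[symmetric] ennreal_plus[symmetric] simp del: ennreal_plus intro!: ennreal_leI)
  also have "\<dots> = (\<integral>\<^sup>+u. ennreal c * (ennreal (norm ((F u)\<^sup>2)) * indicator (ball x \<rho>) u) \<partial>lborel) + (\<integral>\<^sup>+u. ennreal d * indicator (ball x \<rho>) u \<partial>lborel)"
    by (rule nn_integral_add) (intro borel_measurable_times_ennreal borel_measurable_indicator; measurable)+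
  also have "(\<integral>\<^sup>+u. ennreal c * (ennreal (norm ((F u)\<^sup>2)) * indicator (ball x \<rho>) u) \<partial>lborel) = ennreal c * (\<integral>\<^sup>+u\<in>ball x \<rho>. ennreal (norm ((F u)\<^sup>2)) \<partial>lborel)"
    by (rule nn_integral_cmult) (intro borel_measurable_times_ennreal borel_measurable_indicator; measurable)
  also have "(\<integral>\<^sup>+u. ennreal d * indicator (ball x \<rho>) u \<partial>lborel) = ennreal d * ennreal V"
    using emeasure_ball_real2[OF \<rho>, of x] by (simp add: nn_integral_cmult_indicator V_def)
  also have "ennreal c * (\<integral>\<^sup>+u\<in>ball x \<rho>. ennreal (norm ((F u)\<^sup>2)) \<partial>lborel) + ennreal d * ennreal V
     \<le> ennreal c * (ennreal V * ennreal (A\<^sup>2)) + ennreal d * ennreal V"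
  proof (intro add_mono mult_left_mono order_refl)
    have "(\<integral>\<^sup>+u\<in>ball x \<rho>. ennreal (norm ((F u)\<^sup>2)) \<partial>lborel) \<le> ennreal V * ennreal ((max2 F x)\<^sup>2)"
      using nn_integral_ball_le_hl_maximal[OF \<rho>, where f="\<lambda>u. (F u)\<^sup>2" and x=x]
      unfolding hl_maximal_max2(1)[OF Fa] emeasure_ball_real2[OF \<rho>] V_def .
    also have "\<dots> \<le> ennreal V * ennreal (A\<^sup>2)"
      using A N0 by (intro mult_left_mono ennreal_leI power_mono) auto
    finally show "(\<integral>\<^sup>+u\<in>ball x \<rho>. ennreal (norm ((F u)\<^sup>2)) \<partial>lborel) \<le> ennreal V * ennreal (A\<^sup>2)" .
  qed auto
  also have "\<dots> = ennreal (c * (V * A\<^sup>2) + d * V)"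
    using cd V by (simp add: ennreal_mult[symmetric] ennreal_plus[symmetric] del: ennreal_plus)
  also have "c * (V * A\<^sup>2) + d * V = V * A powr r"
  proof -
    have "A powr (r - 2) * A\<^sup>2 = A powr r" using A0 powr_add[of A "r - 2" 2] by simp
    then have "c * (V * A\<^sup>2) = V * (r / 2 * A powr r)" by (simp add: c_def mult_ac)
    then show ?thesis by (simp add: d_def algebra_simps)
  qed
  finally show ?thesis
    unfolding ball_avg_le_iff[OF \<rho>] emeasure_ball_real2[OF \<rho>] V_def using V by (simp add: ennreal_mult V_def)
qed

lemma hl_maximal_powr_le_max2:
  fixes h :: "real^2 \<Rightarrow> complex"
  assumes [measurable]: "h \<in> borel_measurable borel" and b: "\<And>u. norm (h u) \<le> b" and r: "1 \<le> r" "r \<le> 2"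
  shows "hl_maximal_powr r h x \<le> ennreal (max2 (\<lambda>u. norm (h u)) x)"
proof -
  let ?F = "\<lambda>u. norm (h u)"
  have N0: "0 \<le> max2 ?F x" by (rule hl_maximal_max2(3)[where b=b]) (use b in auto)
  show ?thesis
  proof (rule ennreal_le_epsilon)
    fix e :: real assume e: "0 < e"
    have "hl_maximal (\<lambda>y. norm (h y) powr r) x \<le> ennreal ((max2 ?F x + e) powr r)"
      unfolding hl_maximal_ball_avg
      by (intro SUP_least ball_avg_powr_le_max2[where b=b]) (use b r e in auto)
    then have "hl_maximal_powr r h x \<le> ennreal_powr (ennreal ((max2 ?F x + e) powr r)) (1 / r)"
      unfolding hl_maximal_powr_def using r by (intro ennreal_powr_mono) auto
    also have "\<dots> = ennreal (max2 ?F x + e)"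
      using r N0 e by (simp add: ennreal_powr_ennreal powr_powr)
    also have "\<dots> = ennreal (max2 ?F x) + ennreal e" using N0 e by (simp add: ennreal_plus)
    finally show "hl_maximal_powr r h x \<le> ennreal (max2 ?F x) + ennreal e" .
  qed
qed

lemma circ_measurable_sphere: "circ \<in> restrict_space lborel {0..<2 * pi} \<rightarrow>\<^sub>M restrict_space borel (sphere 0 1)"
  using circle_param_measurable unfolding circ_def[abs_def] .

lemma nn_integral_circle_measure:
  assumes [measurable]: "g \<in> borel_measurable borel"
  shows "(\<integral>\<^sup>+x. g x \<partial>circle_measure) = (\<integral>\<^sup>+t\<in>{0..<2 * pi}. g (circ t) \<partial>lborel)"
proof -
  have e: "circle_measure = distr (restrict_space lborel {0..<2 * pi}) (restrict_space borel (sphere 0 1)) circ"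
    by (simp add: circle_measure_def circ_def[abs_def])
  have "(\<integral>\<^sup>+x. g x \<partial>circle_measure) = (\<integral>\<^sup>+t. g (circ t) \<partial>restrict_space lborel {0..<2 * pi})"
    unfolding e by (rule nn_integral_distr[OF circ_measurable_sphere]) (simp add: measurable_restrict_space1)
  also have "\<dots> = (\<integral>\<^sup>+t\<in>{0..<2 * pi}. g (circ t) \<partial>lborel)"
    by (rule nn_integral_restrict_space) simp
  finally show ?thesis .
qed

text \<open>In 1 + 2 pi the first summand bounds the q0-th power term and the second the constant
  term on an interval of length 2 pi. Bounding the q-th root of 1 + 2 pi by the number itself makes
  the constant independent of q, so that one C serves all q.\<close>

lemma L_norm_circle_le:
  fixes g :: "real^2 \<Rightarrow> ennreal" and N :: "real^2 \<Rightarrow> real"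
  assumes [measurable]: "N \<in> borel_measurable borel" and N0: "\<And>x. 0 \<le> N x" and gN: "\<And>x. g x \<le> ennreal (N x)"
    and q: "1 \<le> q" "q \<le> q0" and A: "0 < A"
    and NA: "(\<integral>\<^sup>+t\<in>{0..<2 * pi}. ennreal (N (circ t) powr q0) \<partial>lborel) \<le> ennreal (A powr q0)"
  shows "L_norm (ennreal q) circle_measure g \<le> ennreal ((1 + 2 * pi) * A)"
proof -
  define c where "c = q / q0 * A powr (q - q0)"
  define d where "d = (1 - q / q0) * A powr q"
  have cd: "0 \<le> c" "0 \<le> d" using q by (auto simp: c_def d_def)
  have "(\<integral>\<^sup>+x. ennreal_powr (g x) q \<partial>circle_measure) \<le> (\<integral>\<^sup>+x. ennreal (N x powr q) \<partial>circle_measure)"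
    using ennreal_powr_mono[OF gN, of q] q N0 by (intro nn_integral_mono) (simp add: ennreal_powr_ennreal)
  also have "\<dots> = (\<integral>\<^sup>+t\<in>{0..<2 * pi}. ennreal (N (circ t) powr q) \<partial>lborel)"
    by (rule nn_integral_circle_measure) measurable
  also have "\<dots> \<le> (\<integral>\<^sup>+t. ennreal c * (ennreal (N (circ t) powr q0) * indicator {0..<2 * pi} t) + ennreal d * indicator {0..<2 * pi} t \<partial>lborel)"
  proof (rule nn_integral_mono)
    fix t
    have "N (circ t) powr q \<le> c * N (circ t) powr q0 + d"
      unfolding c_def d_def using q A N0 by (intro powr_le_interpolate) auto
    then show "ennreal (N (circ t) powr q) * indicator {0..<2 * pi} t \<le> ennreal c * (ennreal (N (circ t) powr q0) * indicator {0..<2 * pi} t) + ennreal d * indicator {0..<2 * pi} t"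
      using cd by (auto simp: indicator_def ennreal_mult[symmetric] ennreal_plus[symmetric] simp del: ennreal_plus intro!: ennreal_leI)
  qed
  also have "\<dots> = ennreal c * (\<integral>\<^sup>+t\<in>{0..<2 * pi}. ennreal (N (circ t) powr q0) \<partial>lborel) + ennreal d * ennreal (2 * pi)"
    by (subst nn_integral_add) (auto simp: nn_integral_cmult nn_integral_cmult_indicator)
  also have "\<dots> \<le> ennreal c * ennreal (A powr q0) + ennreal d * ennreal (2 * pi)"
    by (intro add_mono mult_left_mono NA) auto
  also have "\<dots> = ennreal (c * A powr q0 + d * (2 * pi))"
    using cd by (simp add: ennreal_mult[symmetric] ennreal_plus[symmetric] del: ennreal_plus)
  also have "\<dots> \<le> ennreal ((1 + 2 * pi) * A powr q)"
  proof (rule ennreal_leI)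
    have "A powr (q - q0) * A powr q0 = A powr q" using A by (simp add: powr_add[symmetric])
    then have "c * A powr q0 = q / q0 * A powr q" by (simp add: c_def)
    also have "\<dots> \<le> 1 * A powr q" using q by (intro mult_right_mono) auto
    finally have 1: "c * A powr q0 \<le> A powr q" by simp
    have "d \<le> 1 * A powr q" unfolding d_def using q by (intro mult_right_mono) auto
    then have 2: "d * (2 * pi) \<le> A powr q * (2 * pi)" by (intro mult_right_mono) auto
    have "(1 + 2 * pi) * A powr q = A powr q + A powr q * (2 * pi)" by (simp add: algebra_simps)
    with add_mono[OF 1 2] show "c * A powr q0 + d * (2 * pi) \<le> (1 + 2 * pi) * A powr q" by (simp only:)
  qed
  finally have "L_norm (ennreal q) circle_measure g \<le> ennreal_powr (ennreal ((1 + 2 * pi) * A powr q)) (1 / q)"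
    using q unfolding L_norm_def by (auto intro!: ennreal_powr_mono)
  also have "\<dots> = ennreal ((1 + 2 * pi) powr (1 / q) * A)"
    using A q by (simp add: ennreal_powr_ennreal powr_mult powr_powr)
  also have "\<dots> \<le> ennreal ((1 + 2 * pi) * A)"
  proof (rule ennreal_leI, rule mult_right_mono)
    have "(1 + 2 * pi) powr (1 / q) \<le> (1 + 2 * pi) powr 1" using q by (intro powr_mono) auto
    then show "(1 + 2 * pi) powr (1 / q) \<le> 1 + 2 * pi" by simp
  qed (use A in simp)
  finally show ?thesis .
qed

section \<open>Schwartz decay and conjugate exponents\<close>

lemma schwartz_integrable:
  fixes f :: "real^2 \<Rightarrow> complex"
  assumes "schwartz f"
  shows "integrable lborel f"
proof -
  have "f differentiable (at x)" for x
    using assms by (auto simp: schwartz_def iter_partial_deriv_def dest: spec[of _ "[]"])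
  then have "continuous_on UNIV f"
    by (simp add: continuous_on_eq_continuous_at differentiable_imp_continuous_within)
  then have [measurable]: "f \<in> borel_measurable borel" by (rule borel_measurable_continuous_onI)
  have bd: "\<exists>B. \<forall>x. norm ((\<Prod>j\<in>UNIV. (x $ j) ^ \<alpha> j) *\<^sub>R f x) \<le> B" for \<alpha> :: "2 \<Rightarrow> nat"
  proof -
    have "bounded (range (\<lambda>x. (\<Prod>j\<in>UNIV. (x $ j) ^ \<alpha> j) *\<^sub>R iter_partial_deriv [] f x))"
      using assms unfolding schwartz_def by blast
    then show ?thesis unfolding bounded_iff by (auto simp: iter_partial_deriv_def)
  qed
  have ex: "\<exists>B. \<forall>x. (x $ 1)^m * (x $ 2)^n * norm (f x) \<le> B" if "even m" "even n" for m n
  proof -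
    obtain B where "\<forall>x. norm ((\<Prod>j\<in>UNIV. (x $ j) ^ (if j = 1 then m else n)) *\<^sub>R f x) \<le> B"
      using bd[of "\<lambda>j. if j = 1 then m else n"] by blast
    then show ?thesis using that by (intro exI[of _ B]) (simp add: UNIV_2 abs_mult power_abs power_even_abs)
  qed
  \<comment> \<open>The four weights add up to (1 + x1^2)(1 + x2^2), whose inverse is a product of
    integrable functions of one variable. Even powers avoid absolute values.\<close>
  obtain B1 B2 B3 B4 where B: "\<And>x. (x $ 1)^0 * (x $ 2)^0 * norm (f x) \<le> B1" "\<And>x. (x $ 1)^2 * (x $ 2)^0 * norm (f x) \<le> B2"
     "\<And>x. (x $ 1)^0 * (x $ 2)^2 * norm (f x) \<le> B3" "\<And>x. (x $ 1)^2 * (x $ 2)^2 * norm (f x) \<le> B4"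
    using ex[of 0 0] ex[of 2 0] ex[of 0 2] ex[of 2 2] by auto
  define B where "B = B1 + B2 + B3 + B4"
  have fB: "norm (f x) \<le> B * inverse (1 + (x $ 1)\<^sup>2) * inverse (1 + (x $ 2)\<^sup>2)" for x
  proof -
    have p: "0 < 1 + (x $ 1)\<^sup>2" "0 < 1 + (x $ 2)\<^sup>2" by (auto intro: add_pos_nonneg)
    have "(1 + (x $ 1)\<^sup>2) * (1 + (x $ 2)\<^sup>2) * norm (f x) \<le> B"
      using B[of x] unfolding B_def by (simp add: algebra_simps)
    then have "norm (f x) \<le> B / ((1 + (x $ 1)\<^sup>2) * (1 + (x $ 2)\<^sup>2))"
      using mult_pos_pos[OF p] by (simp only: pos_le_divide_eq mult.commute)
    then show ?thesis by (simp only: divide_inverse inverse_mult_distrib mult.assoc)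
  qed
  have "norm (f 0) \<le> B" using fB[of 0] by simp
  then have B0: "0 \<le> B" by (rule order.trans[OF norm_ge_zero])
  have J: "(\<integral>\<^sup>+x. ennreal (inverse (1 + x\<^sup>2)) \<partial>lborel) < \<infinity>"
    using integrable_inverse_1_plus_square by (simp add: set_integrable_def integrable_iff_bounded add_nonneg_nonneg)
  have "(\<integral>\<^sup>+x. ennreal (norm (f x)) \<partial>lborel)
     \<le> (\<integral>\<^sup>+x. ennreal B * ennreal (inverse (1 + (x $ 1)\<^sup>2)) * ennreal (inverse (1 + (x $ 2)\<^sup>2)) \<partial>(lborel :: (real^2) measure))"
    using fB B0 by (intro nn_integral_mono) (simp add: ennreal_mult[symmetric] ennreal_leI)
  also have "\<dots> = (\<integral>\<^sup>+a. \<integral>\<^sup>+b. ennreal B * ennreal (inverse (1 + a\<^sup>2)) * ennreal (inverse (1 + b\<^sup>2)) \<partial>lborel \<partial>lborel)"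
    by (rule nn_integral_real2) measurable
  also have "\<dots> = ennreal B * (\<integral>\<^sup>+a. ennreal (inverse (1 + a\<^sup>2)) \<partial>lborel) * (\<integral>\<^sup>+b. ennreal (inverse (1 + b\<^sup>2)) \<partial>lborel)"
    by (simp add: nn_integral_cmult nn_integral_multc)
  also have "\<dots> < \<infinity>" using J by (simp add: ennreal_mult_less_top)
  finally show ?thesis by (intro integrableI_bounded) auto
qed

text \<open>In \<open>ennreal\<close> the equation must be cleared of its extreme cases: p' = 0
  makes 1 / p' equal to top, and p' = top forces p = 1.\<close>

lemma conjugate_exponent:
  fixes p :: real and p' :: ennreal
  assumes p: "1 < p" and conj: "1 / ennreal p + 1 / p' = 1"
  obtains x where "p' = ennreal x" "1 < x" "1 / p + 1 / x = 1"
proof (cases p')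
  case (real x)
  have "x \<noteq> 0"
  proof
    assume "x = 0"
    then have "1 / p' = top" using real by simp
    with conj show False by simp
  qed
  with real have x: "0 < x" by simp
  then have "1 / ennreal p = ennreal (1 / p)" "1 / p' = ennreal (1 / x)"
    using p real by (simp_all add: divide_ennreal flip: ennreal_1)
  then have "ennreal (1 / p + 1 / x) = ennreal 1"
    using conj p x by simp
  then have e: "1 / p + 1 / x = 1" using p x by (subst (asm) ennreal_inj) auto
  moreover have "0 < 1 / p" using p by simp
  ultimately have "1 / x < 1" by linarith
  then have "1 < x" using x by simp
  then show ?thesis using that real e by blast
next
  case top
  then have "1 / ennreal p = 1" using conj by simp
  then have "ennreal (1 / p) = ennreal 1" using p by (simp add: divide_ennreal flip: ennreal_1)
  then show ?thesis using p by (subst (asm) ennreal_inj) auto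
qed

theorem theorem2:
  fixes r p :: real and p' :: ennreal
  assumes "1 \<le> r" and "r \<le> 2"
    and "1 \<le> p" and "p < 4 / 3"
    and "1 / ennreal p + 1 / p' = 1"
  shows "\<exists>C::real. \<forall>q::ennreal. 1 \<le> q \<longrightarrow> 3 * q \<le> p' \<longrightarrow>
    (\<forall>f :: real^2 \<Rightarrow> complex. schwartz f \<longrightarrow>
      L_norm q circle_measure (hl_maximal_powr r (fourier f))
        \<le> ennreal C * L_norm (ennreal p) lborel (\<lambda>x. ennreal (norm (f x))))"
proof (cases "p = 1")
  case True
  \<comment> \<open>For p = 1 the maximal function is bounded by the L^1 norm of f everywhere. One
    factor 1 + 2 pi comes from \<open>L_norm_circle_le\<close>, the other dominates the length of
    the circle for every q.\<close>
  define C where "C = (1 + 2 * pi) * (1 + 2 * pi)"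
  have C1: "1 \<le> C" using mult_mono[of 1 "1 + 2 * pi" 1 "1 + 2 * pi"] by (simp add: C_def)
  have "L_norm q circle_measure (hl_maximal_powr r (fourier f)) \<le> ennreal C * L_norm (ennreal p) lborel (\<lambda>x. ennreal (norm (f x)))"
    if q: "1 \<le> q" and "schwartz f" for q and f :: "real^2 \<Rightarrow> complex"
  proof -
    have f: "integrable lborel f" by (rule schwartz_integrable[OF \<open>schwartz f\<close>])
    then have [measurable]: "f \<in> borel_measurable borel" by auto
    define b where "b = (\<integral>x. norm (f x) \<partial>lborel)"
    have b0: "0 \<le> b" by (simp add: b_def)
    have rhs: "L_norm (ennreal p) lborel (\<lambda>x. ennreal (norm (f x))) = ennreal b"
      using nn_integral_eq_integral[OF integrable_norm[OF f]] b0 True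
      by (simp add: L_norm_def ennreal_powr_ennreal b_def flip: ennreal_1)
    have Fb: "norm (fourier f u) \<le> b" for u unfolding b_def by (rule norm_fourier_le)
    have Mb: "hl_maximal_powr r (fourier f) x \<le> ennreal b" for x
      by (rule order.trans[OF hl_maximal_powr_le_max2[OF _ Fb assms(1,2)] ennreal_leI[OF hl_maximal_max2(2)]]) (auto simp: Fb)
    show ?thesis
    proof (cases "q = \<infinity>")
      case True
      have "hl_maximal (\<lambda>y. norm (fourier f y) powr r) \<in> borel_measurable borel" by measurable
      then have "hl_maximal_powr r (fourier f) \<in> borel_measurable borel"
        unfolding hl_maximal_powr_def[abs_def] by measurable
      then have "hl_maximal_powr r (fourier f) \<in> borel_measurable circle_measure"
        unfolding circle_measure_def by (simp add: measurable_restrict_space1)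
      then have "esssup circle_measure (hl_maximal_powr r (fourier f)) \<le> ennreal b"
        by (rule esssup_I) (simp add: Mb)
      also have "\<dots> \<le> ennreal (C * b)"
        using b0 C1 mult_right_mono[of 1 C b] by (intro ennreal_leI) simp
      finally show ?thesis unfolding rhs using True b0 C1 by (simp add: L_norm_def ennreal_mult)
    next
      case False
      then obtain q' where q': "q = ennreal q'" "1 \<le> q'" using q by (cases q) auto
      show ?thesis
      proof (rule ennreal_le_epsilon)
        fix e :: real assume e: "0 < e"
        \<comment> \<open>The added e / C makes the level positive even when f vanishes almost
          everywhere, and costs exactly e in the final bound.\<close>
        define N where "N = b + e / C"
        have N: "0 < N" "b \<le> N" unfolding N_def using b0 e C1 by (auto intro!: add_nonneg_pos divide_pos_pos)
        have "L_norm (ennreal q') circle_measure (hl_maximal_powr r (fourier f)) \<le> ennreal ((1 + 2 * pi) * ((1 + 2 * pi) * N))"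
        proof (rule L_norm_circle_le[where N="\<lambda>x. N", OF _ _ _ q'(2) order_refl])
          show "hl_maximal_powr r (fourier f) x \<le> ennreal N" for x
            using order.trans[OF Mb ennreal_leI[OF N(2)]] .
          have "(\<integral>\<^sup>+t\<in>{0..<2 * pi}. ennreal (N powr q') \<partial>lborel) = ennreal (N powr q' * (2 * pi))"
            by (simp add: nn_integral_cmult_indicator ennreal_mult)
          also have "\<dots> \<le> ennreal (((1 + 2 * pi) * N) powr q')"
          proof (rule ennreal_leI)
            have "(1 + 2 * pi) powr 1 \<le> (1 + 2 * pi) powr q'" using q' by (intro powr_mono) auto
            then have "2 * pi \<le> (1 + 2 * pi) powr q'" by simp
            then have "N powr q' * (2 * pi) \<le> N powr q' * (1 + 2 * pi) powr q'" by (intro mult_left_mono) auto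
            then show "N powr q' * (2 * pi) \<le> ((1 + 2 * pi) * N) powr q'" using N by (simp add: powr_mult mult.commute)
          qed
          finally show "(\<integral>\<^sup>+t\<in>{0..<2 * pi}. ennreal (N powr q') \<partial>lborel) \<le> ennreal (((1 + 2 * pi) * N) powr q')" .
          show "0 < (1 + 2 * pi) * N" using N by (intro mult_pos_pos add_pos_pos) auto
        qed (use N in auto)
        also have "(1 + 2 * pi) * ((1 + 2 * pi) * N) = C * b + e"
          using C1 unfolding mult.assoc[symmetric] C_def[symmetric] N_def by (simp add: distrib_left)
        also have "ennreal (C * b + e) = ennreal C * ennreal b + ennreal e"
          using C1 b0 e by (simp add: ennreal_mult ennreal_plus)
        finally show "L_norm q circle_measure (hl_maximal_powr r (fourier f)) \<le> ennreal C * L_norm (ennreal p) lborel (\<lambda>x. ennreal (norm (f x))) + ennreal e"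
          unfolding rhs q'(1) .
      qed
    qed
  qed
  then show ?thesis by blast
next
  case False
  then have p1: "1 < p" using assms by simp
  obtain p0 where p0: "p' = ennreal p0" "1 < p0" "1 / p + 1 / p0 = 1"
    using conjugate_exponent[OF p1 assms(5)] .
  \<comment> \<open>With p' = 2 s the largest admissible q is p' / 3 = 2 s / 3, and p < 4/3 becomes
    s > 2.\<close>
  define s where "s = p0 / 2"
  have s: "2 < s" and ps: "p = 2 * s / (2 * s - 1)"
  proof -
    have "3 / 4 < 1 / p" using p1 assms(4) by (simp add: field_simps)
    then have "1 / p0 < 1 / 4" using p0(3) by linarith
    then show "2 < s" using p0(2) by (simp add: s_def field_simps)
    show "p = 2 * s / (2 * s - 1)" using p0 p1 by (simp add: s_def field_simps)
  qed
  define C where "C = (1 + 2 * pi) * restriction_const s"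
  have C: "0 < C" using restriction_const_pos[OF s] unfolding C_def by (intro mult_pos_pos add_pos_pos) auto
  have "L_norm q circle_measure (hl_maximal_powr r (fourier f)) \<le> ennreal C * L_norm (ennreal p) lborel (\<lambda>x. ennreal (norm (f x)))"
    if q: "1 \<le> q" "3 * q \<le> p'" and "schwartz f" for q and f :: "real^2 \<Rightarrow> complex"
  proof -
    have f: "integrable lborel f" by (rule schwartz_integrable[OF \<open>schwartz f\<close>])
    then have [measurable]: "f \<in> borel_measurable borel" by auto
    \<comment> \<open>For p > 1 the conjugate exponent is finite, so the essential supremum branch
      of \<open>L_norm\<close> does not occur.\<close>
    have "q \<noteq> \<infinity>" using q(2) p0(1) by (auto simp: ennreal_mult_top top_unique)
    then obtain q' where q': "q = ennreal q'" "1 \<le> q'" using q(1) by (cases q) auto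
    have "3 * q = ennreal (3 * q')" using q' by (simp add: ennreal_mult)
    then have qs: "q' \<le> 2 * s / 3" using q(2) p0 q' by (simp add: s_def)
    define F where "F = (\<lambda>u. norm (fourier f u))"
    have [measurable]: "F \<in> borel_measurable borel" unfolding F_def by measurable
    have Fa: "\<bar>F u\<bar> \<le> (\<integral>x. norm (f x) \<partial>lborel)" for u unfolding F_def by (auto intro: norm_fourier_le)
    have MF: "hl_maximal_powr r (fourier f) x \<le> ennreal (max2 F x)" for x
      unfolding F_def by (rule hl_maximal_powr_le_max2[OF _ norm_fourier_le assms(1,2)]) measurable
    show ?thesis
    proof (cases "(\<integral>\<^sup>+x. ennreal (norm (f x) powr p) \<partial>lborel)")
      case top
      then have "L_norm (ennreal p) lborel (\<lambda>x. ennreal (norm (f x))) = top"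
        using p1 by (simp add: L_norm_def ennreal_powr_ennreal) (simp add: ennreal_powr_def)
      then show ?thesis using C by (simp add: ennreal_mult_top)
    next
      case (real I)
      define Fp where "Fp = I powr (1 / p)"
      have rhs: "L_norm (ennreal p) lborel (\<lambda>x. ennreal (norm (f x))) = ennreal Fp"
        using p1 real by (simp add: L_norm_def ennreal_powr_ennreal Fp_def)
      have Fp: "0 \<le> Fp" "I = Fp powr p" using real p1 by (auto simp: Fp_def powr_powr)
      show ?thesis unfolding rhs
      proof (rule ennreal_le_epsilon)
        fix e :: real assume e: "0 < e"
        \<comment> \<open>Again a perturbation by e / C, since the endpoint and the interpolation on
          the circle work with a positive level while the norm of f may be 0.\<close>
        define A where "A = restriction_const s * (Fp + e / C)"
        have eC: "0 < e / C" using e C by simp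
        have A: "0 < A" unfolding A_def using Fp eC restriction_const_pos[OF s] by (intro mult_pos_pos) auto
        have "L_norm q circle_measure (hl_maximal_powr r (fourier f)) \<le> ennreal ((1 + 2 * pi) * A)"
          unfolding q'(1)
        proof (rule L_norm_circle_le[where N="max2 F", OF _ _ MF q'(2) qs A])
          show "0 \<le> max2 F x" for x by (rule hl_maximal_max2(3)[OF Fa])
          show "(\<integral>\<^sup>+t\<in>{0..<2 * pi}. ennreal (max2 F (circ t) powr (2 * s / 3)) \<partial>lborel) \<le> ennreal (A powr (2 * s / 3))"
            unfolding F_def A_def
          proof (rule maximal_restriction_endpoint[OF s f])
            have "(\<integral>\<^sup>+x. ennreal (norm (f x) powr p) \<partial>lborel) \<le> ennreal ((Fp + e / C) powr p)"
              unfolding real Fp(2) using Fp eC p1 by (intro ennreal_leI powr_mono2) auto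
            then show "(\<integral>\<^sup>+x. ennreal (norm (f x) powr (2 * s / (2 * s - 1))) \<partial>lborel) \<le> ennreal ((Fp + e / C) powr (2 * s / (2 * s - 1)))"
              unfolding ps .
          qed (use Fp eC in auto)
        qed measurable
        also have "(1 + 2 * pi) * A = C * Fp + e" using C by (simp add: A_def C_def[symmetric] mult.assoc[symmetric] distrib_left)
        also have "ennreal (C * Fp + e) = ennreal C * ennreal Fp + ennreal e"
          using C Fp e by (simp add: ennreal_mult ennreal_plus)
        finally show "L_norm q circle_measure (hl_maximal_powr r (fourier f)) \<le> ennreal C * ennreal Fp + ennreal e" .
      qed
    qed
  qed
  then show ?thesis by blast
qed

end
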